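(* Let $W_1,W_2$ be Coxeter groups with sets of simple generators $S_1,S_2$. Then the following hold. (1) For all $u_1,v_1\in W_1$ and $u_2,v_2\in W_2$ such that $[u_1,v_1]$ is a short edge interval and the Bruhat intervals $[u_1,v_1]$ and $[u_2,v_2]$ are isomorphic as posets: (a) $R_{u_1,v_1}=R_{u_2,v_2}$, and (b) $P_{u_1,v_1}=P_{u_2,v_2}$. (2) For all $J_1\subseteq S_1$, $J_2\subseteq S_2$, $u_1,v_1\in W_1^{J_1}$, $u_2,v_2\in W_2^{J_2}$ such that $[u_1,v_1]$ is a short edge interval and there is a poset isomorphism $\varphi:[u_1,v_1]\to[u_2,v_2]$ restricting to an isomorphism $[u_1,v_1]^{J_1}\to[u_2,v_2]^{J_2}$: (a) $R^{J_1,x}_{u_1,v_1}=R^{J_2,x}_{u_2,v_2}$ for $x\in\{-1,q\}$, and (b) $P^{J_1,x}_{u_1,v_1}=P^{J_2,x}_{u_2,v_2}$ for $x\in\{-1,q\}$. (3) For all $J_1\subseteq S_1$, $J_2\subseteq S_2$, $u_1,v_1\in W_1^{J_1}$, $u_2,v_2\in W_2^{J_2}$ such that $[u_1,v_1]$ is a short edge interval and there is a poset isomorphism $\varphi:[u_1,v_1]\to[u_2,v_2]$ restricting to a bijection $A^{J_1}_{u_1,v_1}\to A^{J_2}_{u_2,v_2}$: (a) $R^{J_1,x}_{u_1,v_1}=R^{J_2,x}_{u_2,v_2}$ for $x\in\{-1,q\}$, and (b) $P^{J_1,q}_{u_1,v_1}=P^{J_2,q}_{u_2,v_2}$.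
   Context: Let $W$ be a Coxeter group with set of simple generators $S$, length function $\ell$ and identity $e$; let $J\subseteq S$. $W_J$ is the parabolic subgroup generated by $J$ and $W^J$ is the set of minimum-length representatives of the left cosets $wW_J$. $\leq$ denotes the (strong) Bruhat order on $W$, $\lessdot$ its cover relation, and $[u,v]=\{y\in W\mid u\leq y\leq v\}$, viewed as a poset under Bruhat order. For $u,v\in W^J$ put $[u,v]^J=[u,v]\cap W^J$ (with the induced order) and $A^J_{u,v}=\{a\in W^J\mid u\lessdot a\leq v\}$. The Bruhat graph of $W$ is the directed graph with vertex set $W$ and directed edges $y\to y'$ whenever $y'=yt$ for some reflection $t$ (a conjugate of an element of $S$) and $\ell(y)<\ell(y')$. A Bruhat interval $[u,v]$ is a short edge interval if all edges $y\to y'$ in the Bruhat graph restricted to $[u,v]$ have $\ell(y')-\ell(y)=1$. Parabolic $R$-polynomials: for $x\in\{-1,q\}$, the family of polynomials $\{R^{J,x}_{u,v}\}_{u,v\in W^J}\subset\mathbb{Z}[q]$ is uniquely determined by: (i) $R^{J,x}_{u,v}=0$ if $u\not\leq v$; (ii) $R^{J,x}_{u,u}=1$; (iii) for all $s\in S$ with $\ell(sv)<\ell(v)$, $R^{J,x}_{u,v}$ equals $R^{J,x}_{su,sv}$ if $\ell(su)<\ell(u)$; equals $(q-1)R^{J,x}_{u,sv}+qR^{J,x}_{su,sv}$ if $\ell(su)>\ell(u)$ and $su\in W^J$; and equals $(q-1-x)R^{J,x}_{u,sv}$ if $\ell(su)>\ell(u)$ but $su\notin W^J$. Parabolic Kazhdan--Lusztig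 polynomials: for $x\in\{-1,q\}$, the family of polynomials $\{P^{J,x}_{u,v}\}_{u,v\in W^J}\subset\mathbb{Z}[q]$ is uniquely determined by: (i) $P^{J,x}_{u,v}=0$ if $u\not\leq v$; (ii) $P^{J,x}_{u,u}=1$; (iii) $\deg P^{J,x}_{u,v}\leq\frac12(\ell(v)-\ell(u)-1)$ if $u<v$; (iv) $q^{\ell(v)-\ell(u)}P^{J,x}_{u,v}(q^{-1})=\sum_{\sigma\in[u,v]^J}R^{J,x}_{u,\sigma}P^{J,x}_{\sigma,v}$. The ordinary polynomials $R_{u,v}$ and $P_{u,v}$ ($u,v\in W$) are the case $J=\emptyset$, which is independent of $x$. *)

theory Defs
  imports "HOL-Algebra.Generated_Groups" "HOL-Computational_Algebra.Polynomial"
begin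

definition word_prod :: "('a, 'm) monoid_scheme \<Rightarrow> 'a list \<Rightarrow> 'a" where
  "word_prod G ws = foldr (\<lambda>x y. x \<otimes>\<^bsub>G\<^esub> y) ws \<one>\<^bsub>G\<^esub>"

text \<open>The entry 0 of a Coxeter matrix stands for infinity.\<close>

definition coxeter_matrix :: "'a set \<Rightarrow> ('a \<Rightarrow> 'a \<Rightarrow> nat) \<Rightarrow> bool" where
  "coxeter_matrix S m \<longleftrightarrow>
     (\<forall>s\<in>S. m s s = 1) \<and> (\<forall>s\<in>S. \<forall>t\<in>S. m s t = m t s \<and> (s \<noteq> t \<longrightarrow> m s t \<noteq> 1))"

text \<open>One application of a relator \<open>(s t)\<^sup>m\<close>, where \<open>m = m s t\<close>; an entry 0 gives the empty relator,
  that is, no relation.\<close>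

inductive coxeter_step :: "'a set \<Rightarrow> ('a \<Rightarrow> 'a \<Rightarrow> nat) \<Rightarrow> 'a list \<Rightarrow> 'a list \<Rightarrow> bool" for S m where
  "\<lbrakk>as \<in> lists S; bs \<in> lists S; s \<in> S; t \<in> S\<rbrakk> \<Longrightarrow>
     coxeter_step S m (as @ concat (replicate (m s t) [s, t]) @ bs) (as @ bs)"

text \<open>\<open>G\<close> has the presentation with generators \<open>S\<close> and relators \<open>(s t)\<^sup>m\<close>. The relators
  with \<open>s = t\<close> are \<open>s s\<close>, so every generator is its own inverse, the monoid so presented is the
  group so presented, and words need no formal inverses.\<close>

definition coxeter_system :: "('a, 'm) monoid_scheme \<Rightarrow> 'a set \<Rightarrow> bool" where
  "coxeter_system G S \<longleftrightarrow>
     group G \<and> S \<subseteq> carrier G \<and>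
     (\<exists>m. coxeter_matrix S m \<and>
        word_prod G ` lists S = carrier G \<and>
        (\<forall>ws\<in>lists S. \<forall>ws'\<in>lists S.
           word_prod G ws = word_prod G ws' \<longleftrightarrow> equivclp (coxeter_step S m) ws ws'))"

definition cox_length :: "('a, 'm) monoid_scheme \<Rightarrow> 'a set \<Rightarrow> 'a \<Rightarrow> nat" where
  "cox_length G S w = (LEAST n. \<exists>ws\<in>lists S. length ws = n \<and> word_prod G ws = w)"

definition reflections :: "('a, 'm) monoid_scheme \<Rightarrow> 'a set \<Rightarrow> 'a set" where
  "reflections G S = {w \<otimes>\<^bsub>G\<^esub> s \<otimes>\<^bsub>G\<^esub> inv\<^bsub>G\<^esub> w | w s. w \<in> carrier G \<and> s \<in> S}"

definition bruhat_edge :: "('a, 'm) monoid_scheme \<Rightarrow> 'a set \<Rightarrow> 'a \<Rightarrow> 'a \<Rightarrow> bool" where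
  "bruhat_edge G S y y' \<longleftrightarrow>
     y \<in> carrier G \<and> (\<exists>t\<in>reflections G S. y' = y \<otimes>\<^bsub>G\<^esub> t) \<and> cox_length G S y < cox_length G S y'"

definition bruhat_le :: "('a, 'm) monoid_scheme \<Rightarrow> 'a set \<Rightarrow> 'a \<Rightarrow> 'a \<Rightarrow> bool" where
  "bruhat_le G S u v \<longleftrightarrow> u \<in> carrier G \<and> v \<in> carrier G \<and> (bruhat_edge G S)\<^sup>*\<^sup>* u v"

definition bruhat_less :: "('a, 'm) monoid_scheme \<Rightarrow> 'a set \<Rightarrow> 'a \<Rightarrow> 'a \<Rightarrow> bool" where
  "bruhat_less G S u v \<longleftrightarrow> bruhat_le G S u v \<and> u \<noteq> v"

definition bruhat_cover :: "('a, 'm) monoid_scheme \<Rightarrow> 'a set \<Rightarrow> 'a \<Rightarrow> 'a \<Rightarrow> bool" where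
  "bruhat_cover G S u v \<longleftrightarrow>
     bruhat_less G S u v \<and> (\<nexists>y. bruhat_less G S u y \<and> bruhat_less G S y v)"

definition bruhat_interval :: "('a, 'm) monoid_scheme \<Rightarrow> 'a set \<Rightarrow> 'a \<Rightarrow> 'a \<Rightarrow> 'a set" where
  "bruhat_interval G S u v = {y \<in> carrier G. bruhat_le G S u y \<and> bruhat_le G S y v}"

definition short_edge_interval :: "('a, 'm) monoid_scheme \<Rightarrow> 'a set \<Rightarrow> 'a \<Rightarrow> 'a \<Rightarrow> bool" where
  "short_edge_interval G S u v \<longleftrightarrow>
     (\<forall>y\<in>bruhat_interval G S u v. \<forall>y'\<in>bruhat_interval G S u v.
        bruhat_edge G S y y' \<longrightarrow> cox_length G S y' = cox_length G S y + 1)"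

definition poset_iso ::
  "'a set \<Rightarrow> ('a \<Rightarrow> 'a \<Rightarrow> bool) \<Rightarrow> 'b set \<Rightarrow> ('b \<Rightarrow> 'b \<Rightarrow> bool) \<Rightarrow> ('a \<Rightarrow> 'b) \<Rightarrow> bool" where
  "poset_iso A leA B leB f \<longleftrightarrow>
     bij_betw f A B \<and> (\<forall>x\<in>A. \<forall>y\<in>A. leA x y \<longleftrightarrow> leB (f x) (f y))"

definition min_coset_reps :: "('a, 'm) monoid_scheme \<Rightarrow> 'a set \<Rightarrow> 'a set \<Rightarrow> 'a set" where
  "min_coset_reps G S J =
     {w \<in> carrier G. \<forall>y \<in> w <#\<^bsub>G\<^esub> generate G J. cox_length G S w \<le> cox_length G S y}"

definition parabolic_interval ::
  "('a, 'm) monoid_scheme \<Rightarrow> 'a set \<Rightarrow> 'a set \<Rightarrow> 'a \<Rightarrow> 'a \<Rightarrow> 'a set" where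
  "parabolic_interval G S J u v = bruhat_interval G S u v \<inter> min_coset_reps G S J"

definition parabolic_atoms ::
  "('a, 'm) monoid_scheme \<Rightarrow> 'a set \<Rightarrow> 'a set \<Rightarrow> 'a \<Rightarrow> 'a \<Rightarrow> 'a set" where
  "parabolic_atoms G S J u v =
     {a \<in> min_coset_reps G S J. bruhat_cover G S u a \<and> bruhat_le G S a v}"

definition q_var :: "int poly" where
  "q_var = [:0, 1:]"

text \<open>The parameter \<open>x\<close> is meant to be \<open>- 1\<close> or \<open>q_var\<close>. The first condition below is not part of the
  mathematics: it pins down the family, which is a total function here, off the index set.\<close>

definition parabolic_R_family ::
  "('a, 'm) monoid_scheme \<Rightarrow> 'a set \<Rightarrow> 'a set \<Rightarrow> int poly \<Rightarrow> ('a \<Rightarrow> 'a \<Rightarrow> int poly) \<Rightarrow> bool" where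
  "parabolic_R_family G S J x R \<longleftrightarrow>
     (\<forall>u v. u \<notin> min_coset_reps G S J \<or> v \<notin> min_coset_reps G S J \<longrightarrow> R u v = 0) \<and>
     (\<forall>u\<in>min_coset_reps G S J. \<forall>v\<in>min_coset_reps G S J.
        (\<not> bruhat_le G S u v \<longrightarrow> R u v = 0) \<and>
        R u u = 1 \<and>
        (\<forall>s\<in>S. cox_length G S (s \<otimes>\<^bsub>G\<^esub> v) < cox_length G S v \<longrightarrow>
           (cox_length G S (s \<otimes>\<^bsub>G\<^esub> u) < cox_length G S u \<longrightarrow>
              R u v = R (s \<otimes>\<^bsub>G\<^esub> u) (s \<otimes>\<^bsub>G\<^esub> v)) \<and>
           (cox_length G S (s \<otimes>\<^bsub>G\<^esub> u) > cox_length G S u \<and> s \<otimes>\<^bsub>G\<^esub> u \<in> min_coset_reps G S J \<longrightarrow>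
              R u v = (q_var - 1) * R u (s \<otimes>\<^bsub>G\<^esub> v) + q_var * R (s \<otimes>\<^bsub>G\<^esub> u) (s \<otimes>\<^bsub>G\<^esub> v)) \<and>
           (cox_length G S (s \<otimes>\<^bsub>G\<^esub> u) > cox_length G S u \<and> s \<otimes>\<^bsub>G\<^esub> u \<notin> min_coset_reps G S J \<longrightarrow>
              R u v = (q_var - 1 - x) * R u (s \<otimes>\<^bsub>G\<^esub> v))))"

definition parabolic_R ::
  "('a, 'm) monoid_scheme \<Rightarrow> 'a set \<Rightarrow> 'a set \<Rightarrow> int poly \<Rightarrow> 'a \<Rightarrow> 'a \<Rightarrow> int poly" where
  "parabolic_R G S J x = (THE R. parabolic_R_family G S J x R)"

text \<open>The polynomial \<open>q\<^sup>n p(q\<^sup>-\<^sup>1)\<close>, for \<open>degree p \<le> n\<close>.\<close>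

definition q_reverse :: "nat \<Rightarrow> int poly \<Rightarrow> int poly" where
  "q_reverse n p = (\<Sum>i\<le>degree p. monom (coeff p i) (n - i))"

text \<open>The degree bound is stated without division. It implies the assumption of
  \<open>q_reverse\<close> in the last condition; if \<open>u \<le> v\<close> fails there, then both sides are 0.\<close>

definition parabolic_P_family ::
  "('a, 'm) monoid_scheme \<Rightarrow> 'a set \<Rightarrow> 'a set \<Rightarrow> int poly \<Rightarrow> ('a \<Rightarrow> 'a \<Rightarrow> int poly) \<Rightarrow> bool" where
  "parabolic_P_family G S J x P \<longleftrightarrow>
     (\<forall>u v. u \<notin> min_coset_reps G S J \<or> v \<notin> min_coset_reps G S J \<longrightarrow> P u v = 0) \<and>
     (\<forall>u\<in>min_coset_reps G S J. \<forall>v\<in>min_coset_reps G S J.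
        (\<not> bruhat_le G S u v \<longrightarrow> P u v = 0) \<and>
        P u u = 1 \<and>
        (bruhat_less G S u v \<longrightarrow> 2 * degree (P u v) + 1 \<le> cox_length G S v - cox_length G S u) \<and>
        q_reverse (cox_length G S v - cox_length G S u) (P u v) =
          (\<Sum>\<sigma>\<in>parabolic_interval G S J u v. parabolic_R G S J x u \<sigma> * P \<sigma> v))"

definition parabolic_P ::
  "('a, 'm) monoid_scheme \<Rightarrow> 'a set \<Rightarrow> 'a set \<Rightarrow> int poly \<Rightarrow> 'a \<Rightarrow> 'a \<Rightarrow> int poly" where
  "parabolic_P G S J x = (THE P. parabolic_P_family G S J x P)"

text \<open>For \<open>J = {}\<close> all elements are minimal representatives, the case with \<open>q_var - 1 - x\<close> never
  occurs, and the choice of \<open>x\<close> is irrelevant.\<close>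

definition ordinary_R :: "('a, 'm) monoid_scheme \<Rightarrow> 'a set \<Rightarrow> 'a \<Rightarrow> 'a \<Rightarrow> int poly" where
  "ordinary_R G S = parabolic_R G S {} (- 1)"

definition ordinary_P :: "('a, 'm) monoid_scheme \<Rightarrow> 'a set \<Rightarrow> 'a \<Rightarrow> 'a \<Rightarrow> int poly" where
  "ordinary_P G S = parabolic_P G S {} (- 1)"

end

theory Submission
  imports Defs
begin

text \<open>
  The key is a closed formula. Let \<open>u \<le> v\<close> be minimal coset representatives whose interval has short
  edges, let \<open>n\<close> be the length difference and \<open>m\<close> the number of \<open>r \<in> J\<close> with \<open>u r \<le> v\<close>. Then
  \<open>R\<^sup>J\<^sup>,\<^sup>x = (q - 1)\<^sup>n\<^sup>-\<^sup>m (q - 1 - x)\<^sup>m\<close> (\<open>R_short\<close>). Indeed, in the recursion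
  along a generator \<open>s\<close>, the term with the two elements \<open>s u\<close> and \<open>s v\<close> for \<open>u < s u\<close> vanishes: a
  relation \<open>s u \<le> s v\<close> would give a path from \<open>u\<close> to \<open>v\<close> in the Bruhat graph with only \<open>n - 2\<close>
  edges. As the elements \<open>u r\<close> are the atoms of the interval outside the minimal representatives,
  \<open>m\<close> and \<open>n\<close> depend on the poset and the parabolic atoms only (\<open>card_atoms_split\<close>).

  The formula must be available in both intervals, while only the first one is assumed to have short edges.
  The property is therefore characterised in terms of the poset: no interval of length three inside
  has exactly two atoms (\<open>short_edge_iff\<close>). A long edge of least length difference has length
  difference three (\<open>long_edge_path3\<close>), and in length three the bottom is joined to the top by an edge
  exactly when there are two atoms (\<open>card_atoms_3\<close>). The last equivalence is proved by induction along
  left descents. The induction step compares numbers of atoms, and it could fail only if an element had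
  three covers labelled by reflections with coplanar roots. Such covers do not exist
  (\<open>three_covers_not_planar\<close>): if three reflections with coplanar roots increase the length of an
  element, the one with the middle root does not give a cover. For this a root system is needed. The representation is enlarged so that the coroots of
  different reflections are linearly independent; then an equation \<open>a b = c d\<close> between reflections
  forces their roots into one plane (\<open>in_plane\<close>), and this applies to every diamond in the Bruhat order.

  The Kazhdan-Lusztig polynomials are computed from R-polynomials of subintervals, upwards in the length
  difference. An isomorphism that respects the minimal representatives respects all the data
  (\<open>P_invariant\<close>); with \<open>J = {}\<close> this is the ordinary case. If only the parabolic atoms are respected
  and \<open>x = q\<close>, the polynomial is the alternating sum of the ordinary Kazhdan-Lusztig polynomials of \<open>y\<close> and
  \<open>v\<close>, where \<open>y\<close> runs through the elements of the coset of \<open>u\<close> in the interval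
  (\<open>parabolic_P_q_interval\<close>). These \<open>y\<close> are the elements of the interval without a parabolic
  atom below them (\<open>nonparabolic_interval\<close>), which is again a description in terms of the isomorphism.

  The polynomials are given by definite descriptions, so the existence of both families is part of the
  proof. Ordinary R-polynomials come from operators that multiply like the inverses of the
  standard generators of the Hecke algebra (\<open>fold_Ll_cong\<close>), parabolic ones by alternating
  summation over cosets (\<open>RJ_rec\<close>). The Kazhdan-Lusztig polynomials exist because the matrix of
  R-polynomials is inverted by reversal of its entries (\<open>R_Rbar\<close>).
\<close>


section \<open>Coxeter systems, words and length\<close>

locale coxeter = group G for G :: "('a, 'm) monoid_scheme" (structure) +
  fixes S :: "'a set"
  assumes coxeter_system: "coxeter_system G S"
begin

abbreviation "wp \<equiv> word_prod G"
abbreviation "len \<equiv> cox_length G S"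
abbreviation "T \<equiv> reflections G S"

text \<open>A Coxeter matrix of the presentation, kept fixed from here on.\<close>

definition mat :: "'a \<Rightarrow> 'a \<Rightarrow> nat" where
  "mat = (SOME m. coxeter_matrix S m \<and> wp ` lists S = carrier G \<and>
        (\<forall>ws\<in>lists S. \<forall>ws'\<in>lists S. wp ws = wp ws' \<longleftrightarrow> equivclp (coxeter_step S m) ws ws'))"

lemma mat: "coxeter_matrix S mat" "wp ` lists S = carrier G"
    "\<And>ws ws'. ws \<in> lists S \<Longrightarrow> ws' \<in> lists S \<Longrightarrow> wp ws = wp ws' \<longleftrightarrow> equivclp (coxeter_step S mat) ws ws'"
proof -
  have "\<exists>m. coxeter_matrix S m \<and> wp ` lists S = carrier G \<and>
        (\<forall>ws\<in>lists S. \<forall>ws'\<in>lists S. wp ws = wp ws' \<longleftrightarrow> equivclp (coxeter_step S m) ws ws')"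
    using coxeter_system unfolding coxeter_system_def by blast
  from someI_ex[OF this, folded mat_def]
  show "coxeter_matrix S mat" "wp ` lists S = carrier G"
    "\<And>ws ws'. ws \<in> lists S \<Longrightarrow> ws' \<in> lists S \<Longrightarrow> wp ws = wp ws' \<longleftrightarrow> equivclp (coxeter_step S mat) ws ws'"
    by blast+
qed

lemma S_carrier [intro]: "s \<in> S \<Longrightarrow> s \<in> carrier G"
  using coxeter_system unfolding coxeter_system_def by blast

lemma wp_Nil [simp]: "wp [] = \<one>" by (simp add: word_prod_def)
lemma wp_Cons [simp]: "wp (s # ws) = s \<otimes> wp ws" by (simp add: word_prod_def)
lemma wp_closed [simp, intro]: "ws \<in> lists S \<Longrightarrow> wp ws \<in> carrier G"
  by (induction ws) auto
lemma wp_closed' [simp]: "\<forall>x\<in>set ws. x \<in> S \<Longrightarrow> wp ws \<in> carrier G"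
  using wp_closed[of ws] by (auto simp: in_lists_conv_set)
lemma wp_append: "as \<in> lists S \<Longrightarrow> bs \<in> lists S \<Longrightarrow> wp (as @ bs) = wp as \<otimes> wp bs"
  by (induction as) (auto simp: m_assoc S_carrier)
lemma wp_ex: "w \<in> carrier G \<Longrightarrow> \<exists>ws\<in>lists S. wp ws = w"
  using mat(2) by (metis imageE)

lemma S_sq: assumes "s \<in> S" shows "s \<otimes> s = \<one>"
proof -
  have "mat s s = 1" using mat(1) assms by (auto simp: coxeter_matrix_def)
  hence "coxeter_step S mat [s, s] []"
    using coxeter_step.intros[of "[]" S "[]" s s mat] assms by simp
  hence "wp [s, s] = wp []" using mat(3)[of "[s,s]" "[]"] assms
    by (simp add: r_into_equivclp)
  thus ?thesis using assms by (simp add: S_carrier)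
qed

lemma S_inv: "s \<in> S \<Longrightarrow> inv s = s"
  using S_sq S_carrier by (metis inv_equality)
lemma S_cancel: "s \<in> S \<Longrightarrow> w \<in> carrier G \<Longrightarrow> s \<otimes> (s \<otimes> w) = w"
  by (metis S_carrier S_sq l_one m_assoc)
lemma S_cancel_right: "s \<in> S \<Longrightarrow> w \<in> carrier G \<Longrightarrow> w \<otimes> s \<otimes> s = w"
  by (metis S_carrier S_sq r_one m_assoc)

lemma inv_cancel: "x \<in> carrier G \<Longrightarrow> w \<in> carrier G \<Longrightarrow> inv x \<otimes> (x \<otimes> w) = w"
  by (simp flip: m_assoc)

lemma foldr_alternating:
  "foldr F (concat (replicate n [s, t])) = (F s \<circ> F t) ^^ n"
  by (induction n) (auto simp: comp_def fun_eq_iff)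

lemma foldr_append_comp: "foldr F (as @ bs) = foldr F as \<circ> foldr F bs"
  by (simp add: fun_eq_iff)

text \<open>The universal property of the presentation, for maps into the monoid of self-maps of any type:
  the \<open>F s\<close> are composed along a word, and a relator acts as the identity. It is used for the
  parity of words, for the reflection cocycle and for the geometric representation.\<close>

lemma word_action_cong:
  assumes F: "\<And>s t. s \<in> S \<Longrightarrow> t \<in> S \<Longrightarrow> (F s \<circ> F t) ^^ mat s t = id"
    and ws: "ws \<in> lists S" "ws' \<in> lists S" "wp ws = wp ws'"
  shows "foldr F ws = foldr F ws'"
proof -
  have "equivclp (coxeter_step S mat) ws ws'" using mat(3) ws by blast
  moreover have step: "foldr F x = foldr F y" if "coxeter_step S mat x y" for x y
    using that by cases (simp add: foldr_append_comp foldr_alternating F)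
  ultimately show ?thesis by (induction rule: equivclp_induct) auto
qed

lemma len_le: "ws \<in> lists S \<Longrightarrow> len (wp ws) \<le> length ws"
  unfolding cox_length_def by (rule Least_le) auto

lemma reduced_ex:
  assumes "w \<in> carrier G"
  obtains ws where "ws \<in> lists S" "wp ws = w" "length ws = len w"
proof -
  have "\<exists>n. \<exists>ws\<in>lists S. length ws = n \<and> wp ws = w" using wp_ex[OF assms] by blast
  from LeastI_ex[OF this] show ?thesis using that unfolding cox_length_def by blast
qed

lemma len_one [simp]: "len \<one> = 0"
  using len_le[of "[]"] by simp

lemma len_eq_0: "w \<in> carrier G \<Longrightarrow> len w = 0 \<longleftrightarrow> w = \<one>"
  by (metis reduced_ex len_one length_0_conv wp_Nil)

lemma wp_snoc: "ws \<in> lists S \<Longrightarrow> s \<in> S \<Longrightarrow> wp (ws @ [s]) = wp ws \<otimes> s"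
  by (simp add: wp_append S_carrier)

lemma wp_rev: "ws \<in> lists S \<Longrightarrow> wp (rev ws) = inv (wp ws)"
proof (induction ws rule: list.induct)
  case (Cons s ws)
  then have "wp (rev (s # ws)) = wp (rev ws @ [s])" by simp
  also have "\<dots> = wp (rev ws) \<otimes> s" using Cons by (intro wp_snoc) auto
  finally show ?case using Cons by (auto simp: inv_mult_group S_inv S_carrier)
qed simp

lemma len_inv: assumes "w \<in> carrier G" shows "len (inv w) = len w"
proof -
  have *: "len (inv w) \<le> len w" if w: "w \<in> carrier G" for w
  proof -
    obtain ws where "ws \<in> lists S" "wp ws = w" "length ws = len w" using reduced_ex[OF w] .
    thus ?thesis using len_le[of "rev ws"] wp_rev[of ws] by (auto simp: in_lists_conv_set)
  qed
  from *[OF assms] *[of "inv w"] assms show ?thesis by simp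
qed

lemma len_mult: assumes "x \<in> carrier G" "y \<in> carrier G" shows "len (x \<otimes> y) \<le> len x + len y"
proof -
  obtain xs where x: "xs \<in> lists S" "wp xs = x" "length xs = len x" using reduced_ex[OF assms(1)] .
  obtain ys where y: "ys \<in> lists S" "wp ys = y" "length ys = len y" using reduced_ex[OF assms(2)] .
  show ?thesis using len_le[of "xs @ ys"] wp_append[of xs ys] x y by auto
qed

lemma len_S_le: "s \<in> S \<Longrightarrow> len s \<le> 1"
  using len_le[of "[s]"] by (auto simp: S_carrier)

text \<open>Every generator acts on the booleans as negation; the relators have even length.\<close>

lemma even_len:
  assumes "ws \<in> lists S" shows "even (len (wp ws)) = even (length ws)"
proof -
  have *: "foldr (\<lambda>_. Not) ws = (if even (length ws) then id else Not)" for ws :: "'a list"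
    by (induction ws) (auto simp: fun_eq_iff)
  obtain ws' where ws': "ws' \<in> lists S" "wp ws' = wp ws" "length ws' = len (wp ws)"
    using reduced_ex assms by (metis wp_closed)
  have "foldr (\<lambda>_. Not) ws = foldr (\<lambda>_. Not) ws'"
  proof (rule word_action_cong)
    fix s t show "(Not \<circ> Not) ^^ mat s t = id"
      by (simp add: comp_def flip: id_def)
  qed (use assms ws' in auto)
  thus ?thesis using ws' unfolding * by (auto simp: fun_eq_iff split: if_splits)
qed

lemma even_len_mult:
  assumes "x \<in> carrier G" "y \<in> carrier G"
  shows "even (len (x \<otimes> y)) = even (len x + len y)"
proof -
  obtain xs where x: "xs \<in> lists S" "wp xs = x" "length xs = len x" using reduced_ex[OF assms(1)] .
  obtain ys where y: "ys \<in> lists S" "wp ys = y" "length ys = len y" using reduced_ex[OF assms(2)] .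
  show ?thesis using even_len[of "xs @ ys"] wp_append[of xs ys] x y by auto
qed

section \<open>The reflection cocycle and strong exchange\<close>

text \<open>The classical action of a generator on signed reflections: conjugation, with a change of sign
  exactly at the generator itself. Outside the carrier nothing moves, so that the relators act as the
  identity on the whole type.\<close>

definition flip :: "'a \<Rightarrow> 'a \<times> bool \<Rightarrow> 'a \<times> bool" where
  "flip s = (\<lambda>(t, b). if t \<in> carrier G then (s \<otimes> t \<otimes> s, b \<noteq> (t = s)) else (t, b))"

lemma flip_apply: "t \<in> carrier G \<Longrightarrow> flip s (t, b) = (s \<otimes> t \<otimes> s, b \<noteq> (t = s))"
  by (simp add: flip_def)

text \<open>The sign of \<open>r\<close> changes once for every \<open>i < 2 k\<close> with \<open>r = t (s t)\<^sup>i\<close>; these are the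
  reflections of the dihedral word \<open>(s t)\<^sup>k\<close>, in order.\<close>

lemma flip_power:
  assumes st: "s \<in> S" "t \<in> S" and r: "r \<in> carrier G"
  shows "((flip s \<circ> flip t) ^^ k) (r, b) =
    ((s \<otimes> t) [^] k \<otimes> r \<otimes> inv ((s \<otimes> t) [^] k),
     b \<noteq> odd (\<Sum>i<2*k. of_bool (r = t \<otimes> (s \<otimes> t) [^] i) :: nat))"
proof (induction k)
  case 0 thus ?case using r by simp
next
  case (Suc k)
  let ?p = "s \<otimes> t" let ?q = "?p [^] k"
  have c [simp]: "s \<in> carrier G" "t \<in> carrier G" using st by auto
  have q: "?q \<in> carrier G" by simp
  have tq: "?p [^] k \<otimes> t \<otimes> ?p [^] k = t" for k :: nat
  proof (induction k rule: nat.induct)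
    case (Suc k)
    have "?p [^] Suc k = ?p \<otimes> ?p [^] k" by (intro nat_pow_Suc2) simp
    hence "?p [^] Suc k \<otimes> t \<otimes> ?p [^] Suc k = (?p [^] k \<otimes> ?p) \<otimes> t \<otimes> (?p \<otimes> ?p [^] k)" by simp
    also have "\<dots> = ?p [^] k \<otimes> (?p \<otimes> t \<otimes> ?p) \<otimes> ?p [^] k" by (simp add: m_assoc)
    also have "?p \<otimes> t \<otimes> ?p = t"
      using st by (simp add: m_assoc S_cancel S_sq)
    finally show ?case using Suc by simp
  qed simp
  have ct: "?q \<otimes> r \<otimes> inv ?q = t \<longleftrightarrow> r = t \<otimes> ?p [^] (2*k)"
  proof -
    have "?q \<otimes> r \<otimes> inv ?q = t \<longleftrightarrow> ?q \<otimes> r = t \<otimes> ?q"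
      by (metis q r c(2) inv_closed inv_solve_right m_closed)
    also have "\<dots> \<longleftrightarrow> ?q \<otimes> r = ?q \<otimes> (t \<otimes> ?q \<otimes> ?q)"
      using tq[of k] q by (simp add: m_assoc[symmetric])
    also have "\<dots> \<longleftrightarrow> r = t \<otimes> ?q \<otimes> ?q" using q r by simp
    finally show ?thesis by (simp add: nat_pow_mult m_assoc mult_2)
  qed
  have cs: "t \<otimes> (?q \<otimes> r \<otimes> inv ?q) \<otimes> t = s \<longleftrightarrow> r = t \<otimes> ?p [^] (Suc (2*k))"
  proof -
    have "t \<otimes> (?q \<otimes> r \<otimes> inv ?q) \<otimes> t = s \<longleftrightarrow> ?q \<otimes> r \<otimes> inv ?q = t \<otimes> s \<otimes> t"
      (is "t \<otimes> ?x \<otimes> t = s \<longleftrightarrow> _")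
    proof
      have x: "?x \<in> carrier G" using q r by simp
      { assume "t \<otimes> ?x \<otimes> t = s"
        hence "t \<otimes> (t \<otimes> ?x \<otimes> t) \<otimes> t = t \<otimes> s \<otimes> t" by simp
        thus "?x = t \<otimes> s \<otimes> t" using x st(2) by (simp add: m_assoc S_cancel S_sq) }
      { assume e: "?x = t \<otimes> s \<otimes> t"
        show "t \<otimes> ?x \<otimes> t = s" unfolding e using st by (simp add: m_assoc S_cancel S_sq) }
    qed
    also have "\<dots> \<longleftrightarrow> ?q \<otimes> r = t \<otimes> s \<otimes> t \<otimes> ?q"
      by (metis q r c inv_closed inv_solve_right m_closed)
    also have "t \<otimes> s \<otimes> t \<otimes> ?q = t \<otimes> (?p \<otimes> ?q)" using q by (simp add: m_assoc)
    also have "?p \<otimes> ?q = ?q \<otimes> ?p" using nat_pow_comm[of ?p 1 k] by simp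
    also have "t \<otimes> (?q \<otimes> ?p) = (?q \<otimes> t \<otimes> ?q) \<otimes> (?q \<otimes> ?p)" unfolding tq ..
    also have "\<dots> = ?q \<otimes> (t \<otimes> ?q \<otimes> ?q \<otimes> ?p)" using q by (simp add: m_assoc)
    also have "?q \<otimes> r = \<dots> \<longleftrightarrow> r = t \<otimes> ?q \<otimes> ?q \<otimes> ?p" using q r by simp
    finally show ?thesis by (simp add: nat_pow_mult m_assoc mult_2 nat_pow_Suc)
  qed
  have pk: "?p [^] Suc k = ?p \<otimes> ?q" by (metis c m_closed nat_pow_Suc2)
  have "s \<otimes> (t \<otimes> (?q \<otimes> r \<otimes> inv ?q) \<otimes> t) \<otimes> s = ?p [^] Suc k \<otimes> r \<otimes> inv (?p [^] Suc k)"
    unfolding pk using q r st by (simp add: inv_mult_group S_inv m_assoc)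
  note eq = this
  define g :: "nat \<Rightarrow> nat" where "g i = of_bool (r = t \<otimes> ?p [^] i)" for i
  have "((flip s \<circ> flip t) ^^ Suc k) (r, b) = flip s (flip t (((flip s \<circ> flip t) ^^ k) (r, b)))"
    by simp
  also have "((flip s \<circ> flip t) ^^ k) (r, b) = (?q \<otimes> r \<otimes> inv ?q, b \<noteq> odd (sum g {..<2*k}))"
    unfolding Suc g_def ..
  also have "flip t \<dots> = (t \<otimes> (?q \<otimes> r \<otimes> inv ?q) \<otimes> t, b \<noteq> odd (sum g {..<Suc (2*k)}))"
    using q r ct by (auto simp: flip_def g_def simp del: sum_of_bool_eq)
  also have "flip s \<dots> = (?p [^] Suc k \<otimes> r \<otimes> inv (?p [^] Suc k), b \<noteq> odd (sum g {..<Suc (Suc (2*k))}))"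
    using q r cs unfolding eq[symmetric]
    by (auto simp: flip_def g_def simp del: sum_of_bool_eq nat_pow_Suc)
  finally show ?case by (simp add: g_def del: nat_pow_Suc sum_of_bool_eq)
qed

lemma wp_relator:
  assumes "s \<in> S" "t \<in> S" shows "wp (concat (replicate (mat s t) [s, t])) = \<one>"
proof -
  have w: "concat (replicate n [s, t]) \<in> lists S" for n using assms by (induction n) auto
  have "coxeter_step S mat (concat (replicate (mat s t) [s, t])) []"
    using coxeter_step.intros[of "[]" S "[]" s t mat] assms by simp
  thus ?thesis using mat(3)[OF w, of "[]"] by (simp add: r_into_equivclp)
qed

lemma mat_power:
  assumes "s \<in> S" "t \<in> S" shows "(s \<otimes> t) [^] mat s t = \<one>"
proof -
  have "wp (concat (replicate n [s, t])) = (s \<otimes> t) [^] n" for n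
  proof (induction n)
    case (Suc n)
    have "(s \<otimes> t) [^] Suc n = (s \<otimes> t) \<otimes> (s \<otimes> t) [^] n"
      using assms by (intro nat_pow_Suc2) (auto simp: S_carrier)
    moreover have "concat (replicate n [s, t]) \<in> lists S" using assms by (induction n) auto
    ultimately show ?case using Suc assms by (simp add: m_assoc S_carrier del: nat_pow_Suc)
  qed simp
  thus ?thesis using wp_relator[OF assms] by metis
qed

text \<open>As \<open>(s t)\<^sup>m = \<one>\<close>, the reflections \<open>t (s t)\<^sup>i\<close> with \<open>i < m\<close> and with
  \<open>m \<le> i < 2 m\<close> are the same, and every sign changes an even number of times.\<close>

lemma flip_relation:
  assumes st: "s \<in> S" "t \<in> S"
  shows "(flip s \<circ> flip t) ^^ mat s t = id"
proof
  fix p :: "'a \<times> bool" obtain r b where p: "p = (r, b)" by fastforce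
  let ?m = "mat s t"
  show "((flip s \<circ> flip t) ^^ ?m) p = id p"
  proof (cases "r \<in> carrier G")
    case False
    hence "((flip s \<circ> flip t) ^^ k) (r, b) = (r, b)" for k
      by (induction k) (auto simp: flip_def)
    thus ?thesis using p by simp
  next
    case True
    have "(\<Sum>i<2*?m. of_bool (r = t \<otimes> (s \<otimes> t) [^] i) :: nat) =
          (\<Sum>i<?m. of_bool (r = t \<otimes> (s \<otimes> t) [^] i)) + (\<Sum>i=?m..<?m+?m. of_bool (r = t \<otimes> (s \<otimes> t) [^] i))"
      using sum.atLeastLessThan_concat[of 0 ?m "?m + ?m" "\<lambda>i. of_bool (r = t \<otimes> (s \<otimes> t) [^] i) :: nat"]
      by (simp add: lessThan_atLeast0 mult_2)
    also have "(\<Sum>i=?m..<?m+?m. of_bool (r = t \<otimes> (s \<otimes> t) [^] i) :: nat) =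
          (\<Sum>i<?m. of_bool (r = t \<otimes> (s \<otimes> t) [^] (i + ?m)))"
      using sum.shift_bounds_nat_ivl[of "\<lambda>i. of_bool (r = t \<otimes> (s \<otimes> t) [^] i) :: nat" 0 ?m ?m]
      by (simp add: atLeast0LessThan)
    also have "\<dots> = (\<Sum>i<?m. of_bool (r = t \<otimes> (s \<otimes> t) [^] i))"
      using st by (simp add: nat_pow_mult[symmetric] mat_power S_carrier)
    finally have "even (\<Sum>i<2*?m. of_bool (r = t \<otimes> (s \<otimes> t) [^] i) :: nat)" by simp
    thus ?thesis unfolding p using True st by (subst flip_power) (auto simp: mat_power)
  qed
qed

definition word :: "'a \<Rightarrow> 'a list" where
  "word w = (SOME ws. ws \<in> lists S \<and> wp ws = w \<and> length ws = len w)"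

lemma word: assumes "w \<in> carrier G"
  shows "word w \<in> lists S" "wp (word w) = w" "length (word w) = len w"
proof -
  have "\<exists>ws. ws \<in> lists S \<and> wp ws = w \<and> length ws = len w" using reduced_ex[OF assms] by blast
  from someI_ex[OF this, folded word_def]
  show "word w \<in> lists S" "wp (word w) = w" "length (word w) = len w" by auto
qed

text \<open>\<open>eta w\<close> is the indicator of the right inversions of \<open>w\<close> among the reflections; see
  \<open>eta_iff\<close> for the description by lengths.\<close>

definition eta :: "'a \<Rightarrow> 'a \<Rightarrow> bool" where
  "eta w t = snd (foldr flip (word w) (t, False))"

lemma foldr_flip:
  assumes "ws \<in> lists S" "t \<in> carrier G"
  shows "foldr flip ws (t, b) = (wp ws \<otimes> t \<otimes> inv (wp ws), b \<noteq> snd (foldr flip ws (t, False)))"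
  using assms(1)
proof (induction ws arbitrary: b rule: list.induct)
  case Nil thus ?case using assms by simp
next
  case (Cons s ws)
  have s: "s \<in> S" "ws \<in> lists S" using Cons.prems by auto
  note IH = Cons.IH[OF s(2)]
  define c where "c = snd (foldr flip ws (t, False))"
  have wt: "wp ws \<in> carrier G" "t \<in> carrier G" using s assms by auto
  have *: "foldr flip (s # ws) (t, b) = (wp (s # ws) \<otimes> t \<otimes> inv (wp (s # ws)),
      (b \<noteq> c) \<noteq> (wp ws \<otimes> t \<otimes> inv (wp ws) = s))" for b
    using s(1) wt IH[of b, folded c_def]
    by (simp add: flip_apply inv_mult_group S_inv m_assoc S_carrier)
  show ?case unfolding * by auto
qed

lemma eta_word:
  assumes "ws \<in> lists S"
  shows "snd (foldr flip ws (t, False)) = eta (wp ws) t"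
  unfolding eta_def
  by (subst word_action_cong[of flip ws "word (wp ws)"]) (use assms word flip_relation in auto)

text \<open>The cocycle identity, which takes the place of a root system wherever only signs matter.\<close>

lemma eta_mult:
  assumes "x \<in> carrier G" "y \<in> carrier G" "t \<in> carrier G"
  shows "eta (x \<otimes> y) t \<longleftrightarrow> eta y t \<noteq> eta x (y \<otimes> t \<otimes> inv y)"
proof -
  let ?w = "word x @ word y"
  have "eta (x \<otimes> y) t = snd (foldr flip ?w (t, False))"
    using eta_word[of ?w t] word[OF assms(1)] word[OF assms(2)] wp_append by auto
  also have "\<dots> = snd (foldr flip (word x) (foldr flip (word y) (t, False)))" by simp
  also have "foldr flip (word y) (t, False) = (y \<otimes> t \<otimes> inv y, eta y t)"
    using foldr_flip[of "word y" t False] word[OF assms(2)] assms(3) eta_word[of "word y" t] by auto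
  also have "snd (foldr flip (word x) \<dots>) = (eta y t \<noteq> eta x (y \<otimes> t \<otimes> inv y))"
    using foldr_flip[of "word x" "y \<otimes> t \<otimes> inv y" "eta y t"] word[OF assms(1)] assms
      eta_word[of "word x"] by auto
  finally show ?thesis .
qed

lemma eta_S: "s \<in> S \<Longrightarrow> t \<in> carrier G \<Longrightarrow> eta s t \<longleftrightarrow> t = s"
  using eta_word[of "[s]" t] by (auto simp: flip_def S_carrier)

lemma eta_one: "eta \<one> t = False"
  using eta_word[of "[]" t] by simp

text \<open>Strong exchange. A change of sign happens at some letter, and \<open>t\<close> deletes this letter from
  the word, reduced or not.\<close>

lemma deletion:
  assumes "ws \<in> lists S" "t \<in> carrier G" "eta (wp ws) t"
  shows "\<exists>ws'. set ws' \<subseteq> set ws \<and> Suc (length ws') = length ws \<and> wp ws \<otimes> t = wp ws'"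
  using assms(1,3)
proof (induction ws rule: list.induct)
  case Nil thus ?case by (simp add: eta_one)
next
  case (Cons s ws)
  have s: "s \<in> S" "ws \<in> lists S" and [simp]: "s \<in> carrier G" using Cons.prems by auto
  show ?case
  proof (cases "eta (wp ws) t")
    case True
    then obtain ws' where ws': "set ws' \<subseteq> set ws" "Suc (length ws') = length ws" "wp ws \<otimes> t = wp ws'"
      using Cons.IH s by blast
    have "wp (s # ws) \<otimes> t = wp (s # ws')"
      using ws'(3) s assms(2) by (simp add: m_assoc)
    thus ?thesis using ws' by (intro exI[of _ "s # ws'"]) auto
  next
    case False
    hence e: "wp ws \<otimes> t \<otimes> inv (wp ws) = s"
      using Cons.prems s assms(2) by (simp add: eta_mult eta_S)
    have "wp ws \<otimes> t = s \<otimes> wp ws"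
      unfolding e[symmetric] using s assms(2) by (simp add: m_assoc)
    hence "wp (s # ws) \<otimes> t = wp ws"
      using s assms(2) by (simp add: m_assoc S_cancel)
    thus ?thesis by (intro exI[of _ ws]) auto
  qed
qed

lemma T_carrier [intro]: "t \<in> T \<Longrightarrow> t \<in> carrier G"
  by (auto simp: reflections_def S_carrier)
lemma T_cases:
  assumes "t \<in> T" obtains x s where "x \<in> carrier G" "s \<in> S" "t = x \<otimes> s \<otimes> inv x"
  using assms by (auto simp: reflections_def)
lemma S_T: "s \<in> S \<Longrightarrow> s \<in> T"
  unfolding reflections_def by (rule CollectI, rule exI[of _ \<one>], rule exI[of _ s]) (auto simp: S_carrier)

lemma T_conj: assumes "x \<in> carrier G" "t \<in> T" shows "x \<otimes> t \<otimes> inv x \<in> T"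
proof -
  obtain y s where y: "y \<in> carrier G" "s \<in> S" "t = y \<otimes> s \<otimes> inv y" using T_cases[OF assms(2)] .
  have "x \<otimes> t \<otimes> inv x = (x \<otimes> y) \<otimes> s \<otimes> inv (x \<otimes> y)"
    using y assms(1) by (simp add: m_assoc inv_mult_group S_carrier)
  thus ?thesis using y assms(1) unfolding reflections_def by blast
qed

lemma T_conj': "x \<in> carrier G \<Longrightarrow> t \<in> T \<Longrightarrow> inv x \<otimes> t \<otimes> x \<in> T"
  using T_conj[of "inv x" t] by simp

lemma T_sq: assumes "t \<in> T" shows "t \<otimes> t = \<one>"
proof -
  obtain y s where y: "y \<in> carrier G" "s \<in> S" "t = y \<otimes> s \<otimes> inv y" using T_cases[OF assms] .
  show ?thesis unfolding y(3) using y(1,2)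
    by (simp add: m_assoc S_carrier S_cancel inv_cancel)
qed
lemma T_inv: "t \<in> T \<Longrightarrow> inv t = t"
  using T_sq T_carrier by (metis inv_equality)
lemma T_cancel: "t \<in> T \<Longrightarrow> w \<in> carrier G \<Longrightarrow> t \<otimes> (t \<otimes> w) = w"
  by (metis T_carrier T_sq l_one m_assoc)
lemma T_cancel_right: "t \<in> T \<Longrightarrow> w \<in> carrier G \<Longrightarrow> w \<otimes> t \<otimes> t = w"
  by (metis T_carrier T_sq r_one m_assoc)

lemma eta_T: assumes "t \<in> T" shows "eta t t"
proof -
  obtain y s where y: "y \<in> carrier G" "s \<in> S" "t = y \<otimes> s \<otimes> inv y" using T_cases[OF assms] .
  have s: "s \<in> carrier G" using y by auto
  have t: "t \<in> carrier G" using assms by auto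
  have yt: "inv y \<otimes> t \<otimes> y = s" unfolding y(3) using y(1) s
    by (simp add: m_assoc inv_cancel)
  have ss: "s \<otimes> s \<otimes> s = s" using y(2) s S_cancel_right by auto
  have "eta t t = (eta (inv y) t \<noteq> eta (y \<otimes> s) s)"
    using eta_mult[of "y \<otimes> s" "inv y" t] y s t yt by simp
  also have "eta (y \<otimes> s) s = (\<not> eta y s)"
    using eta_mult[of y s s] y s by (simp add: eta_S S_inv ss)
  also have "eta y s = eta (inv y) t"
    using eta_mult[of y "inv y" t] y s t yt by (simp add: eta_one)
  finally show ?thesis by simp
qed

lemma len_less_eta:
  assumes "w \<in> carrier G" "t \<in> carrier G" "eta w t" shows "len (w \<otimes> t) < len w"
proof -
  obtain ws' where ws': "set ws' \<subseteq> set (word w)" "Suc (length ws') = length (word w)" "w \<otimes> t = wp ws'"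
    using deletion[of "word w" t] word[OF assms(1)] assms by auto
  have "ws' \<in> lists S" using ws'(1) word(1)[OF assms(1)] by auto
  from len_le[OF this] show ?thesis using ws' word(3)[OF assms(1)] by simp
qed

lemma eta_iff:
  assumes "w \<in> carrier G" "t \<in> T" shows "eta w t \<longleftrightarrow> len (w \<otimes> t) < len w"
proof
  show "eta w t \<Longrightarrow> len (w \<otimes> t) < len w" using len_less_eta assms by auto
next
  have t: "t \<in> carrier G" using assms by auto
  assume a: "len (w \<otimes> t) < len w"
  show "eta w t"
  proof (rule ccontr)
    assume "\<not> eta w t"
    moreover have "t \<otimes> t \<otimes> t = t" using T_cancel_right[OF assms(2) t] .
    ultimately have "eta (w \<otimes> t) t" using eta_mult[of w t t] eta_T[OF assms(2)] T_inv[OF assms(2)] assms t by auto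
    from len_less_eta[OF _ t this] assms t have "len w < len (w \<otimes> t)" by (simp add: T_cancel_right)
    thus False using a by simp
  qed
qed

lemma odd_len_T: assumes "w \<in> carrier G" "t \<in> T" shows "even (len (w \<otimes> t)) \<noteq> even (len w)"
proof -
  have t: "t \<in> carrier G" using assms by auto
  have "odd (len t)"
  proof -
    obtain y s where y: "y \<in> carrier G" "s \<in> S" "t = y \<otimes> s \<otimes> inv y" using T_cases[OF assms(2)] .
    have "odd (len s)" using even_len[of "[s]"] y by (simp add: S_carrier)
    thus ?thesis using y even_len_mult[of "y \<otimes> s" "inv y"] even_len_mult[of y s] by (auto simp: len_inv S_carrier)
  qed
  thus ?thesis using even_len_mult[OF assms(1) t] by auto
qed

lemma len_T_neq: "w \<in> carrier G \<Longrightarrow> t \<in> T \<Longrightarrow> len (w \<otimes> t) \<noteq> len w"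
  using odd_len_T by metis




section \<open>Descents and inversions\<close>

abbreviation "edge \<equiv> bruhat_edge G S"
abbreviation "ble \<equiv> bruhat_le G S"
abbreviation "MR \<equiv> min_coset_reps G S"
abbreviation "par \<equiv> generate G"

definition Inv :: "'a \<Rightarrow> 'a set" where
  "Inv w = {t \<in> T. len (w \<otimes> t) < len w}"

lemma left_mult_T:
  assumes "x \<in> carrier G" "w \<in> carrier G"
  shows "x \<otimes> w = w \<otimes> (inv w \<otimes> x \<otimes> w)"
  using assms by (simp add: m_assoc[symmetric])

lemma len_S_cases:
  assumes "s \<in> S" "w \<in> carrier G"
  shows "len (s \<otimes> w) = len w + 1 \<or> len w = len (s \<otimes> w) + 1"
proof -
  have [simp]: "s \<in> carrier G" using assms by auto
  have "len (s \<otimes> w) \<noteq> len w"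
    using len_T_neq[OF assms(2) T_conj'[OF assms(2) S_T[OF assms(1)]]] left_mult_T[of s w] assms by simp
  moreover have "len (s \<otimes> w) \<le> 1 + len w" using len_mult[of s w] len_S_le assms by fastforce
  moreover have "len w \<le> 1 + len (s \<otimes> w)"
    using len_mult[of s "s \<otimes> w"] len_S_le[OF assms(1)] assms by (simp add: S_cancel)
  ultimately show ?thesis by linarith
qed

lemma len_right_inv: "s \<in> S \<Longrightarrow> w \<in> carrier G \<Longrightarrow> len (w \<otimes> s) = len (s \<otimes> inv w)"
  using len_inv[of "w \<otimes> s"] by (simp add: inv_mult_group S_carrier S_inv)

lemma len_S_cases_right:
  assumes "s \<in> S" "w \<in> carrier G"
  shows "len (w \<otimes> s) = len w + 1 \<or> len w = len (w \<otimes> s) + 1"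
  using len_S_cases[of s "inv w"] assms by (simp add: len_right_inv len_inv)

lemma len_S: "s \<in> S \<Longrightarrow> len s = 1"
  using len_S_cases[of s \<one>] by (auto simp: S_carrier)

lemma left_descent:
  assumes "w \<in> carrier G" "w \<noteq> \<one>"
  obtains s where "s \<in> S" "len w = len (s \<otimes> w) + 1"
proof -
  have "word w \<noteq> []" using word(2)[OF assms(1)] assms(2) by auto
  then obtain s ws where sw: "word w = s # ws" by (cases "word w") auto
  have s: "s \<in> S" "ws \<in> lists S" using word(1)[OF assms(1)] sw by auto
  have "s \<otimes> w = wp ws" using word(2)[OF assms(1)] sw s by (auto simp: S_cancel)
  hence "len (s \<otimes> w) \<le> length ws" using len_le s by simp
  hence "len (s \<otimes> w) < len w" using word(3)[OF assms(1)] sw by simp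
  thus ?thesis using that s(1) len_S_cases[OF s(1) assms(1)] by auto
qed

lemma Inv_left:
  assumes s: "s \<in> S" and w: "w \<in> carrier G" and l: "len (s \<otimes> w) = len w + 1"
  shows "Inv (s \<otimes> w) = insert (inv w \<otimes> s \<otimes> w) (Inv w)" "inv w \<otimes> s \<otimes> w \<notin> Inv w"
proof -
  let ?r = "inv w \<otimes> s \<otimes> w"
  have sc [simp]: "s \<in> carrier G" using s by auto
  have r: "?r \<in> T" using T_conj'[OF w S_T[OF s]] .
  have wr: "w \<otimes> ?r = s \<otimes> w" using left_mult_T[of s w] w by simp
  show nr: "?r \<notin> Inv w" using l wr by (simp add: Inv_def)
  have e: "eta (s \<otimes> w) t \<longleftrightarrow> eta w t \<noteq> (t = ?r)" if "t \<in> T" for t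
  proof -
    have t: "t \<in> carrier G" using that by auto
    have "w \<otimes> t \<otimes> inv w = s \<longleftrightarrow> t = ?r"
    proof
      assume "w \<otimes> t \<otimes> inv w = s"
      hence "inv w \<otimes> (w \<otimes> t \<otimes> inv w) \<otimes> w = ?r" by simp
      thus "t = ?r" using w t by (simp add: m_assoc inv_cancel)
    next
      assume "t = ?r" thus "w \<otimes> t \<otimes> inv w = s" using wr w by (simp add: m_assoc)
    qed
    thus ?thesis using eta_mult[of s w t] s w t by (simp add: eta_S)
  qed
  show "Inv (s \<otimes> w) = insert ?r (Inv w)"
  proof (rule Set.set_eqI)
    fix t show "t \<in> Inv (s \<otimes> w) \<longleftrightarrow> t \<in> insert ?r (Inv w)"
      using e[of t] eta_iff[of "s \<otimes> w" t] eta_iff[of w t] w r nr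
      unfolding Inv_def by auto
  qed
qed

lemma card_Inv: assumes "w \<in> carrier G" shows "finite (Inv w) \<and> card (Inv w) = len w"
  using assms
proof (induction "len w" arbitrary: w rule: less_induct)
  case less
  show ?case
  proof (cases "w = \<one>")
    case True thus ?thesis by (simp add: Inv_def)
  next
    case False
    obtain s where s: "s \<in> S" "len w = len (s \<otimes> w) + 1" using left_descent[OF less.prems False] .
    let ?v = "s \<otimes> w"
    have v: "?v \<in> carrier G" using s less.prems by (auto simp: S_carrier)
    have sv: "s \<otimes> ?v = w" using s less.prems by (simp add: S_cancel)
    have "finite (Inv ?v) \<and> card (Inv ?v) = len ?v" using less.hyps[of ?v] s v by simp
    thus ?thesis using Inv_left[OF s(1) v, unfolded sv] s(2) by simp
  qed
qed

section \<open>Bruhat order and lifting\<close>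

lemma edge_carrier: "edge x y \<Longrightarrow> x \<in> carrier G \<and> y \<in> carrier G"
  unfolding bruhat_edge_def by auto
lemma edge_len: "edge x y \<Longrightarrow> len x < len y"
  unfolding bruhat_edge_def by auto

lemma edge_iff:
  "edge x y \<longleftrightarrow> x \<in> carrier G \<and> y \<in> carrier G \<and> inv x \<otimes> y \<in> T \<and> len x < len y"
proof
  assume "edge x y"
  then obtain t where t: "t \<in> T" "y = x \<otimes> t" and x: "x \<in> carrier G" "len x < len y"
    unfolding bruhat_edge_def by auto
  have "inv x \<otimes> y = t" using t x T_carrier[OF t(1)] by (simp add: inv_cancel)
  thus "x \<in> carrier G \<and> y \<in> carrier G \<and> inv x \<otimes> y \<in> T \<and> len x < len y" using t x T_carrier by simp
next
  assume a: "x \<in> carrier G \<and> y \<in> carrier G \<and> inv x \<otimes> y \<in> T \<and> len x < len y"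
  hence "y = x \<otimes> (inv x \<otimes> y)" by (simp flip: m_assoc)
  thus "edge x y" using a unfolding bruhat_edge_def by blast
qed

lemma edgeI: "x \<in> carrier G \<Longrightarrow> t \<in> T \<Longrightarrow> len x < len (x \<otimes> t) \<Longrightarrow> edge x (x \<otimes> t)"
  unfolding bruhat_edge_def by auto

lemma edge_S:
  assumes "s \<in> S" "w \<in> carrier G" "len w < len (s \<otimes> w)" shows "edge w (s \<otimes> w)"
  using edgeI[OF assms(2) T_conj'[OF assms(2) S_T[OF assms(1)]]] left_mult_T[of s w] assms
  by (simp add: S_carrier)

text \<open>By the cocycle identity, left multiplication by \<open>s\<close> can reverse the edge from \<open>x\<close> to
  \<open>x t\<close> only when \<open>x t x\<^sup>-\<^sup>1 = s\<close>, that is, when the edge goes to \<open>s x\<close>.\<close>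

lemma edge_left:
  assumes e: "edge x y" and s: "s \<in> S" and ne: "y \<noteq> s \<otimes> x"
  shows "edge (s \<otimes> x) (s \<otimes> y)"
proof -
  obtain t where t: "t \<in> T" "y = x \<otimes> t" and x: "x \<in> carrier G" and l: "len x < len y"
    using e unfolding bruhat_edge_def by auto
  have tc: "t \<in> carrier G" and sc: "s \<in> carrier G" using t s by auto
  have "x \<otimes> t \<otimes> inv x \<noteq> s"
  proof
    assume "x \<otimes> t \<otimes> inv x = s"
    hence "s \<otimes> x = x \<otimes> t \<otimes> (inv x \<otimes> x)" using x tc by (metis inv_closed m_assoc m_closed)
    thus False using ne t x tc by simp
  qed
  hence "\<not> eta (s \<otimes> x) t"
    using eta_mult[OF sc x tc] eta_iff[OF x t(1)] l t s x tc by (simp add: eta_S)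
  hence "len (s \<otimes> x) < len (s \<otimes> x \<otimes> t)"
    using eta_iff[of "s \<otimes> x" t] len_T_neq[of "s \<otimes> x" t] x sc t by auto
  from edgeI[OF _ t(1) this] show ?thesis using x sc tc t(2) by (simp add: m_assoc)
qed

lemma path_carrier: "(edge ^^ k) x y \<Longrightarrow> x \<in> carrier G \<Longrightarrow> y \<in> carrier G"
  by (induction k arbitrary: y) (auto dest: edge_carrier)

lemma le_path: "ble x y \<longleftrightarrow> x \<in> carrier G \<and> (\<exists>k. (edge ^^ k) x y)"
  unfolding bruhat_le_def rtranclp_power using path_carrier by blast

lemma le_carrier: "ble x y \<Longrightarrow> x \<in> carrier G \<and> y \<in> carrier G"
  by (simp add: bruhat_le_def)

lemma le_refl [simp]: "x \<in> carrier G \<Longrightarrow> ble x x" by (simp add: bruhat_le_def)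
lemma le_trans [trans]: "ble x y \<Longrightarrow> ble y z \<Longrightarrow> ble x z" by (auto simp: bruhat_le_def)
lemma edge_le: "edge x y \<Longrightarrow> ble x y" by (auto simp: bruhat_le_def dest: edge_carrier)

lemma le_len_strict: assumes "ble x y" shows "x = y \<or> len x < len y"
proof -
  have "(edge)\<^sup>*\<^sup>* x y" using assms by (simp add: bruhat_le_def)
  thus ?thesis by (induction rule: rtranclp_induct) (auto dest: edge_len)
qed
lemma le_len: "ble x y \<Longrightarrow> len x \<le> len y" using le_len_strict by fastforce
lemma le_len_eq: "ble x y \<Longrightarrow> len y \<le> len x \<Longrightarrow> x = y" using le_len_strict by fastforce
lemma le_antisym: "ble x y \<Longrightarrow> ble y x \<Longrightarrow> x = y" using le_len_eq le_len by blast

text \<open>Left multiplication by \<open>s\<close> maps a path edge by edge, except at a step of the form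
  \<open>x \<rightarrow> s x\<close>. At the first such step the two paths meet, and the step from \<open>y\<close> to \<open>s y\<close>
  at the end makes up for the missing edge. The number of edges is what matters later: it gives the
  lifting property, and it keeps control of the edges that are not covers.\<close>

lemma path_left_up:
  assumes "(edge ^^ k) x y" "s \<in> S" "x \<in> carrier G" "len y < len (s \<otimes> y)"
  shows "(edge ^^ k) (s \<otimes> x) (s \<otimes> y)"
  using assms(1,3)
proof (induction k arbitrary: x)
  case (Suc k)
  obtain x' where x': "edge x x'" "(edge ^^ k) x' y" using Suc.prems(1) by (meson relpowp_Suc_D2)
  have c: "x' \<in> carrier G" using edge_carrier x' by auto
  show ?case
  proof (cases "x' = s \<otimes> x")
    case True
    have "edge y (s \<otimes> y)" using edge_S assms path_carrier[OF x'(2) c] by auto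
    thus ?thesis using x'(2) True by (meson relpowp_Suc_I)
  next
    case False
    thus ?thesis using edge_left[OF x'(1) assms(2) False] Suc.IH[OF x'(2) c] by (meson relpowp_Suc_I2)
  qed
qed simp

text \<open>The mirror image of \<open>path_left_up\<close>: now the compensating step is \<open>s x \<rightarrow> x\<close>, at the start.\<close>

lemma path_left_down:
  assumes "(edge ^^ k) x y" "s \<in> S" "x \<in> carrier G" "len (s \<otimes> x) < len x"
  shows "(edge ^^ k) (s \<otimes> x) (s \<otimes> y)"
  using assms(1)
proof (induction k arbitrary: y)
  case (Suc k)
  obtain y' where y': "(edge ^^ k) x y'" "edge y' y" using Suc.prems(1) by auto
  have sx: "s \<otimes> x \<in> carrier G" using assms by auto
  show ?case
  proof (cases "y = s \<otimes> y'")
    case True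
    have "edge (s \<otimes> x) x" using edge_S[OF assms(2) sx] assms by (simp add: S_cancel)
    moreover have "s \<otimes> y = y'" using True assms edge_carrier[OF y'(2)] by (simp add: S_cancel)
    ultimately show ?thesis using y'(1) by (metis relpowp_Suc_I2)
  next
    case False
    thus ?thesis using edge_left[OF y'(2) assms(2) False] Suc.IH[OF y'(1)] by (meson relpowp_Suc_I)
  qed
qed simp

lemma le_left_up: "ble x y \<Longrightarrow> s \<in> S \<Longrightarrow> len y < len (s \<otimes> y) \<Longrightarrow> ble (s \<otimes> x) (s \<otimes> y)"
  using path_left_up unfolding le_path by (metis S_carrier m_closed)
lemma le_left_down: "ble x y \<Longrightarrow> s \<in> S \<Longrightarrow> len (s \<otimes> x) < len x \<Longrightarrow> ble (s \<otimes> x) (s \<otimes> y)"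
  using path_left_down unfolding le_path by (metis S_carrier m_closed)

lemma le_S: "s \<in> S \<Longrightarrow> w \<in> carrier G \<Longrightarrow> len w < len (s \<otimes> w) \<Longrightarrow> ble w (s \<otimes> w)"
  using edge_S edge_le by blast
lemma S_le: "s \<in> S \<Longrightarrow> w \<in> carrier G \<Longrightarrow> len (s \<otimes> w) < len w \<Longrightarrow> ble (s \<otimes> w) w"
  using edge_S[of s "s \<otimes> w"] edge_le by (simp add: S_cancel S_carrier)

lemma lift_above:
  assumes "ble x y" "s \<in> S" "len (s \<otimes> y) < len y" shows "ble (s \<otimes> x) y"
proof -
  have "(edge)\<^sup>*\<^sup>* x y" and y: "y \<in> carrier G" using assms by (auto simp: bruhat_le_def)
  thus ?thesis
  proof (induction rule: converse_rtranclp_induct)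
    case base thus ?case using S_le assms by auto
  next
    case (step x x')
    show ?case
    proof (cases "x' = s \<otimes> x")
      case True thus ?thesis using step by (auto simp: bruhat_le_def dest: edge_carrier)
    next
      case False
      thus ?thesis using edge_le[OF edge_left[OF step(1) assms(2) False]] step le_trans by blast
    qed
  qed
qed

lemma lift_below:
  assumes "ble x y" "s \<in> S" "len x < len (s \<otimes> x)" "len (s \<otimes> y) < len y" shows "ble x (s \<otimes> y)"
proof -
  have x: "x \<in> carrier G" using assms le_carrier by auto
  show ?thesis using le_left_down[OF lift_above[OF assms(1,2,4)] assms(2)] assms x by (simp add: S_cancel)
qed

lemma edge_inv: assumes "edge x y" shows "edge (inv x) (inv y)"
proof -
  obtain t where t: "t \<in> T" "y = x \<otimes> t" and x: "x \<in> carrier G" and l: "len x < len y"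
    using assms unfolding bruhat_edge_def by auto
  have tc: "t \<in> carrier G" using t by auto
  have "inv y = inv x \<otimes> (x \<otimes> t \<otimes> inv x)"
    using t x tc by (simp add: inv_mult_group T_inv m_assoc inv_cancel)
  thus ?thesis using edgeI[of "inv x" "x \<otimes> t \<otimes> inv x"] T_conj[OF x t(1)] x tc l t
    by (metis inv_closed len_inv m_closed)
qed

lemma le_inv: assumes "ble x y" shows "ble (inv x) (inv y)"
proof -
  have "(edge)\<^sup>*\<^sup>* x y" using assms by (simp add: bruhat_le_def)
  hence "(edge)\<^sup>*\<^sup>* (inv x) (inv y)"
    by (induction rule: rtranclp_induct) (auto intro: rtranclp.rtrancl_into_rtrancl edge_inv)
  thus ?thesis using assms by (simp add: bruhat_le_def)
qed

lemma lift_below_right: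
  assumes "ble x y" "s \<in> S" "len x < len (x \<otimes> s)" "len (y \<otimes> s) < len y" shows "ble x (y \<otimes> s)"
proof -
  have c: "x \<in> carrier G" "y \<in> carrier G" using assms le_carrier by auto
  have "ble (inv x) (s \<otimes> inv y)"
    using lift_below[OF le_inv[OF assms(1)] assms(2)] assms c by (simp add: len_right_inv len_inv)
  from le_inv[OF this] show ?thesis using assms c by (simp add: inv_mult_group S_carrier S_inv)
qed

lemma edge_right:
  assumes "s \<in> S" "w \<in> carrier G" "len w < len (w \<otimes> s)" shows "edge w (w \<otimes> s)"
  using edgeI[OF assms(2) S_T[OF assms(1)]] assms by simp

text \<open>By lifting, an element below \<open>y\<close> is below \<open>s y\<close>, or becomes so after
  multiplication by \<open>s\<close>.\<close>

lemma finite_lower: assumes "y \<in> carrier G" shows "finite {x. ble x y}"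
  using assms
proof (induction "len y" arbitrary: y rule: less_induct)
  case less
  show ?case
  proof (cases "y = \<one>")
    case True
    have "x = \<one>" if "ble x \<one>" for x using le_len[OF that] le_carrier[OF that] len_eq_0 by auto
    hence "{x. ble x y} \<subseteq> {\<one>}" using True by auto
    thus ?thesis using finite_subset by blast
  next
    case False
    obtain s where s: "s \<in> S" "len y = len (s \<otimes> y) + 1" using left_descent[OF less.prems False] .
    let ?B = "{x. ble x (s \<otimes> y)}"
    have fin: "finite ?B" using less.hyps[of "s \<otimes> y"] s less.prems by (simp add: S_carrier)
    have "{x. ble x y} \<subseteq> ?B \<union> (\<lambda>x. s \<otimes> x) ` ?B"
    proof
      fix x assume "x \<in> {x. ble x y}"
      hence x: "ble x y" "x \<in> carrier G" using le_carrier by auto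
      show "x \<in> ?B \<union> (\<lambda>x. s \<otimes> x) ` ?B"
      proof (cases "len x < len (s \<otimes> x)")
        case True thus ?thesis using lift_below[OF x(1) s(1)] s by simp
      next
        case False
        hence "ble (s \<otimes> x) (s \<otimes> y)" using le_left_down[OF x(1) s(1)] len_S_cases[OF s(1) x(2)] by linarith
        moreover have "x = s \<otimes> (s \<otimes> x)" using s x by (simp add: S_cancel)
        ultimately show ?thesis by blast
      qed
    qed
    thus ?thesis using fin finite_subset by blast
  qed
qed

section \<open>Parabolic subgroups and minimal coset representatives\<close>

text \<open>The deletion property: at the first place, from the right, where the length drops, strong exchange
  removes a second letter.\<close>

lemma deletion_nonreduced:
  assumes "ws \<in> lists S" "len (wp ws) < length ws"
  shows "\<exists>ws'. set ws' \<subseteq> set ws \<and> length ws' < length ws \<and> wp ws' = wp ws"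
  using assms
proof (induction ws rule: list.induct)
  case (Cons s ws)
  have s: "s \<in> S" "ws \<in> lists S" using Cons.prems by auto
  let ?w = "wp ws"
  have w: "?w \<in> carrier G" using s by auto
  show ?case
  proof (cases "len ?w < length ws")
    case True
    then obtain ws' where "set ws' \<subseteq> set ws \<and> length ws' < length ws \<and> wp ws' = wp ws"
      using Cons.IH s by blast
    thus ?thesis by (intro exI[of _ "s # ws'"]) auto
  next
    case False
    hence "len ?w = length ws" using len_le[OF s(2)] by simp
    hence l: "len (s \<otimes> ?w) < len ?w" using Cons.prems(2) len_S_cases[OF s(1) w] by auto
    let ?t = "inv ?w \<otimes> s \<otimes> ?w"
    have t: "?t \<in> T" using T_conj'[OF w S_T[OF s(1)]] .
    have "eta ?w ?t" using eta_iff[OF w t] l left_mult_T[of s ?w] s w by (simp add: S_carrier)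
    then obtain ws' where "set ws' \<subseteq> set ws \<and> Suc (length ws') = length ws \<and> ?w \<otimes> ?t = wp ws'"
      using deletion[OF s(2), of ?t] t by blast
    thus ?thesis using left_mult_T[of s ?w] s w by (intro exI[of _ ws']) (auto simp: S_carrier)
  qed
qed simp

lemma par_closed: assumes "J \<subseteq> S" shows "par J \<subseteq> carrier G"
  using generate_incl[of J] assms by auto

lemma par_sub: assumes "J \<subseteq> S" shows "subgroup (par J) G"
  using generate_is_subgroup[of J] assms by auto

lemma wp_par: "J \<subseteq> S \<Longrightarrow> ws \<in> lists J \<Longrightarrow> wp ws \<in> par J"
  by (induction ws rule: list.induct) (auto intro: generate.intros)

lemma par_word: assumes "J \<subseteq> S" "z \<in> par J" shows "\<exists>ws\<in>lists J. wp ws = z"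
  using assms(2)
proof (induction rule: generate.induct)
  case one show ?case by (intro bexI[of _ "[]"]) auto
next
  case (incl h) thus ?case using assms by (intro bexI[of _ "[h]"]) (auto simp: S_carrier)
next
  case (inv h) thus ?case using assms by (intro bexI[of _ "[h]"]) (auto simp: S_carrier S_inv subsetD)
next
  case (eng h1 h2)
  then obtain a b where "a \<in> lists J" "wp a = h1" "b \<in> lists J" "wp b = h2" by blast
  moreover have "a \<in> lists S" "b \<in> lists S" using calculation assms by auto
  ultimately show ?case by (intro bexI[of _ "a @ b"]) (auto simp: wp_append)
qed

lemma par_reduced:
  assumes "J \<subseteq> S" "z \<in> par J"
  obtains ws where "ws \<in> lists J" "wp ws = z" "length ws = len z"
proof -
  define n where "n = (LEAST n. \<exists>ws\<in>lists J. length ws = n \<and> wp ws = z)"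
  have ex: "\<exists>n. \<exists>ws\<in>lists J. length ws = n \<and> wp ws = z" using par_word[OF assms] by blast
  obtain ws where ws: "ws \<in> lists J" "length ws = n" "wp ws = z" using LeastI_ex[OF ex] unfolding n_def by blast
  have wS: "ws \<in> lists S" using ws assms(1) by auto
  have "len z = length ws"
  proof (rule ccontr)
    assume "len z \<noteq> length ws"
    hence "len (wp ws) < length ws" using len_le[OF wS] ws by simp
    from deletion_nonreduced[OF wS this] obtain ws' where
      ws': "set ws' \<subseteq> set ws" "length ws' < length ws" "wp ws' = wp ws" by blast
    hence "ws' \<in> lists J" using ws by auto
    hence "n \<le> length ws'" unfolding n_def using ws' ws by (intro Least_le) auto
    thus False using ws' ws by simp
  qed
  thus ?thesis using that ws by simp
qed

lemma MR_iff: assumes "J \<subseteq> S"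
  shows "u \<in> MR J \<longleftrightarrow> u \<in> carrier G \<and> (\<forall>z\<in>par J. len u \<le> len (u \<otimes> z))"
  unfolding min_coset_reps_def l_coset_def by auto

lemma MR_carrier: "u \<in> MR J \<Longrightarrow> u \<in> carrier G"
  unfolding min_coset_reps_def by auto

lemma MR_empty [simp]: "MR {} = carrier G"
proof -
  have "par {} = {\<one>}" using generate_empty by simp
  thus ?thesis using MR_iff[of "{}"] by auto
qed

text \<open>A minimal representative \<open>u\<close> has no inversion in the parabolic subgroup. So the cocycle
  identity shows that the inversions of \<open>u z\<close> by letters of a reduced word of \<open>z\<close> are those
  of \<open>z\<close>, and every letter increases the length.\<close>

lemma MR_len:
  assumes J: "J \<subseteq> S" and u: "u \<in> MR J" and z: "z \<in> par J"
  shows "len (u \<otimes> z) = len u + len z"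
proof -
  have uc: "u \<in> carrier G" using u MR_carrier by auto
  have *: "len (u \<otimes> wp ws) = len u + length ws" if "ws \<in> lists J" "length ws = len (wp ws)" for ws
    using that
  proof (induction ws rule: rev_induct)
    case Nil thus ?case using uc by simp
  next
    case (snoc r ws)
    have r: "r \<in> J" "ws \<in> lists J" "r \<in> S" "ws \<in> lists S" using snoc.prems J by auto
    let ?z = "wp ws"
    have zc [simp]: "?z \<in> carrier G" "r \<in> carrier G" using r by auto
    have zr: "wp (ws @ [r]) = ?z \<otimes> r" using r by (simp add: wp_snoc)
    have l: "len ?z = length ws"
      using snoc.prems(2) len_le[OF r(4)] len_S_cases_right[OF r(3) zc(1)] zr by auto
    have IH: "len (u \<otimes> ?z) = len u + length ws" using snoc.IH r l by simp
    have zp: "?z \<in> par J" "r \<in> par J" using wp_par[OF J r(2)] r generate.incl by auto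
    have t: "?z \<otimes> r \<otimes> inv ?z \<in> par J"
      using zp par_sub[OF J] by (simp add: subgroup.m_closed subgroup.m_inv_closed)
    have "\<not> eta u (?z \<otimes> r \<otimes> inv ?z)"
      using eta_iff[OF uc T_conj[OF zc(1) S_T[OF r(3)]]] u t MR_iff[OF J] by auto
    moreover have "\<not> eta ?z r" using eta_iff[OF zc(1) S_T[OF r(3)]] zr l snoc.prems(2) by simp
    ultimately have "\<not> eta (u \<otimes> ?z) r" using eta_mult[OF uc zc(1), of r] by simp
    hence "len (u \<otimes> ?z \<otimes> r) = len (u \<otimes> ?z) + 1"
      using eta_iff[of "u \<otimes> ?z" r] S_T[OF r(3)] len_S_cases_right[OF r(3), of "u \<otimes> ?z"] uc by auto
    thus ?case using IH zr uc by (simp add: m_assoc)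
  qed
  obtain ws where "ws \<in> lists J" "wp ws = z" "length ws = len z" using par_reduced[OF J z] .
  thus ?thesis using *[of ws] by simp
qed

lemma MR_decomp:
  assumes J: "J \<subseteq> S" and w: "w \<in> carrier G"
  obtains \<sigma> z where "\<sigma> \<in> MR J" "z \<in> par J" "w = \<sigma> \<otimes> z"
proof -
  obtain z where z: "z \<in> par J" "\<And>z'. z' \<in> par J \<Longrightarrow> len (w \<otimes> z) \<le> len (w \<otimes> z')"
    using ex_has_least_nat[of "\<lambda>z. z \<in> par J" \<one> "\<lambda>z. len (w \<otimes> z)"] generate.one by metis
  have zc: "z \<in> carrier G" using z par_closed[OF J] by auto
  have "w \<otimes> z \<in> MR J"
    unfolding MR_iff[OF J] using w zc z par_closed[OF J] subgroup.m_closed[OF par_sub[OF J]]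
    by (auto simp: m_assoc subsetD)
  moreover have "inv z \<in> par J" using z par_sub[OF J] by (simp add: subgroup.m_inv_closed)
  moreover have "w = w \<otimes> z \<otimes> inv z" using w zc by (simp add: m_assoc)
  ultimately show ?thesis using that by blast
qed

lemma MR_unique:
  assumes J: "J \<subseteq> S" and "\<sigma> \<in> MR J" "\<sigma>' \<in> MR J" "z \<in> par J" "\<sigma>' = \<sigma> \<otimes> z"
  shows "z = \<one>"
proof -
  have c: "\<sigma> \<in> carrier G" "z \<in> carrier G" using assms MR_carrier par_closed[OF J] by auto
  have "inv z \<in> par J" using assms par_sub[OF J] by (simp add: subgroup.m_inv_closed)
  moreover have "\<sigma>' \<otimes> inv z = \<sigma>" using assms c by (simp add: m_assoc)
  ultimately have "len \<sigma>' \<le> len \<sigma>" using assms MR_iff[OF J] by metis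
  thus ?thesis using MR_len[OF J assms(2,4)] assms(5) c len_eq_0 by simp
qed

lemma MR_decomp_unique:
  assumes J: "J \<subseteq> S" and "\<sigma> \<in> MR J" "\<sigma>' \<in> MR J" "z \<in> par J" "z' \<in> par J" "\<sigma> \<otimes> z = \<sigma>' \<otimes> z'"
  shows "\<sigma> = \<sigma>'" "z = z'"
proof -
  have c: "\<sigma> \<in> carrier G" "z \<in> carrier G" "\<sigma>' \<in> carrier G" "z' \<in> carrier G"
    using assms MR_carrier par_closed[OF J] by auto
  have "z \<otimes> inv z' \<in> par J" using assms par_sub[OF J] by (simp add: subgroup.m_closed subgroup.m_inv_closed)
  moreover have "\<sigma>' = \<sigma> \<otimes> (z \<otimes> inv z')" using c assms(6) by (metis inv_closed inv_solve_right m_assoc m_closed)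
  ultimately have "z \<otimes> inv z' = \<one>" using MR_unique[OF J assms(2,3)] by blast
  hence "z = z'" using c by (metis inv_equality inv_inv inv_closed)
  thus "z = z'" "\<sigma> = \<sigma>'" using c assms(6) by auto
qed

lemma MR_left_down:
  assumes J: "J \<subseteq> S" and u: "u \<in> MR J" and s: "s \<in> S" "len (s \<otimes> u) < len u"
  shows "s \<otimes> u \<in> MR J"
proof -
  have uc: "u \<in> carrier G" and sc: "s \<in> carrier G" using u MR_carrier s by auto
  have "len (s \<otimes> u) \<le> len (s \<otimes> u \<otimes> z)" if z: "z \<in> par J" for z
  proof -
    have zc: "z \<in> carrier G" using z par_closed[OF J] by auto
    have "len u \<le> len (u \<otimes> z)" using u z MR_iff[OF J] by auto
    moreover have "len (u \<otimes> z) \<le> len (s \<otimes> (u \<otimes> z)) + 1" using len_S_cases[OF s(1), of "u \<otimes> z"] uc zc by auto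
    ultimately show ?thesis using s uc zc sc by (simp add: m_assoc)
  qed
  thus ?thesis using MR_iff[OF J] uc sc by auto
qed

lemma par_len_1:
  assumes "J \<subseteq> S" "z \<in> par J" "len z = 1" shows "z \<in> J"
proof -
  obtain ws where "ws \<in> lists J" "wp ws = z" "length ws = len z" using par_reduced[OF assms(1,2)] .
  then obtain r where "ws = [r]" "r \<in> J" using assms(3) by (cases ws) auto
  thus ?thesis using \<open>wp ws = z\<close> assms(1) by (auto simp: S_carrier)
qed

text \<open>The coset of \<open>s u\<close> contains a shorter element \<open>s u z\<close>. The lengths of \<open>u z\<close> and
  \<open>s u z\<close> differ by one, which forces \<open>z\<close> to be a generator; were \<open>u z \<noteq> s u\<close>, the edge
  from \<open>u\<close> to \<open>u z\<close> would be carried by \<open>s\<close> to an edge that decreases the length.\<close>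

lemma MR_left_up:
  assumes J: "J \<subseteq> S" and u: "u \<in> MR J" and s: "s \<in> S" "len u < len (s \<otimes> u)" and n: "s \<otimes> u \<notin> MR J"
  obtains r where "r \<in> J" "s \<otimes> u = u \<otimes> r"
proof -
  have uc: "u \<in> carrier G" and sc: "s \<in> carrier G" using u MR_carrier s by auto
  obtain z where z: "z \<in> par J" "len (s \<otimes> u \<otimes> z) < len (s \<otimes> u)"
    using n MR_iff[OF J] uc sc by (auto simp: not_le)
  have zc: "z \<in> carrier G" using z par_closed[OF J] by auto
  have l: "len (u \<otimes> z) = len u + len z" using MR_len[OF J u z(1)] .
  have z2: "len (s \<otimes> (u \<otimes> z)) < len u + 1" using z(2) len_S_cases[OF s(1) uc] s(2) uc sc zc by (simp add: m_assoc)
  hence zl: "len z \<le> 1" using l len_S_cases[OF s(1), of "u \<otimes> z"] uc zc by auto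
  have "z \<noteq> \<one>" using z uc sc by auto
  hence "len z = 1" using zl len_eq_0[OF zc] by auto
  hence zJ: "z \<in> J" using par_len_1[OF J z(1)] by simp
  hence zS: "z \<in> S" using J by auto
  have e: "edge u (u \<otimes> z)" using edge_right[OF zS uc] l \<open>len z = 1\<close> by simp
  have "u \<otimes> z = s \<otimes> u"
  proof (rule ccontr)
    assume "u \<otimes> z \<noteq> s \<otimes> u"
    from edge_len[OF edge_left[OF e s(1) this]] z(2) show False using uc zc sc by (simp add: m_assoc)
  qed
  thus ?thesis using that zJ by simp
qed

text \<open>Right lifting, letter by letter: \<open>u\<close> goes up under each letter of \<open>z\<close>.\<close>

lemma le_MR:
  assumes J: "J \<subseteq> S" and u: "u \<in> MR J" and \<sigma>: "\<sigma> \<in> MR J" and z: "z \<in> par J" and ble: "ble u (\<sigma> \<otimes> z)"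
  shows "ble u \<sigma>"
proof -
  have uc: "u \<in> carrier G" "\<sigma> \<in> carrier G" using u \<sigma> MR_carrier by auto
  obtain ws where ws: "ws \<in> lists J" "wp ws = z" "length ws = len z" using par_reduced[OF J z] .
  have "ble u (\<sigma> \<otimes> wp ws) \<Longrightarrow> ble u \<sigma>" using ws(1)
  proof (induction ws rule: rev_induct)
    case Nil thus ?case using uc by simp
  next
    case (snoc r ws)
    have r: "r \<in> J" "ws \<in> lists J" "r \<in> S" "ws \<in> lists S" using snoc.prems J by auto
    let ?y = "\<sigma> \<otimes> wp ws"
    have y: "?y \<in> carrier G" "r \<in> carrier G" using uc r by auto
    have yr: "\<sigma> \<otimes> wp (ws @ [r]) = ?y \<otimes> r" using r uc by (simp add: wp_snoc m_assoc S_carrier)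
    have ur: "len u < len (u \<otimes> r)" using MR_len[OF J u, of r] r len_S by (simp add: generate.incl)
    have "ble u ?y"
    proof (cases "len ?y < len (?y \<otimes> r)")
      case True
      thus ?thesis using lift_below_right[of u "?y \<otimes> r" r] snoc.prems yr r ur y by (simp add: S_cancel_right)
    next
      case False
      hence "edge (?y \<otimes> r) ?y" using edge_right[OF r(3), of "?y \<otimes> r"] len_S_cases_right[OF r(3) y(1)] y r
        by (auto simp: S_cancel_right)
      thus ?thesis using snoc.prems yr edge_le le_trans by metis
    qed
    thus ?case using snoc.IH r by simp
  qed
  thus ?thesis using ble ws by simp
qed

text \<open>The induced order on the minimal representatives is graded. For \<open>J = {}\<close> this is gradedness of
  the Bruhat order itself.\<close>

lemma MR_graded:
  assumes J: "J \<subseteq> S" and "u \<in> MR J" "v \<in> MR J" "ble u v" "u \<noteq> v"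
  obtains a where "a \<in> MR J" "edge u a" "len a = len u + 1" "ble a v"
proof -
  have "\<exists>a\<in>MR J. edge u a \<and> len a = len u + 1 \<and> ble a v"
    using assms(2-5)
  proof (induction "len v" arbitrary: u v rule: less_induct)
    case less
    have c: "u \<in> carrier G" "v \<in> carrier G" using less.prems MR_carrier by auto
    have "v \<noteq> \<one>" using less.prems le_len_strict[of u v] by auto
    then obtain s where s: "s \<in> S" "len v = len (s \<otimes> v) + 1" using left_descent c by metis
    have sc: "s \<in> carrier G" using s by auto
    have sv: "s \<otimes> v \<in> MR J" using MR_left_down[OF J less.prems(2) s(1)] s by simp
    have svv: "ble (s \<otimes> v) v" using S_le[OF s(1) c(2)] s by simp
    note IH = less.hyps[of "s \<otimes> v", OF _ _ sv]
    show ?case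
    proof (cases "len u < len (s \<otimes> u)")
      case True
      show ?thesis
      proof (cases "s \<otimes> u \<in> MR J")
        case True': True
        thus ?thesis using edge_S[OF s(1) c(1) True] lift_above[OF less.prems(3) s(1)] s
            len_S_cases[OF s(1) c(1)] True by (intro bexI[of _ "s \<otimes> u"]) auto
      next
        case False
        have u: "ble u (s \<otimes> v)" using lift_below[OF less.prems(3) s(1) True] s by simp
        have "u \<noteq> s \<otimes> v" using False less.prems(2) s c by (auto simp: S_cancel)
        thus ?thesis using IH[OF _ less.prems(1) u] s svv le_trans by fastforce
      qed
    next
      case False
      hence su: "len u = len (s \<otimes> u) + 1" using len_S_cases[OF s(1) c(1)] by auto
      have suM: "s \<otimes> u \<in> MR J" using MR_left_down[OF J less.prems(1) s(1)] su by simp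
      have l: "ble (s \<otimes> u) (s \<otimes> v)" using le_left_down[OF less.prems(3) s(1)] su by simp
      have "s \<otimes> u \<noteq> s \<otimes> v" using less.prems(4) c sc by simp
      from IH[OF _ suM l this] s obtain a where a: "a \<in> MR J" "edge (s \<otimes> u) a" "len a = len (s \<otimes> u) + 1" "ble a (s \<otimes> v)"
        by auto
      have ac: "a \<in> carrier G" using a MR_carrier by auto
      show ?thesis
      proof (cases "a = u")
        case True
        hence u: "ble u (s \<otimes> v)" using a by simp
        have "u \<noteq> s \<otimes> v" using su s c by (auto simp: S_cancel)
        thus ?thesis using IH[OF _ less.prems(1) u] s svv le_trans by fastforce
      next
        case ne: False
        have ssu: "s \<otimes> (s \<otimes> u) = u" using s c by (simp add: S_cancel)
        have e: "edge u (s \<otimes> a)" using edge_left[OF a(2) s(1)] ne ssu by simp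
        have la: "len (s \<otimes> a) = len u + 1" using edge_len[OF e] len_S_cases[OF s(1) ac] a(3) su by linarith
        have "ble (s \<otimes> a) (s \<otimes> (s \<otimes> v))" using le_left_up[OF a(4) s(1)] s c by (simp add: S_cancel)
        hence lav: "ble (s \<otimes> a) v" using s c by (simp add: S_cancel)
        have "s \<otimes> a \<in> MR J"
        proof (rule ccontr)
          (* The atom s a leaves the minimal representatives only as a r; then u lies below a, and equals it. *)
          assume "s \<otimes> a \<notin> MR J"
          then obtain r where r: "r \<in> J" "s \<otimes> a = a \<otimes> r"
            using MR_left_up[OF J a(1) s(1)] la a(3) su by (metis less_add_one)
          have "ble u a" using le_MR[OF J less.prems(1) a(1), of r] r edge_le[OF e] by (simp add: generate.incl)
          hence "u = a" using le_len_eq a(3) su by auto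
          thus False using ne by simp
        qed
        thus ?thesis using e la lav by auto
      qed
    qed
  qed
  thus ?thesis using that by blast
qed

lemma graded:
  assumes "ble u v" "u \<noteq> v"
  obtains a where "edge u a" "len a = len u + 1" "ble a v"
  using MR_graded[of "{}" u v] assms le_carrier[OF assms(1)] by auto

lemma saturated_path:
  assumes "ble u v" shows "(edge ^^ (len v - len u)) u v"
  using assms
proof (induction "len v - len u" arbitrary: u)
  case 0
  hence "u = v" using le_len_strict[of u v] by auto
  thus ?case by simp
next
  case (Suc n)
  then have "u \<noteq> v" by auto
  then obtain a where a: "edge u a" "len a = len u + 1" "ble a v" using graded Suc by metis
  have "(edge ^^ (len v - len a)) a v" using Suc a by (intro Suc.hyps) auto
  moreover have "len v - len u = Suc (len v - len a)" using a Suc by simp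
  ultimately show ?case using a(1) by (metis relpowp_Suc_I2)
qed

text \<open>With gradedness, covers are the relations of length difference one.\<close>

lemma cover_iff: "bruhat_cover G S u a \<longleftrightarrow> ble u a \<and> len a = len u + 1"
proof
  assume c: "bruhat_cover G S u a"
  hence "ble u a" "u \<noteq> a" by (auto simp: bruhat_cover_def bruhat_less_def)
  then obtain b where b: "edge u b" "len b = len u + 1" "ble b a" using graded by metis
  have "b = a" using c b edge_le[OF b(1)] by (auto simp: bruhat_cover_def bruhat_less_def)
  thus "ble u a \<and> len a = len u + 1" using b \<open>ble u a\<close> by simp
next
  assume c: "ble u a \<and> len a = len u + 1"
  have "False" if "ble u y" "u \<noteq> y" "ble y a" "y \<noteq> a" for y
    using le_len_strict[OF that(1)] le_len_strict[OF that(3)] that c by auto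
  thus "bruhat_cover G S u a" using c by (auto simp: bruhat_cover_def bruhat_less_def)
qed

lemma cover_edge: assumes "ble u a" "len a = len u + 1" shows "edge u a"
proof -
  obtain b where b: "edge u b" "len b = len u + 1" "ble b a" using graded[of u a] assms by force
  thus ?thesis using le_len_eq[OF b(3)] assms by simp
qed

text \<open>An atom of the interval outside the minimal representatives lies in the coset of \<open>u\<close>, because
  its projection lies between \<open>u\<close> and the atom.\<close>

lemma nonparabolic_atom:
  assumes J: "J \<subseteq> S" and u: "u \<in> MR J" and a: "ble u a" "len a = len u + 1" "a \<notin> MR J"
  obtains r where "r \<in> J" "a = u \<otimes> r"
proof -
  have ac: "a \<in> carrier G" using a le_carrier by auto
  obtain \<sigma> z where \<sigma>: "\<sigma> \<in> MR J" "z \<in> par J" "a = \<sigma> \<otimes> z" using MR_decomp[OF J ac] .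
  have l: "len a = len \<sigma> + len z" using MR_len[OF J] \<sigma> by simp
  have "z \<noteq> \<one>" using a \<sigma> MR_carrier by auto
  hence z0: "len z \<noteq> 0" using len_eq_0 \<sigma> par_closed[OF J] by auto
  have us: "ble u \<sigma>" using le_MR[OF J u \<sigma>(1,2)] a \<sigma> by simp
  hence "len u \<le> len \<sigma>" using le_len by simp
  hence "len z = 1" "len \<sigma> = len u" using l a z0 by auto
  thus ?thesis using that[of z] le_len_eq[OF us] par_len_1[OF J \<sigma>(2)] \<sigma> by auto
qed

text \<open>Induction on \<open>v\<close>. For a left descent \<open>s\<close> of \<open>v\<close> the edge from \<open>s u\<close> to \<open>s v\<close>
  either is still long, and a path of three edges is carried back by \<open>path_left_up\<close>, or it is
  a cover and \<open>u \<rightarrow> s u \<rightarrow> s v \<rightarrow> v\<close> is the path. Consequently a shortest edge among the long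
  ones has length difference three.\<close>

lemma long_edge_path3:
  assumes "edge u v" "len v \<ge> len u + 3" shows "(edge ^^ 3) u v"
  using assms
proof (induction "len v" arbitrary: u v rule: less_induct)
  case less
  have c: "u \<in> carrier G" "v \<in> carrier G" using less.prems edge_carrier by auto
  have "v \<noteq> \<one>" using less.prems by auto
  then obtain s where s: "s \<in> S" "len v = len (s \<otimes> v) + 1" using left_descent c by metis
  have su: "v \<noteq> s \<otimes> u" using less.prems len_S_cases[OF s(1) c(1)] by auto
  have e: "edge (s \<otimes> u) (s \<otimes> v)" using edge_left[OF less.prems(1) s(1) su] .
  have cc: "s \<otimes> u \<in> carrier G" "s \<otimes> v \<in> carrier G" using e edge_carrier by auto
  have ss: "s \<otimes> (s \<otimes> u) = u" "s \<otimes> (s \<otimes> v) = v" using s c by (auto simp: S_cancel)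
  have down: ?case if "(edge ^^ 3) (s \<otimes> u) (s \<otimes> v)"
    using path_left_up[OF that s(1) cc(1)] s ss by simp
  show ?case
  proof (cases "len (s \<otimes> v) \<ge> len (s \<otimes> u) + 3")
    case True thus ?thesis using less.hyps[OF _ e] s down by simp
  next
    case False
    hence "len u < len (s \<otimes> u)" using less.prems s len_S_cases[OF s(1) c(1)] by auto
    hence "edge u (s \<otimes> u)" "edge (s \<otimes> v) v" using edge_S[OF s(1) c(1)] edge_S[OF s(1) cc(2)] s ss by auto
    moreover have "(3::nat) = Suc (Suc (Suc 0))" by simp
    ultimately show ?thesis using e by (metis relpowp_0_I relpowp_Suc_I)
  qed
qed




section \<open>A reflection representation with independent coroots\<close>

text \<open>Twice the usual bilinear form on simple roots; an entry 0 of the Coxeter matrix is infinity, where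
  the form is \<open>- 1\<close>.\<close>

definition cart :: "'a \<Rightarrow> 'a \<Rightarrow> real" where
  "cart s t = (if s \<in> S \<and> t \<in> S then
     if s = t then 2 else if mat s t = 0 then - 2 else - 2 * cos (pi / mat s t) else 0)"

text \<open>The representation acts on functions, the dual side of the root lattice: the value of \<open>h\<close> at
  \<open>Inl t\<close> is the pairing of \<open>h\<close> with the simple root of \<open>t\<close>. This avoids finite sums when
  \<open>S\<close> is infinite. The additional coordinates \<open>Inr f\<close> make coroots of different reflections
  linearly independent, which fails for affine groups in the usual representation. \<open>gram\<close> is the
  Gram matrix: \<open>gram (Inl s)\<close> is the simple coroot of \<open>s\<close>, and its symmetry gives the
  adjointness \<open>actw_adjoint\<close> below.\<close>

fun gram :: "'a + ('a \<Rightarrow> real) \<Rightarrow> 'a + ('a \<Rightarrow> real) \<Rightarrow> real" where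
  "gram (Inl s) (Inl t) = cart s t"
| "gram (Inl s) (Inr f) = f s"
| "gram (Inr f) (Inl s) = f s"
| "gram (Inr f) (Inr g) = 0"

definition act :: "'a \<Rightarrow> ('a + ('a \<Rightarrow> real) \<Rightarrow> real) \<Rightarrow> 'a + ('a \<Rightarrow> real) \<Rightarrow> real" where
  "act s h i = h i - h (Inl s) * gram (Inl s) i"

lemma mat_sym: "s \<in> S \<Longrightarrow> t \<in> S \<Longrightarrow> mat s t = mat t s"
  and mat_diag: "s \<in> S \<Longrightarrow> mat s s = 1"
  and mat_neq_1: "s \<in> S \<Longrightarrow> t \<in> S \<Longrightarrow> s \<noteq> t \<Longrightarrow> mat s t \<noteq> 1"
  using mat(1) unfolding coxeter_matrix_def by blast+

lemma cart_sym: "cart s t = cart t s"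
  unfolding cart_def using mat_sym by auto
lemma gram_sym: "gram i j = gram j i"
  by (cases i; cases j) (auto simp: cart_sym)

text \<open>Multiplication by \<open>2 sin \<theta>\<close> makes the sum telescope over a full period.\<close>

lemma sum_sin_zero:
  assumes "m * \<theta> = pi" "sin \<theta> \<noteq> 0"
  shows "(\<Sum>k<m. sin (2 * real k * \<theta> + \<phi>)) = 0"
proof -
  have "2 * sin \<theta> * (\<Sum>k<n. sin (2 * real k * \<theta> + \<phi>)) = cos (\<phi> - \<theta>) - cos (2 * real n * \<theta> + \<phi> - \<theta>)" for n
  proof (induction n)
    case (Suc n)
    have "2 * sin \<theta> * sin (2 * real n * \<theta> + \<phi>) =
        cos (2 * real n * \<theta> + \<phi> - \<theta>) - cos (2 * real n * \<theta> + \<phi> + \<theta>)"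
      by (simp add: cos_add cos_diff)
    moreover have "2 * real (Suc n) * \<theta> + \<phi> - \<theta> = 2 * real n * \<theta> + \<phi> + \<theta>" by (simp add: algebra_simps)
    ultimately show ?case using Suc by (simp add: algebra_simps)
  qed simp
  from this[of m] have "2 * sin \<theta> * (\<Sum>k<m. sin (2 * real k * \<theta> + \<phi>)) = cos (\<phi> - \<theta>) - cos (2 * pi + (\<phi> - \<theta>))"
    using assms(1) by (simp add: mult.assoc add_diff_eq)
  also have "cos (2 * pi + (\<phi> - \<theta>)) = cos (\<phi> - \<theta>)" by (metis add.commute cos_periodic)
  finally show ?thesis using assms(2) by simp
qed

lemma two_cos_sin: "2 * cos \<theta> * sin a = sin (a + \<theta>) + sin (a - (\<theta>::real))"
  by (simp add: sin_add sin_diff)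

text \<open>Applying \<open>s t\<close> repeatedly subtracts multiples of two coroots. The coefficients satisfy the recursion
  of \<open>sin (k \<theta>)\<close> with \<open>\<theta> = \<pi> / m\<close>, and they sum to zero over \<open>m\<close> steps.\<close>

lemma act_relation:
  assumes st: "s \<in> S" "t \<in> S"
  shows "(act s \<circ> act t) ^^ mat s t = id"
proof (cases "s = t")
  case True
  have "act s (act s h) = h" for h
    using st by (auto simp: act_def cart_def fun_eq_iff algebra_simps)
  thus ?thesis using True mat_diag st by (auto simp: fun_eq_iff)
next
  case False
  show ?thesis
  proof (cases "mat s t = 0")
    case True thus ?thesis by simp
  next
    case m0: False
    define m where "m = mat s t"
    have m2: "m \<ge> 2" using mat_neq_1[OF st False] m0 unfolding m_def by linarith
    define \<theta> where "\<theta> = pi / m"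
    define c where "c = 2 * cos \<theta>"
    have mt: "m * \<theta> = pi" using m2 by (simp add: \<theta>_def)
    have "0 < \<theta>" "\<theta> < pi" using m2 by (auto simp: \<theta>_def field_simps)
    hence sin: "sin \<theta> > 0" using sin_gt_zero by blast
    have K: "cart s t = - c" "cart t s = - c" "cart s s = 2" "cart t t = 2"
      using st False m0 mat_sym[OF st] by (auto simp: cart_def c_def \<theta>_def m_def)
    show ?thesis
    proof
      fix h :: "'a + ('a \<Rightarrow> real) \<Rightarrow> real"
      define p r where "p = h (Inl s)" and "r = h (Inl t)"
      define H where "H k = ((act s \<circ> act t) ^^ k) h" for k
      have step: "H (Suc k) i = H k i - H k (Inl t) * gram (Inl t) i - (H k (Inl s) + c * H k (Inl t)) * gram (Inl s) i" for k i
        unfolding H_def by (simp add: act_def K algebra_simps)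
      (* The coefficients subtracted at step k, in closed form in terms of the initial values r and p. *)
      have cf: "sin \<theta> * H k (Inl t) = r * sin ((2 * real k + 1) * \<theta>) + p * sin (2 * real k * \<theta>) \<and>
          sin \<theta> * (H k (Inl s) + c * H k (Inl t)) = r * sin ((2 * real k + 2) * \<theta>) + p * sin ((2 * real k + 1) * \<theta>)" for k
      proof (induction k)
        case 0
        have "sin (2 * \<theta>) = c * sin \<theta>" by (simp add: sin_double c_def)
        thus ?case by (simp add: H_def p_def r_def algebra_simps)
      next
        case (Suc k)
        define A where "A = sin \<theta> * H k (Inl t)"
        define B where "B = sin \<theta> * (H k (Inl s) + c * H k (Inl t))"
        have ts: "c * sin ((2 * real k + 1) * \<theta>) = sin ((2 * real k + 2) * \<theta>) + sin (2 * real k * \<theta>)"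
          unfolding c_def using two_cos_sin[of \<theta> "(2 * real k + 1) * \<theta>"] by (simp add: algebra_simps)
        have ts2: "c * sin ((2 * real k + 2) * \<theta>) = sin ((2 * real k + 3) * \<theta>) + sin ((2 * real k + 1) * \<theta>)"
          unfolding c_def using two_cos_sin[of \<theta> "(2 * real k + 2) * \<theta>"] by (simp add: algebra_simps)
        have ts3: "c * sin ((2 * real k + 3) * \<theta>) = sin ((2 * real k + 4) * \<theta>) + sin ((2 * real k + 2) * \<theta>)"
          unfolding c_def using two_cos_sin[of \<theta> "(2 * real k + 3) * \<theta>"] by (simp add: algebra_simps)
        have AB: "A = r * sin ((2 * real k + 1) * \<theta>) + p * sin (2 * real k * \<theta>)"
           "B = r * sin ((2 * real k + 2) * \<theta>) + p * sin ((2 * real k + 1) * \<theta>)"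
          using Suc unfolding A_def B_def by auto
        have t': "sin \<theta> * H (Suc k) (Inl t) = c * B - A"
          unfolding step A_def B_def by (simp add: K algebra_simps)
        have s': "sin \<theta> * H (Suc k) (Inl s) = - B"
          unfolding step A_def B_def by (simp add: K algebra_simps)
        have "c * B = r * (c * sin ((2 * real k + 2) * \<theta>)) + p * (c * sin ((2 * real k + 1) * \<theta>))"
          unfolding AB by (simp add: algebra_simps)
        hence t'': "sin \<theta> * H (Suc k) (Inl t) = r * sin ((2 * real k + 3) * \<theta>) + p * sin ((2 * real k + 2) * \<theta>)"
          unfolding t' ts ts2 AB by (simp add: algebra_simps)
        have "sin \<theta> * (H (Suc k) (Inl s) + c * H (Suc k) (Inl t)) = - B + c * (sin \<theta> * H (Suc k) (Inl t))"
          using s' by (simp add: algebra_simps)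
        also have "c * (sin \<theta> * H (Suc k) (Inl t)) = r * (c * sin ((2 * real k + 3) * \<theta>)) + p * (c * sin ((2 * real k + 2) * \<theta>))"
          unfolding t'' by (simp add: algebra_simps)
        finally have s'': "sin \<theta> * (H (Suc k) (Inl s) + c * H (Suc k) (Inl t)) =
            r * sin ((2 * real k + 4) * \<theta>) + p * sin ((2 * real k + 3) * \<theta>)"
          unfolding ts3 ts2 AB by (simp add: algebra_simps)
        have "2 * real (Suc k) = 2 * real k + 2" "2 * real k + 2 + 1 = 2 * real k + 3"
          "2 * real k + 2 + 2 = 2 * real k + 4" by simp_all
        thus ?case using t'' s'' by metis
      qed
      have Hsum: "H n i = h i - (\<Sum>k<n. H k (Inl t)) * gram (Inl t) i - (\<Sum>k<n. H k (Inl s) + c * H k (Inl t)) * gram (Inl s) i" for n i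
        by (induction n) (simp add: H_def, simp add: step algebra_simps)
      have cf': "sin \<theta> * H k (Inl t) = r * sin (2 * real k * \<theta> + \<theta>) + p * sin (2 * real k * \<theta> + 0)"
        "sin \<theta> * (H k (Inl s) + c * H k (Inl t)) = r * sin (2 * real k * \<theta> + 2 * \<theta>) + p * sin (2 * real k * \<theta> + \<theta>)" for k
        using cf[of k] by (simp_all add: distrib_right)
      have "sin \<theta> * (\<Sum>k<m. H k (Inl t)) = (\<Sum>k<m. r * sin (2 * real k * \<theta> + \<theta>) + p * sin (2 * real k * \<theta> + 0))"
        unfolding sum_distrib_left cf' ..
      also have "\<dots> = 0" unfolding sum.distrib sum_distrib_left[symmetric] using sum_sin_zero[OF mt, of \<theta>] sum_sin_zero[OF mt, of "2 * \<theta>"] sum_sin_zero[OF mt, of 0] sin by simp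
      finally have 1: "(\<Sum>k<m. H k (Inl t)) = 0" using sin by simp
      have "sin \<theta> * (\<Sum>k<m. H k (Inl s) + c * H k (Inl t)) = (\<Sum>k<m. r * sin (2 * real k * \<theta> + 2 * \<theta>) + p * sin (2 * real k * \<theta> + \<theta>))"
        unfolding sum_distrib_left cf' ..
      also have "\<dots> = 0" unfolding sum.distrib sum_distrib_left[symmetric] using sum_sin_zero[OF mt, of \<theta>] sum_sin_zero[OF mt, of "2 * \<theta>"] sum_sin_zero[OF mt, of 0] sin by simp
      finally have 2: "(\<Sum>k<m. H k (Inl s) + c * H k (Inl t)) = 0" using sin by simp
      have "H m = h" by (rule ext) (subst Hsum, simp add: 1 2)
      thus "((act s \<circ> act t) ^^ mat s t) h = id h" unfolding H_def m_def by simp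
    qed
  qed
qed

definition actw :: "'a \<Rightarrow> ('a + ('a \<Rightarrow> real) \<Rightarrow> real) \<Rightarrow> 'a + ('a \<Rightarrow> real) \<Rightarrow> real" where
  "actw w = foldr act (word w)"

lemma actw_wp: "ws \<in> lists S \<Longrightarrow> actw (wp ws) = foldr act ws"
  unfolding actw_def using word_action_cong[of act "word (wp ws)" ws] act_relation word by auto

lemma actw_mult: assumes "x \<in> carrier G" "y \<in> carrier G" shows "actw (x \<otimes> y) h = actw x (actw y h)"
proof -
  have "actw (x \<otimes> y) = foldr act (word x @ word y)"
    using actw_wp[of "word x @ word y"] word[OF assms(1)] word[OF assms(2)] wp_append[of "word x" "word y"] by auto
  thus ?thesis by (simp add: actw_def)
qed

lemma actw_one [simp]: "actw \<one> h = h"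
  using actw_wp[of "[]"] by simp
lemma actw_S: "s \<in> S \<Longrightarrow> actw s = act s"
  using actw_wp[of "[s]"] by (auto simp: S_carrier fun_eq_iff)
lemma actw_inv: "x \<in> carrier G \<Longrightarrow> actw x (actw (inv x) h) = h" "x \<in> carrier G \<Longrightarrow> actw (inv x) (actw x h) = h"
  using actw_mult[of x "inv x"] actw_mult[of "inv x" x] by auto

lemma act_linear: "act s (\<lambda>i. a * h i + b * g i) = (\<lambda>i. a * act s h i + b * act s g i)"
  by (auto simp: act_def algebra_simps fun_eq_iff)
lemma fold_act_linear: "foldr act ws (\<lambda>i. a * h i + b * g i) = (\<lambda>i. a * foldr act ws h i + b * foldr act ws g i)"
  by (induction ws) (auto simp: act_linear)
lemma actw_linear: "actw w (\<lambda>i. a * h i + b * g i) = (\<lambda>i. a * actw w h i + b * actw w g i)"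
  unfolding actw_def by (rule fold_act_linear)

lemma actw_local:
  assumes "\<And>t. h (Inl t) = h' (Inl t)" shows "actw w h (Inl t) = actw w h' (Inl t)"
proof -
  have "foldr act ws h (Inl t) = foldr act ws h' (Inl t)" for ws t
    by (induction ws arbitrary: t) (auto simp: assms act_def)
  thus ?thesis by (simp add: actw_def)
qed

lemma fold_act_adjoint: "foldr act ws (gram i) j = foldr act (rev ws) (gram j) i"
proof (induction ws arbitrary: j)
  case Nil thus ?case by (simp add: gram_sym)
next
  case (Cons s ws)
  have "act s (gram j) = (\<lambda>i. 1 * gram j i + (- gram j (Inl s)) * gram (Inl s) i)" by (simp add: act_def fun_eq_iff)
  hence "foldr act (rev (s # ws)) (gram j) i =
      1 * foldr act (rev ws) (gram j) i + (- gram j (Inl s)) * foldr act (rev ws) (gram (Inl s)) i"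
    using fold_act_linear[of "rev ws" 1 "gram j" "- gram j (Inl s)" "gram (Inl s)"] by simp
  also have "\<dots> = act s (foldr act ws (gram i)) j"
    unfolding Cons.IH[of j, symmetric] Cons.IH[of "Inl s", symmetric] act_def[of s _ j] gram_sym[of j "Inl s"] by simp
  finally show ?case by simp
qed

lemma actw_adjoint: assumes "w \<in> carrier G" shows "actw w (gram i) j = actw (inv w) (gram j) i"
proof -
  have "inv w = wp (rev (word w))" using wp_rev[of "word w"] word[OF assms] by simp
  moreover have "rev (word w) \<in> lists S" using word[OF assms] by (auto simp: in_lists_conv_set)
  ultimately show ?thesis using fold_act_adjoint[of "word w"] actw_wp by (simp add: actw_def)
qed

section \<open>Positivity of roots\<close>

text \<open>The dominant functions. A linear form is a nonnegative combination of simple roots exactly when it is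
  nonnegative on them, and only this side of the equivalence is used as the meaning of positivity.\<close>

definition dominant :: "('a + ('a \<Rightarrow> real) \<Rightarrow> real) \<Rightarrow> bool" where
  "dominant h \<longleftrightarrow> (\<forall>t\<in>S. h (Inl t) \<ge> 0)"

fun alt_word :: "'a \<Rightarrow> 'a \<Rightarrow> nat \<Rightarrow> 'a list" where
  "alt_word s t 0 = []"
| "alt_word s t (Suc n) = s # alt_word t s n"

lemma alt_word_S: "s \<in> S \<Longrightarrow> t \<in> S \<Longrightarrow> alt_word s t n \<in> lists S"
  by (induction n arbitrary: s t) auto
lemma alt_word_length [simp]: "length (alt_word s t n) = n"
  by (induction n arbitrary: s t) auto

lemma alt_word_split:
  assumes "s \<in> S" "t \<in> S"
  shows "\<exists>tl. alt_word s t (a + b) = alt_word s t a @ tl \<and> length tl = b \<and> tl \<in> lists S"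
  using assms
proof (induction a arbitrary: s t)
  case 0 thus ?case using alt_word_S[of s t b] by simp
next
  case (Suc a) thus ?case using Suc.IH[of t s] by auto
qed

lemma alt_word_double: "alt_word s t (2 * n) = concat (replicate n [s, t])"
  by (induction n) auto

text \<open>The relator rewrites an alternating word of length \<open>m + 1\<close> to one of length \<open>m - 1\<close>.\<close>

lemma alt_word_reduced:
  assumes st: "s \<in> S" "t \<in> S" "s \<noteq> t" and l: "len (wp (alt_word s t k)) = k" and m: "mat s t \<noteq> 0"
  shows "k \<le> mat s t"
proof (rule ccontr)
  let ?m = "mat s t"
  have m2: "?m \<ge> 2" using mat_neq_1[OF st] m by linarith
  assume "\<not> k \<le> ?m"
  then obtain d where d: "k = (?m + 1) + d" by (metis Suc_eq_plus1 less_eq_Suc_le linorder_not_le nat_le_iff_add)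
  obtain tl where tl: "alt_word s t k = alt_word s t (?m + 1) @ tl" "length tl = d" "tl \<in> lists S"
    using alt_word_split[OF st(1,2), of "?m + 1" d] d by auto
  obtain tl' where tl': "alt_word s t ((?m + 1) + (?m - 1)) = alt_word s t (?m + 1) @ tl'" "length tl' = ?m - 1" "tl' \<in> lists S"
    using alt_word_split[OF st(1,2), of "?m + 1" "?m - 1"] by auto
  have r: "alt_word s t (?m + 1) \<in> lists S" using alt_word_S st by blast
  have "(?m + 1) + (?m - 1) = 2 * ?m" using m2 by simp
  hence "wp (alt_word s t (?m + 1) @ tl') = wp (concat (replicate ?m [s, t]))" using tl' alt_word_double by metis
  also have "\<dots> = \<one>" using wp_relator st by blast
  finally have "wp (alt_word s t (?m + 1)) \<otimes> wp tl' = \<one>" using wp_append[OF r tl'(3)] by simp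
  hence "wp (alt_word s t (?m + 1)) = inv (wp tl')" using r tl' by (metis inv_equality wp_closed)
  hence "len (wp (alt_word s t (?m + 1))) \<le> ?m - 1" using len_inv[of "wp tl'"] len_le[OF tl'(3)] tl' by simp
  moreover have "len (wp (alt_word s t k)) \<le> len (wp (alt_word s t (?m + 1))) + d"
    unfolding tl(1) wp_append[OF r tl(3)]
    using len_mult[OF wp_closed[OF r] wp_closed[OF tl(3)]] len_le[OF tl(3)] tl(2) by linarith
  ultimately show False using l d m2 by simp
qed

text \<open>Letters \<open>s\<close> and \<open>t\<close> are removed alternately from the left as long as the length drops. The
  letter removed last is an ascent of the remainder, since putting it back increases the length.\<close>

lemma strip:
  assumes "y \<in> carrier G" "s \<in> S" "t \<in> S" "len y < len (s \<otimes> y)"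
  shows "\<exists>n y'. y' \<in> carrier G \<and> y = wp (alt_word t s n) \<otimes> y' \<and> len y = n + len y' \<and>
           len y' < len (s \<otimes> y') \<and> len y' < len (t \<otimes> y')"
  using assms
proof (induction "len y" arbitrary: y s t rule: less_induct)
  case less
  show ?case
  proof (cases "len y < len (t \<otimes> y)")
    case True thus ?thesis using less.prems by (intro exI[of _ 0] exI[of _ y]) auto
  next
    case False
    let ?z = "t \<otimes> y"
    have z: "?z \<in> carrier G" "t \<otimes> ?z = y" "len y = len ?z + 1"
      using less.prems False len_S_cases[of t y] by (auto simp: S_carrier S_cancel)
    obtain n y' where y': "y' \<in> carrier G" "?z = wp (alt_word s t n) \<otimes> y'" "len ?z = n + len y'"
        "len y' < len (t \<otimes> y')" "len y' < len (s \<otimes> y')"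
      using less.hyps[of ?z t s] z less.prems by auto
    have "y = wp (alt_word t s (Suc n)) \<otimes> y'"
      using z(2) y'(1,2) less.prems alt_word_S[of s t n] by (auto simp: m_assoc S_carrier)
    thus ?thesis using y' z by (intro exI[of _ "Suc n"] exI[of _ y']) auto
  qed
qed

text \<open>Chebyshev polynomials of the second kind, with the index shifted so that the recursion
  starts at the values \<open>- 1\<close> and \<open>0\<close>.\<close>

fun cheb :: "real \<Rightarrow> nat \<Rightarrow> real" where
  "cheb c 0 = - 1" | "cheb c (Suc 0) = 0" | "cheb c (Suc (Suc n)) = c * cheb c (Suc n) - cheb c n"

lemma cheb_2: "cheb 2 (Suc n) = n"
proof -
  have "cheb 2 (Suc n) = n \<and> cheb 2 n = real n - 1" by (induction n) auto
  thus ?thesis by simp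
qed

lemma cheb_sin: "sin \<theta> * cheb (2 * cos \<theta>) (Suc n) = sin (n * \<theta>)"
proof -
  have "sin \<theta> * cheb (2 * cos \<theta>) (Suc n) = sin (n * \<theta>) \<and> sin \<theta> * cheb (2 * cos \<theta>) n = sin ((real n - 1) * \<theta>)"
  proof (induction n)
    case (Suc n)
    have "sin \<theta> * cheb (2 * cos \<theta>) (Suc (Suc n)) =
        2 * cos \<theta> * (sin \<theta> * cheb (2 * cos \<theta>) (Suc n)) - sin \<theta> * cheb (2 * cos \<theta>) n"
      by (simp add: algebra_simps)
    also have "\<dots> = 2 * cos \<theta> * sin (n * \<theta>) - sin ((real n - 1) * \<theta>)" using Suc by simp
    also have "\<dots> = sin (real (Suc n) * \<theta>)"
      using two_cos_sin[of \<theta> "n * \<theta>"] by (simp add: algebra_simps)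
    finally show ?case using Suc by simp
  qed simp
  thus ?thesis by simp
qed

lemma alt_word_act:
  assumes "s \<in> S" "t \<in> S" "s \<noteq> t" "g (Inl s) \<ge> 0" "g (Inl t) \<ge> 0"
  defines "c \<equiv> - cart s t"
  shows "\<exists>A B. A \<ge> 0 \<and> B \<ge> 0 \<and> foldr act (alt_word t s n) g (Inl s) = cheb c (n + 2) * A + cheb c (n + 1) * B \<and>
     foldr act (alt_word t s n) g (Inl t) = - (cheb c (n + 1) * A + cheb c n * B)"
  using assms(1-5) unfolding c_def
proof (induction n arbitrary: s t)
  case 0 thus ?case by (intro exI[of _ "g (Inl s)"] exI[of _ "g (Inl t)"]) (auto simp: numeral_2_eq_2)
next
  case (Suc n)
  obtain A B where AB: "A \<ge> 0" "B \<ge> 0"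
     "foldr act (alt_word s t n) g (Inl t) = cheb (- cart t s) (n + 2) * A + cheb (- cart t s) (n + 1) * B"
     "foldr act (alt_word s t n) g (Inl s) = - (cheb (- cart t s) (n + 1) * A + cheb (- cart t s) n * B)"
    using Suc.IH[of t s] Suc.prems by auto
  have ct: "cart t t = 2" using Suc.prems by (simp add: cart_def)
  define h where "h = foldr act (alt_word s t n) g"
  note AB' = AB(3,4)[folded h_def, unfolded cart_sym[of t s]]
  have "foldr act (alt_word t s (Suc n)) g = act t h" by (simp add: h_def)
  moreover have "act t h (Inl t) = - h (Inl t)" "act t h (Inl s) = h (Inl s) + (- cart s t) * h (Inl t)"
    by (auto simp: act_def ct cart_sym[of t s])
  ultimately show ?case using AB(1,2) AB'
    by (intro exI[of _ A] exI[of _ B]) (auto simp: numeral_2_eq_2 algebra_simps)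
qed

text \<open>The fundamental theorem on root systems, in its dual form: the inverse of \<open>y\<close> maps the simple root
  of the ascent \<open>s\<close> to a positive root. After \<open>strip\<close>, both values at the remainder are
  nonnegative by induction, and the alternating word combines them with the coefficients
  \<open>sin (k \<theta>) / sin \<theta>\<close>, where \<open>k \<le> m\<close> because the alternating word with \<open>s\<close>
  in front is reduced.\<close>

lemma root_positive:
  assumes "y \<in> carrier G" "s \<in> S" "len y < len (s \<otimes> y)" "dominant h"
  shows "actw y h (Inl s) \<ge> 0"
  using assms(1-3)
proof (induction "len y" arbitrary: y s rule: less_induct)
  case less
  show ?case
  proof (cases "y = \<one>")
    case True thus ?thesis using assms(4) less.prems by (simp add: dominant_def)
  next
    case False
    obtain t where t: "t \<in> S" "len y = len (t \<otimes> y) + 1" using left_descent[OF less.prems(1) False] .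
    have st: "s \<noteq> t" using t less.prems by auto
    obtain n y' where y': "y' \<in> carrier G" "y = wp (alt_word t s n) \<otimes> y'" "len y = n + len y'"
        "len y' < len (s \<otimes> y')" "len y' < len (t \<otimes> y')"
      using strip[OF less.prems(1,2) t(1) less.prems(3)] by blast
    have "n \<noteq> 0" using y' t by (cases n) auto
    hence ly: "len y' < len y" using y' by simp
    define g where "g = actw y' h"
    have g: "g (Inl s) \<ge> 0" "g (Inl t) \<ge> 0" unfolding g_def
      using less.hyps[OF ly y'(1)] y' t less.prems by auto
    have r: "alt_word t s n \<in> lists S" using alt_word_S t less.prems by blast
    have a: "actw y h = foldr act (alt_word t s n) g"
      unfolding y'(2) g_def using actw_mult[OF wp_closed[OF r] y'(1)] actw_wp[OF r] by simp
    have rs: "alt_word s t (Suc n) \<in> lists S" using alt_word_S t less.prems by blast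
    have "s \<otimes> y = wp (alt_word s t (Suc n)) \<otimes> y'"
      using y'(1,2) r less.prems by (auto simp: m_assoc S_carrier)
    hence "Suc n + len y' \<le> len (wp (alt_word s t (Suc n))) + len y'"
      using len_mult[OF wp_closed[OF rs] y'(1)] less.prems(3) y'(3) by simp
    hence red: "len (wp (alt_word s t (Suc n))) = Suc n" using len_le[OF rs] by simp
    define c where "c = - cart s t"
    have u: "cheb c (Suc k) \<ge> 0" if "k \<le> Suc n" for k
    proof (cases "mat s t = 0")
      case True
      hence "c = 2" using st t less.prems by (simp add: c_def cart_def)
      thus ?thesis by (simp add: cheb_2)
    next
      case False
      define \<theta> where "\<theta> = pi / mat s t"
      have c: "c = 2 * cos \<theta>" using st t less.prems False by (simp add: c_def cart_def \<theta>_def)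
      have k: "k \<le> mat s t" using alt_word_reduced[OF less.prems(2) t(1) st red False] that by simp
      have m2: "mat s t \<ge> 2" using mat_neq_1[OF less.prems(2) t(1) st] False by linarith
      have "0 < \<theta>" "\<theta> < pi" using m2 by (auto simp: \<theta>_def field_simps)
      hence sin: "sin \<theta> > 0" using sin_gt_zero by blast
      have "k * \<theta> \<le> pi" using k m2 by (auto simp: \<theta>_def field_simps)
      hence "sin (k * \<theta>) \<ge> 0" using \<open>0 < \<theta>\<close> by (intro sin_ge_zero) auto
      hence "sin \<theta> * cheb c (Suc k) \<ge> 0" unfolding c cheb_sin .
      thus ?thesis using sin by (simp add: zero_le_mult_iff)
    qed
    obtain A B where AB: "A \<ge> 0" "B \<ge> 0" "foldr act (alt_word t s n) g (Inl s) = cheb c (n + 2) * A + cheb c (n + 1) * B"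
      using alt_word_act[OF less.prems(2) t(1) st g, of n] unfolding c_def by blast
    thus ?thesis unfolding a using u[of "Suc n"] u[of n] by (simp add: numeral_2_eq_2 del: cheb.simps)
  qed
qed

lemma root_negative:
  assumes y: "y \<in> carrier G" "s \<in> S" "len (s \<otimes> y) < len y" "dominant h"
  shows "actw y h (Inl s) \<le> 0"
proof -
  let ?z = "s \<otimes> y"
  have z: "?z \<in> carrier G" "s \<otimes> ?z = y" using y by (auto simp: S_carrier S_cancel)
  have "actw ?z h (Inl s) \<ge> 0" using root_positive[OF z(1) y(2) _ y(4)] z y by simp
  moreover have "actw y h = act s (actw ?z h)"
    using actw_mult[of s ?z h] actw_S[OF y(2)] z y by (simp add: S_carrier)
  ultimately show ?thesis using y by (simp add: act_def cart_def)
qed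

section \<open>Roots of reflections, and the planes that they span\<close>

lemma root_rep_ex:
  assumes "t \<in> T"
  shows "\<exists>p. fst p \<in> carrier G \<and> snd p \<in> S \<and> t = fst p \<otimes> snd p \<otimes> inv (fst p) \<and> len (fst p) < len (fst p \<otimes> snd p)"
proof -
  obtain x s where x: "x \<in> carrier G" "s \<in> S" "t = x \<otimes> s \<otimes> inv x" using T_cases[OF assms] .
  show ?thesis
  proof (cases "len x < len (x \<otimes> s)")
    case True thus ?thesis using x by (intro exI[of _ "(x, s)"]) auto
  next
    case False
    have sc: "s \<in> carrier G" using x by auto
    have "t = (x \<otimes> s) \<otimes> s \<otimes> inv (x \<otimes> s)" using x sc by (simp add: S_cancel_right inv_mult_group S_inv m_assoc)
    thus ?thesis using x sc False len_S_cases_right[OF x(2,1)]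
      by (intro exI[of _ "(x \<otimes> s, s)"]) (auto simp: S_cancel_right)
  qed
qed

text \<open>A reflection is written as \<open>x s x\<^sup>-\<^sup>1\<close> with \<open>x < x s\<close>; this selects the
  positive root among the two opposite ones.\<close>

definition root_rep :: "'a \<Rightarrow> 'a \<times> 'a" where
  "root_rep t = (SOME p. fst p \<in> carrier G \<and> snd p \<in> S \<and> t = fst p \<otimes> snd p \<otimes> inv (fst p) \<and> len (fst p) < len (fst p \<otimes> snd p))"

lemma root_rep: assumes "t \<in> T"
  shows "fst (root_rep t) \<in> carrier G" "snd (root_rep t) \<in> S" "t = fst (root_rep t) \<otimes> snd (root_rep t) \<otimes> inv (fst (root_rep t))"
    "len (fst (root_rep t)) < len (fst (root_rep t) \<otimes> snd (root_rep t))"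
  using someI_ex[OF root_rep_ex[OF assms], folded root_rep_def] by auto

definition root :: "'a \<Rightarrow> ('a + ('a \<Rightarrow> real) \<Rightarrow> real) \<Rightarrow> real" where
  "root t h = actw (inv (fst (root_rep t))) h (Inl (snd (root_rep t)))"
definition coroot :: "'a \<Rightarrow> 'a + ('a \<Rightarrow> real) \<Rightarrow> real" where
  "coroot t = actw (fst (root_rep t)) (gram (Inl (snd (root_rep t))))"

lemma root_linear: "root t (\<lambda>i. a * h i + b * g i) = a * root t h + b * root t g"
  unfolding root_def actw_linear ..

lemma actw_T:
  assumes "t \<in> T" shows "actw t h = (\<lambda>i. h i - root t h * coroot t i)"
proof -
  define x s where "x = fst (root_rep t)" and "s = snd (root_rep t)"
  note r = root_rep[OF assms, folded x_def s_def]
  have sc: "s \<in> carrier G" using r by auto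
  define g where "g = actw (inv x) h"
  have "actw t h = actw x (act s g)"
    unfolding g_def by (subst r(3)) (use r sc in \<open>simp add: actw_mult actw_S\<close>)
  also have "act s g = (\<lambda>i. 1 * g i + (- g (Inl s)) * gram (Inl s) i)" by (simp add: act_def fun_eq_iff)
  also have "actw x \<dots> = (\<lambda>i. 1 * actw x g i + (- g (Inl s)) * actw x (gram (Inl s)) i)" by (rule actw_linear)
  also have "actw x g = h" unfolding g_def using r actw_inv by simp
  finally show ?thesis unfolding root_def coroot_def g_def x_def s_def by simp
qed

lemma root_coroot: assumes "t \<in> T" shows "root t (coroot t) = 2"
  using root_rep[OF assms] by (simp add: root_def coroot_def actw_inv cart_def)

lemma root_actw_T: assumes "t \<in> T" shows "root a (actw t h) = root a h - root a (coroot t) * root t h"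
  using root_linear[of a 1 h "- root t h" "coroot t"] by (simp add: actw_T[OF assms] mult.commute)

text \<open>Whether \<open>t\<close> is an inversion of \<open>w\<close> can be read off from the sign of the image of its root.\<close>

lemma root_sign:
  assumes t: "t \<in> T" and w: "w \<in> carrier G" and h: "dominant h"
  shows "\<not> eta w t \<Longrightarrow> root t (actw (inv w) h) \<ge> 0" "eta w t \<Longrightarrow> root t (actw (inv w) h) \<le> 0"
proof -
  define x s where "x = fst (root_rep t)" and "s = snd (root_rep t)"
  note r = root_rep[OF t, folded x_def s_def]
  have sc: "s \<in> carrier G" using r by auto
  have e: "root t (actw (inv w) h) = actw (inv (w \<otimes> x)) h (Inl s)"
    unfolding root_def x_def[symmetric] s_def[symmetric] using r w by (simp add: inv_mult_group actw_mult)
  have ws: "w \<otimes> x \<in> carrier G" using w r by auto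
  have sT: "s \<in> T" using S_T r by auto
  have "\<not> eta x s" using eta_iff[OF r(1) sT] r(4) by simp
  hence et: "eta (w \<otimes> x) s \<longleftrightarrow> eta w t" using eta_mult[OF w r(1) sc] r(3) by simp
  have ll: "len (s \<otimes> inv (w \<otimes> x)) = len (w \<otimes> x \<otimes> s)" using len_right_inv[OF r(2) ws] by simp
  have li: "len (inv (w \<otimes> x)) = len (w \<otimes> x)" using len_inv[OF ws] .
  show "root t (actw (inv w) h) \<ge> 0" if "\<not> eta w t"
    unfolding e using root_positive[OF _ r(2) _ h, of "inv (w \<otimes> x)"] that et eta_iff[OF ws sT] ll li ws
      len_S_cases_right[OF r(2) ws] by auto
  show "root t (actw (inv w) h) \<le> 0" if "eta w t"
    unfolding e using root_negative[OF _ r(2) _ h, of "inv (w \<otimes> x)"] that et eta_iff[OF ws sT] ll li ws by auto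
qed

lemma root_dominant: "t \<in> T \<Longrightarrow> dominant h \<Longrightarrow> root t h \<ge> 0"
  using root_sign(1)[of t \<one> h] by (simp add: eta_one)

lemma root_not_zero:
  assumes t: "t \<in> T" and w: "w \<in> carrier G" and z: "\<And>h. dominant h \<Longrightarrow> root t (actw w h) = 0"
  shows False
proof -
  have "root t (actw w h) = 0" for h
  proof -
    define p n where "p = (\<lambda>i. max (h i) 0)" and "n = (\<lambda>i. max (- h i) 0)"
    have "dominant p" "dominant n" by (auto simp: dominant_def p_def n_def)
    moreover have "(\<lambda>i. 1 * p i + (- 1) * n i) = h" by (auto simp: p_def n_def fun_eq_iff)
    moreover have "root t (actw w (\<lambda>i. 1 * p i + (- 1) * n i)) = 1 * root t (actw w p) + (- 1) * root t (actw w n)"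
      unfolding actw_linear root_linear ..
    ultimately show ?thesis using z by simp
  qed
  from this[of "actw (inv w) (coroot t)"] show False using root_coroot[OF t] actw_inv w by simp
qed

lemma eta_root_iff:
  assumes t: "t \<in> T" and w: "w \<in> carrier G"
  shows "eta w t \<longleftrightarrow> (\<forall>h. dominant h \<longrightarrow> root t (actw (inv w) h) \<le> 0)"
proof
  assume "eta w t" thus "\<forall>h. dominant h \<longrightarrow> root t (actw (inv w) h) \<le> 0" using root_sign(2)[OF t w] by blast
next
  assume a: "\<forall>h. dominant h \<longrightarrow> root t (actw (inv w) h) \<le> 0"
  show "eta w t"
  proof (rule ccontr)
    assume "\<not> eta w t"
    hence "root t (actw (inv w) h) = 0" if "dominant h" for h
      using root_sign(1)[OF t w that] a that by force
    thus False using root_not_zero[OF t, of "inv w"] w by simp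
  qed
qed

text \<open>With \<open>a = x s x\<^sup>-\<^sup>1\<close>, the elements \<open>x\<^sup>-\<^sup>1\<close> and \<open>s x\<^sup>-\<^sup>1\<close> have the same
  inversions except for \<open>a\<close>. So one of them separates \<open>a\<close> from \<open>b\<close>, while proportional
  roots have the same sign everywhere.\<close>

lemma root_inj:
  assumes a: "a \<in> T" and b: "b \<in> T" and p: "\<And>h. root a h = k * root b h" shows "a = b"
proof (rule ccontr)
  assume ne: "a \<noteq> b"
  define x s where "x = fst (root_rep a)" and "s = snd (root_rep a)"
  note r = root_rep[OF a, folded x_def s_def]
  have sc: "s \<in> carrier G" and ac: "a \<in> carrier G" and bc: "b \<in> carrier G" using r a b by auto
  have xa: "inv x \<otimes> a \<otimes> x = s" using r(1) sc by (subst r(3)) (simp add: m_assoc inv_cancel)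
  let ?w = "inv x"
  have w: "?w \<in> carrier G" using r by auto
  have wa: "?w \<otimes> a = s \<otimes> ?w" using r(1) sc by (subst r(3)) (simp add: m_assoc inv_cancel)
  have "len (?w \<otimes> a) = len (x \<otimes> s)" unfolding wa using len_right_inv[OF r(2,1)] by simp
  hence na: "\<not> eta ?w a" using eta_iff[OF w a] r len_inv[OF r(1)] by simp
  have ea: "eta (s \<otimes> ?w) a" using eta_mult[OF sc w ac] na r(1) xa r(2) sc by (simp add: eta_S)
  have "inv x \<otimes> b \<otimes> x \<noteq> s"
  proof
    assume "inv x \<otimes> b \<otimes> x = s"
    hence "x \<otimes> (inv x \<otimes> b \<otimes> x) \<otimes> inv x = a" using r(3) by simp
    moreover have "x \<otimes> (inv x \<otimes> b \<otimes> x) \<otimes> inv x = b"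
      using r(1) bc by (simp add: m_assoc) (simp flip: m_assoc)
    ultimately show False using ne by simp
  qed
  hence eb: "eta (s \<otimes> ?w) b \<longleftrightarrow> eta ?w b" using eta_mult[OF sc w bc] r sc bc by (simp add: eta_S)
  have k: "k \<ge> 0"
  proof (rule ccontr)
    assume "\<not> k \<ge> 0"
    hence "root a (actw \<one> h) = 0" if "dominant h" for h
      using p[of h] root_dominant[OF a that] root_dominant[OF b that] by (auto simp: zero_le_mult_iff)
    thus False using root_not_zero[OF a one_closed] by blast
  qed
  show False
  proof (cases "eta ?w b")
    case True
    have "root a (actw (inv ?w) h) = 0" if "dominant h" for h
      using root_sign(1)[OF a w that na] mult_nonneg_nonpos[OF k root_sign(2)[OF b w that True]]
        p[of "actw (inv ?w) h"] by linarith
    thus False using root_not_zero[OF a, of "inv ?w"] w by blast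
  next
    case False
    have sw: "s \<otimes> ?w \<in> carrier G" using sc w by auto
    have "root a (actw (inv (s \<otimes> ?w)) h) = 0" if "dominant h" for h
    proof -
      have "root b (actw (inv (s \<otimes> ?w)) h) \<ge> 0" using root_sign(1)[OF b sw that] eb False by blast
      from mult_nonneg_nonneg[OF k this] show ?thesis
        using root_sign(2)[OF a sw that ea] p[of "actw (inv (s \<otimes> ?w)) h"] by linarith
    qed
    thus False using root_not_zero[OF a, of "inv (s \<otimes> ?w)"] sw by blast
  qed
qed

text \<open>The coordinates \<open>Inr\<close> of a coroot are the values of the root, by adjointness. Hence proportional
  coroots have proportional roots.\<close>

lemma coroot_Inr:
  assumes "t \<in> T" shows "coroot t (Inr (\<lambda>x. h (Inl x))) = root t h"
proof -
  have "coroot t (Inr (\<lambda>x. h (Inl x))) = root t (gram (Inr (\<lambda>x. h (Inl x))))"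
    unfolding coroot_def root_def by (rule actw_adjoint) (rule root_rep[OF assms])
  also have "\<dots> = root t h" unfolding root_def by (rule actw_local) simp
  finally show ?thesis .
qed

definition plane :: "'a \<Rightarrow> 'a \<Rightarrow> 'a set" where
  "plane a b = {c \<in> T. \<exists>x y. \<forall>h. root c h = x * root a h + y * root b h}"

lemma plane_T: "c \<in> plane a b \<Longrightarrow> c \<in> T" by (simp add: plane_def)
lemma plane_base: "a \<in> T \<Longrightarrow> a \<in> plane a b" "b \<in> T \<Longrightarrow> b \<in> plane a b"
  unfolding plane_def by (auto intro: exI[of _ 1] exI[of _ 0])

lemma root_separate:
  assumes a: "a \<in> T" and b: "b \<in> T" and ne: "a \<noteq> b"
  obtains g where "root a g = 1" "root b g = 0"
proof -
  have "\<exists>h. root b h = 0 \<and> root a h \<noteq> 0"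
  proof (rule ccontr)
    assume "\<not> ?thesis"
    hence z: "root b h = 0 \<Longrightarrow> root a h = 0" for h by blast
    have "root a h = (root a (coroot b) / 2) * root b h" for h
    proof -
      let ?h = "\<lambda>i. 1 * h i + (- root b h / 2) * coroot b i"
      have "root b ?h = 0" unfolding root_linear using root_coroot[OF b] by simp
      from z[OF this] show ?thesis unfolding root_linear by simp
    qed
    thus False using root_inj[OF a b] ne by blast
  qed
  then obtain h where h: "root b h = 0" "root a h \<noteq> 0" by blast
  have "root t (\<lambda>i. (1 / root a h) * h i + 0 * h i) = (1 / root a h) * root t h" for t
    unfolding root_linear by simp
  thus ?thesis using that[of "\<lambda>i. (1 / root a h) * h i + 0 * h i"] h by simp
qed

text \<open>A common fixed vector of \<open>a\<close> and \<open>b\<close> is fixed by \<open>c d\<close>; as the coroots of \<open>c\<close> and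
  \<open>d\<close> are independent, the root of \<open>c\<close> vanishes on it. A linear form that vanishes on the
  common kernel of two forms is a combination of them.\<close>

lemma in_plane:
  assumes T: "a \<in> T" "b \<in> T" "c \<in> T" "d \<in> T" and e: "a \<otimes> b = c \<otimes> d" and ne: "a \<noteq> b"
  shows "c \<in> plane a b"
proof -
  have cl: "a \<in> carrier G" "b \<in> carrier G" "c \<in> carrier G" "d \<in> carrier G" using T by auto
  have cd: "c \<noteq> d"
  proof
    assume "c = d"
    hence "a \<otimes> b = \<one>" using e T_sq T by simp
    hence "a = b" using T cl T_inv by (metis inv_equality)
    thus False using ne by simp
  qed
  have ker: "root c h = 0" if "root a h = 0" "root b h = 0" for h
  proof (rule ccontr)
    assume nz: "root c h \<noteq> 0"
    have "actw b h = h" "actw a h = h" using actw_T T that by auto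
    hence "actw (c \<otimes> d) h = h" unfolding e[symmetric] using actw_mult[OF cl(1,2)] by simp
    hence "actw c (actw d h) = h" using actw_mult[OF cl(3,4)] by simp
    hence "actw c (actw c (actw d h)) = actw c h" by simp
    hence "actw d h = actw c h" using actw_mult[OF cl(3,3)] T_sq T by simp
    hence "root d h * coroot d i = root c h * coroot c i" for i
      unfolding actw_T[OF T(3)] actw_T[OF T(4)] by (metis add_diff_cancel_left' diff_add_cancel minus_diff_eq)
    hence "coroot c i = (root d h / root c h) * coroot d i" for i using nz by (simp add: field_simps)
    hence "root c g = (root d h / root c h) * root d g" for g using coroot_Inr T by metis
    thus False using root_inj[OF T(3,4)] cd by blast
  qed
  obtain g1 where g1: "root a g1 = 1" "root b g1 = 0" using root_separate[OF T(1,2) ne] .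
  obtain g2 where g2: "root b g2 = 1" "root a g2 = 0" using root_separate[OF T(2,1)] ne by metis
  have "root c h = root c g1 * root a h + root c g2 * root b h" for h
  proof -
    define k where "k = (\<lambda>i. 1 * h i + (-1) * (root a h * g1 i + root b h * g2 i))"
    have k: "root t k = root t h - (root a h * root t g1 + root b h * root t g2)" for t
      unfolding k_def root_linear[of t 1 h "-1"] root_linear by simp
    have "root c k = 0" using ker[of k] k[of a] k[of b] g1 g2 by simp
    thus ?thesis using k[of c] by (simp add: mult.commute)
  qed
  thus ?thesis unfolding plane_def using T(3) by blast
qed

lemma plane_change:
  assumes c: "c \<in> plane a b" "d \<in> plane a b" "c \<noteq> d"
  shows "plane a b \<subseteq> plane c d"
proof
  fix e assume e: "e \<in> plane a b"
  obtain x1 y1 where c1: "\<And>h. root c h = x1 * root a h + y1 * root b h" using c(1) unfolding plane_def by blast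
  obtain x2 y2 where d1: "\<And>h. root d h = x2 * root a h + y2 * root b h" using c(2) unfolding plane_def by blast
  obtain x3 y3 where e1: "\<And>h. root e h = x3 * root a h + y3 * root b h" using e unfolding plane_def by blast
  have T: "c \<in> T" "d \<in> T" "e \<in> T" using c e plane_T by auto
  let ?D = "x1 * y2 - x2 * y1"
  have D: "?D \<noteq> 0"
  proof
    assume D: "?D = 0"
    have 1: "x2 * root c h = x1 * root d h" for h
      using D c1[of h] d1[of h] by (simp add: algebra_simps)
    have 2: "y2 * root c h = y1 * root d h" for h
      using D c1[of h] d1[of h] by (simp add: algebra_simps)
    have "x2 \<noteq> 0 \<or> y2 \<noteq> 0" using d1[of "coroot d"] root_coroot[OF T(2)] by auto
    then obtain k where "\<And>h. root c h = k * root d h"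
    proof
      assume "x2 \<noteq> 0" hence "root c h = (x1 / x2) * root d h" for h using 1[of h] by (simp add: field_simps)
      thus ?thesis using that by blast
    next
      assume "y2 \<noteq> 0" hence "root c h = (y1 / y2) * root d h" for h using 2[of h] by (simp add: field_simps)
      thus ?thesis using that by blast
    qed
    thus False using root_inj[OF T(1,2)] c(3) by blast
  qed
  have "root e h = ((x3 * y2 - y3 * x2) / ?D) * root c h + ((y3 * x1 - x3 * y1) / ?D) * root d h" for h
  proof -
    have "?D * root e h = (x3 * y2 - y3 * x2) * root c h + (y3 * x1 - x3 * y1) * root d h"
      unfolding c1 d1 e1 by (simp add: algebra_simps)
    hence "root e h = ((x3 * y2 - y3 * x2) * root c h + (y3 * x1 - x3 * y1) * root d h) / ?D"
      using D by (metis nonzero_mult_div_cancel_left)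
    thus ?thesis by (simp add: add_divide_distrib)
  qed
  thus "e \<in> plane c d" unfolding plane_def using T by blast
qed




section \<open>Covers in a plane\<close>

text \<open>The root of \<open>t2\<close> lies between those of \<open>t1\<close> and \<open>t3\<close>, and the reflection
  \<open>t2\<close> makes the root of \<open>t1\<close> negative. Then \<open>t1\<close> and \<open>t2\<close> are inversions of
  \<open>u t2\<close> in addition to an injective image of the inversions of \<open>u\<close>, so \<open>u t2\<close> does not
  cover \<open>u\<close>.\<close>

lemma middle_root_not_cover:
  assumes T: "t1 \<in> T" "t2 \<in> T" "t3 \<in> T" and u: "u \<in> carrier G"
    and n: "\<not> eta u t1" "\<not> eta u t2" "\<not> eta u t3" and ne: "t1 \<noteq> t2"
    and lin: "\<And>h. root t2 h = x * root t1 h + y * root t3 h" and xy: "x > 0" "y > 0"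
    and big: "x * root t1 (coroot t2) \<ge> 1"
  shows "len (u \<otimes> t2) \<ge> len u + 2"
proof -
  have tc [simp]: "t1 \<in> carrier G" "t2 \<in> carrier G" "t3 \<in> carrier G" using T by auto
  have t2i: "inv t2 = t2" using T_inv T by simp
  define c where "c = root t1 (coroot t2)"
  have cx: "c * x \<ge> 1" using big by (simp add: c_def mult.commute)
  have c0: "c > 0"
  proof (rule ccontr)
    assume "\<not> c > 0" hence "c * x \<le> 0" using xy by (simp add: mult_nonpos_nonneg)
    thus False using cx by simp
  qed
  have r: "root t1 (actw t2 h) = (1 - c * x) * root t1 h - c * y * root t3 h" for h
    unfolding root_actw_T[OF T(2)] lin c_def by (simp add: algebra_simps)
  have neg: "(1 - c * x) * p - c * y * q \<le> 0" if "p \<ge> 0" "q \<ge> 0" for p q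
  proof -
    have "(1 - c * x) * p \<le> 0" using mult_nonpos_nonneg[of "1 - c * x" p] that cx by simp
    moreover have "c * y * q \<ge> 0" using that c0 xy by simp
    ultimately show ?thesis by linarith
  qed
  have e12: "eta t2 t1"
    unfolding eta_root_iff[OF T(1) tc(2)] t2i r using root_dominant T neg by blast
  have e12': "eta (u \<otimes> t2) t1"
  proof -
    have "root t1 (actw (inv (u \<otimes> t2)) h) \<le> 0" if "dominant h" for h
    proof -
      have "actw (inv (u \<otimes> t2)) h = actw t2 (actw (inv u) h)"
        using u by (simp add: inv_mult_group t2i actw_mult)
      hence "root t1 (actw (inv (u \<otimes> t2)) h) =
          (1 - c * x) * root t1 (actw (inv u) h) - c * y * root t3 (actw (inv u) h)"
        using r[of "actw (inv u) h"] by simp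
      also have "\<dots> \<le> 0"
        by (rule neg[OF root_sign(1)[OF T(1) u that n(1)] root_sign(1)[OF T(3) u that n(3)]])
      finally show ?thesis .
    qed
    thus ?thesis using eta_root_iff[OF T(1), of "u \<otimes> t2"] u by simp
  qed
  have "eta (t2 \<otimes> t2) t = False" for t using T_sq[OF T(2)] by (simp add: eta_one)
  hence sym: "eta t2 (t2 \<otimes> t \<otimes> t2) \<longleftrightarrow> eta t2 t" if "t \<in> T" for t
    using eta_mult[of t2 t2 t] that by (auto simp: t2i)
  have cc: "t2 \<otimes> (t2 \<otimes> t \<otimes> t2) \<otimes> t2 = t" if "t \<in> T" for t
    using T_carrier[OF that] T(2) by (simp add: m_assoc T_cancel T_sq)
  have conjT: "t2 \<otimes> t \<otimes> t2 \<in> T" if "t \<in> T" for t using T_conj[OF tc(2) that] t2i by simp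
  (* Conjugation by t2 carries inversions of u to inversions of u t2, except for those that are
   inversions of t2; these stay inversions as they are, because their roots have a positive pairing
   with the coroot of t2. *)
  define \<phi> where "\<phi> t = (if eta t2 t then t else t2 \<otimes> t \<otimes> t2)" for t
  have ut2: "u \<otimes> t2 \<in> carrier G" using u by simp
  have InvE: "t \<in> Inv w \<longleftrightarrow> t \<in> T \<and> eta w t" if "w \<in> carrier G" for w t
    using eta_iff[OF that, of t] by (auto simp: Inv_def)
  have emult: "eta (u \<otimes> t2) t \<longleftrightarrow> eta t2 t \<noteq> eta u (t2 \<otimes> t \<otimes> t2)" if "t \<in> T" for t
    using eta_mult[OF u tc(2), of t] that by (auto simp: t2i)
  have img: "\<phi> ` Inv u \<subseteq> Inv (u \<otimes> t2)"
  proof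
    fix z assume "z \<in> \<phi> ` Inv u"
    then obtain t where t: "z = \<phi> t" "t \<in> T" "eta u t" using InvE[OF u] by auto
    show "z \<in> Inv (u \<otimes> t2)"
    proof (cases "eta t2 t")
      case False
      thus ?thesis using t InvE[OF ut2] conjT emult[OF conjT] sym cc by (simp add: \<phi>_def)
    next
      case True
      define e where "e = root t (coroot t2)"
      have e0: "e > 0"
      proof (rule ccontr)
        assume "\<not> e > 0"
        hence "root t (actw \<one> h) = 0" if "dominant h" for h
          using root_dominant[OF t(2) that] root_dominant[OF T(2) that] root_sign(2)[OF t(2) tc(2) that True]
            root_actw_T[OF T(2), of t h] mult_nonpos_nonneg[of e "root t2 h"] by (simp add: t2i e_def)
        thus False using root_not_zero[OF t(2) one_closed] by blast
      qed
      have "root t (actw (inv (u \<otimes> t2)) h) \<le> 0" if "dominant h" for h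
      proof -
        let ?g = "actw (inv u) h"
        have "actw (inv (u \<otimes> t2)) h = actw t2 ?g"
          using u by (simp add: inv_mult_group t2i actw_mult)
        hence "root t (actw (inv (u \<otimes> t2)) h) = root t ?g - e * root t2 ?g"
          using root_actw_T[OF T(2), of t ?g] by (simp add: e_def)
        moreover have "e * root t2 ?g \<ge> 0" using root_sign(1)[OF T(2) u that n(2)] e0 by simp
        ultimately show ?thesis using root_sign(2)[OF t(2) u that t(3)] by linarith
      qed
      hence "eta (u \<otimes> t2) t" using eta_root_iff[OF t(2) ut2] by simp
      thus ?thesis using True t InvE[OF ut2] by (simp add: \<phi>_def)
    qed
  qed
  have phi_eta: "eta t2 (\<phi> z) \<longleftrightarrow> eta t2 z" if "z \<in> T" for z using sym[OF that] by (simp add: \<phi>_def)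
  have phi_id: "\<phi> z = z" if "eta t2 z" for z using that by (simp add: \<phi>_def)
  have inj: "inj_on \<phi> (Inv u)"
  proof (rule inj_onI)
    fix t t' assume a: "t \<in> Inv u" "t' \<in> Inv u" "\<phi> t = \<phi> t'"
    hence tT: "t \<in> T" "t' \<in> T" by (auto simp: Inv_def)
    have "eta t2 t = eta t2 t'" using a(3) tT phi_eta by metis
    thus "t = t'" using a(3) tT cc unfolding \<phi>_def by metis
  qed
  have t2n: "t2 \<notin> \<phi> ` Inv u"
  proof
    assume "t2 \<in> \<phi> ` Inv u"
    then obtain t where t: "t2 = \<phi> t" "t \<in> T" "eta u t" using InvE[OF u] by auto
    have "eta t2 t" using phi_eta[OF t(2)] eta_T[OF T(2)] unfolding t(1)[symmetric] by simp
    from phi_id[OF this] show False using t(1,3) n(2) by metis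
  qed
  have t1n: "t1 \<notin> \<phi> ` Inv u"
  proof
    assume "t1 \<in> \<phi> ` Inv u"
    then obtain t where t: "t1 = \<phi> t" "t \<in> T" "eta u t" using InvE[OF u] by auto
    have "eta t2 t" using phi_eta[OF t(2)] e12 unfolding t(1)[symmetric] by simp
    from phi_id[OF this] show False using t(1,3) n(1) by metis
  qed
  have t22: "t2 \<otimes> t2 \<otimes> t2 = t2" using T(2) by (simp add: T_cancel_right)
  have sub: "insert t1 (insert t2 (\<phi> ` Inv u)) \<subseteq> Inv (u \<otimes> t2)"
    using img InvE[OF ut2] e12' emult[OF T(2)] eta_T[OF T(2)] n t22 T by auto
  have "card (insert t1 (insert t2 (\<phi> ` Inv u))) = len u + 2"
    using t1n t2n ne card_Inv[OF u] card_image[OF inj] by simp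
  thus ?thesis using card_mono[OF _ sub] card_Inv[OF ut2] by simp
qed

text \<open>Of three roots in a plane that are positive, one lies between the other two,
  \<open>\<beta> = x \<alpha> + y \<gamma>\<close> with \<open>x, y > 0\<close>. Pairing with the coroot of \<open>\<beta>\<close> gives
  \<open>2\<close> as a sum of two terms, one of which is at least 1, and \<open>middle_root_not_cover\<close> applies.\<close>

lemma three_covers_not_planar:
  assumes u: "u \<in> carrier G" and p: "t1 \<in> plane a b" "t2 \<in> plane a b" "t3 \<in> plane a b"
    and ne: "t1 \<noteq> t2" "t1 \<noteq> t3" "t2 \<noteq> t3"
    and l: "len (u \<otimes> t1) = len u + 1" "len (u \<otimes> t2) = len u + 1" "len (u \<otimes> t3) = len u + 1"
  shows False
proof -
  have T: "t1 \<in> T" "t2 \<in> T" "t3 \<in> T" using p plane_T by auto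
  have n: "\<not> eta u t1" "\<not> eta u t2" "\<not> eta u t3" using eta_iff[OF u] T l by auto
  have core: False
    if T: "p \<in> T" "q \<in> T" "r \<in> T" and n: "\<not> eta u p" "\<not> eta u q" "\<not> eta u r" and ne: "p \<noteq> q" "r \<noteq> q"
      and l: "len (u \<otimes> q) = len u + 1"
      and lin: "\<And>h. root q h = x * root p h + y * root r h" and xy: "x > 0" "y > 0" for p q r x y
  proof -
    have "x * root p (coroot q) + y * root r (coroot q) = 2" using lin[of "coroot q"] root_coroot[OF T(2)] by simp
    hence "x * root p (coroot q) \<ge> 1 \<or> y * root r (coroot q) \<ge> 1" by linarith
    thus False
    proof
      assume "x * root p (coroot q) \<ge> 1"
      from middle_root_not_cover[OF T u n ne(1) lin xy this] show False using l by simp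
    next
      assume a: "y * root r (coroot q) \<ge> 1"
      have lin': "root q h = y * root r h + x * root p h" for h using lin by simp
      from middle_root_not_cover[OF T(3,2,1) u n(3,2,1) ne(2) lin' xy(2,1) a] show False using l by simp
    qed
  qed
  have "t3 \<in> plane t1 t2" using plane_change[OF p(1,2) ne(1)] p(3) by blast
  then obtain x y where xy: "\<And>h. root t3 h = x * root t1 h + y * root t2 h" unfolding plane_def by blast
  have x0: "x \<noteq> 0" using root_inj[OF T(3,2), of y] xy ne by auto
  have y0: "y \<noteq> 0" using root_inj[OF T(3,1), of x] xy ne by auto
  consider "x > 0" "y > 0" | "x > 0" "y < 0" | "x < 0" "y > 0" | "x < 0" "y < 0" using x0 y0 by linarith
  thus False
  proof cases
    case 1 thus False using core[OF T(1,3,2) n(1,3,2) _ _ l(3) xy] ne by auto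
  next
    case 2
    have "root t1 h = (1 / x) * root t3 h + (- y / x) * root t2 h" for h using xy[of h] 2 by (simp add: field_simps)
    thus False using core[OF T(3,1,2) n(3,1,2) _ _ l(1)] ne 2 by (metis divide_pos_pos neg_0_less_iff_less zero_less_one)
  next
    case 3
    have "root t2 h = (1 / y) * root t3 h + (- x / y) * root t1 h" for h using xy[of h] 3 by (simp add: field_simps)
    thus False using core[OF T(3,2,1) n(3,2,1) _ _ l(2)] ne 3 by (metis divide_pos_pos neg_0_less_iff_less zero_less_one)
  next
    case 4
    have "root t3 (actw \<one> h) = 0" if "dominant h" for h
      using root_dominant[OF T(1) that] root_dominant[OF T(2) that] root_dominant[OF T(3) that] xy[of h] 4
        mult_nonpos_nonneg[of x "root t1 h"] mult_nonpos_nonneg[of y "root t2 h"] by simp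
    thus False using root_not_zero[OF T(3) one_closed] by blast
  qed
qed

lemma plane_sub: assumes "c \<in> plane a b" "d \<in> plane a b" shows "plane c d \<subseteq> plane a b"
proof
  fix e assume e: "e \<in> plane c d"
  obtain x1 y1 where c1: "\<And>h. root c h = x1 * root a h + y1 * root b h" using assms(1) unfolding plane_def by blast
  obtain x2 y2 where d1: "\<And>h. root d h = x2 * root a h + y2 * root b h" using assms(2) unfolding plane_def by blast
  obtain x3 y3 where e1: "\<And>h. root e h = x3 * root c h + y3 * root d h" using e unfolding plane_def by blast
  have "root e h = (x3 * x1 + y3 * x2) * root a h + (x3 * y1 + y3 * y2) * root b h" for h
    unfolding e1 c1 d1 by (simp add: algebra_simps)
  thus "e \<in> plane a b" using plane_T[OF e] unfolding plane_def by blast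
qed

text \<open>The reflection that labels the edge from \<open>x\<close> to \<open>y\<close>.\<close>

abbreviation lab :: "'a \<Rightarrow> 'a \<Rightarrow> 'a" where "lab x y \<equiv> inv x \<otimes> y"

text \<open>The two factorisations of \<open>x\<^sup>-\<^sup>1 z\<close> into reflections put the four labels of a diamond
  into one plane.\<close>

lemma diamond_plane:
  assumes e: "edge x p" "edge p z" "edge x p'" "edge p' z" and ne: "p \<noteq> p'"
  shows "lab p z \<in> plane (lab x p) (lab x p')" "lab p' z \<in> plane (lab x p) (lab x p')"
proof -
  have c: "x \<in> carrier G" "p \<in> carrier G" "p' \<in> carrier G" "z \<in> carrier G" using e edge_carrier by auto
  have T: "lab x p \<in> T" "lab p z \<in> T" "lab x p' \<in> T" "lab p' z \<in> T" using e edge_iff by auto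
  have eq: "lab x p \<otimes> lab p z = lab x z" "lab x p' \<otimes> lab p' z = lab x z"
    using c by (simp_all add: m_assoc) (simp_all flip: m_assoc)
  have xz: "x \<noteq> z" using edge_len[OF e(1)] edge_len[OF e(2)] by auto
  have n1: "lab x z \<noteq> \<one>" using c xz by (metis inv_equality inv_inv inv_closed)
  have ne1: "lab x p \<noteq> lab p z" using eq n1 T_sq T by metis
  have ne2: "lab x p' \<noteq> lab p' z" using eq n1 T_sq T by metis
  have ne3: "lab x p \<noteq> lab x p'" using c ne by simp
  have 1: "lab x p' \<in> plane (lab x p) (lab p z)"
    using in_plane[OF T(1,2,3,4)] eq ne1 by simp
  have 2: "lab x p \<in> plane (lab x p') (lab p' z)"
    using in_plane[OF T(3,4,1,2)] eq ne2 by simp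
  show "lab p z \<in> plane (lab x p) (lab x p')"
    using plane_change[OF plane_base(1)[OF T(1)] 1 ne3] plane_base(2)[OF T(2)] by blast
  show "lab p' z \<in> plane (lab x p) (lab x p')"
    using plane_change[OF 2 plane_base(1)[OF T(3)] ne3] plane_base(2)[OF T(4)] by blast
qed

section \<open>Intervals of length two and three\<close>

definition atoms :: "'a \<Rightarrow> 'a \<Rightarrow> 'a set" where
  "atoms u v = {a. ble u a \<and> len a = len u + 1 \<and> ble a v}"

lemma atoms_finite: "v \<in> carrier G \<Longrightarrow> finite (atoms u v)"
  using finite_subset[OF _ finite_lower[of v], of "atoms u v"] by (auto simp: atoms_def)

lemma atoms_edge: "a \<in> atoms u v \<Longrightarrow> edge u a"
  using cover_edge by (simp add: atoms_def)

lemma S_inj: "s \<in> S \<Longrightarrow> x \<in> carrier G \<Longrightarrow> y \<in> carrier G \<Longrightarrow> s \<otimes> x = s \<otimes> y \<longleftrightarrow> x = y"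
  by (simp add: S_carrier)

lemma S_asym: "s \<in> S \<Longrightarrow> x \<in> carrier G \<Longrightarrow> \<not> len x < len (s \<otimes> x) \<longleftrightarrow> len (s \<otimes> x) < len x"
  using len_S_cases[of s x] by auto

lemma atom_up:
  assumes "a \<in> atoms x v" "s \<in> S" "len x < len (s \<otimes> x)" "len (s \<otimes> a) < len a"
  shows "a = s \<otimes> x"
proof -
  have xc: "x \<in> carrier G" using assms(1) le_carrier by (auto simp: atoms_def)
  have "ble (s \<otimes> x) a" using lift_above assms by (auto simp: atoms_def)
  from le_len_eq[OF this] show ?thesis using assms len_S_cases[OF assms(2) xc] by (auto simp: atoms_def)
qed

text \<open>Multiplication by a common left descent \<open>s\<close> matches the atoms with descent \<open>s\<close> with the atoms
  of the lower interval other than \<open>u\<close>. Together with \<open>atoms_split\<close> this compares the numbers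
  of atoms of the two intervals.\<close>

lemma atoms_down:
  assumes s: "s \<in> S" and uv: "ble u v" and su: "len (s \<otimes> u) < len u" and sv: "len (s \<otimes> v) < len v"
  defines "D \<equiv> {a \<in> atoms u v. len (s \<otimes> a) < len a}"
  shows "atoms (s \<otimes> u) (s \<otimes> v) = (\<lambda>a. s \<otimes> a) ` D \<union> (if ble u (s \<otimes> v) then {u} else {})"
    "card (atoms (s \<otimes> u) (s \<otimes> v)) = card D + (if ble u (s \<otimes> v) then 1 else 0)"
proof -
  have c: "u \<in> carrier G" "v \<in> carrier G" "s \<in> carrier G" using uv s le_carrier by auto
  have ssu: "s \<otimes> (s \<otimes> u) = u" "s \<otimes> (s \<otimes> v) = v" using s c by (auto simp: S_cancel)
  have lu: "len u = len (s \<otimes> u) + 1" "len v = len (s \<otimes> v) + 1" using len_S_cases[OF s] c su sv by fastforce+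
  have suu: "ble (s \<otimes> u) u" using S_le[OF s c(1) su] .
  show eq: "atoms (s \<otimes> u) (s \<otimes> v) = (\<lambda>a. s \<otimes> a) ` D \<union> (if ble u (s \<otimes> v) then {u} else {})"
  proof (intro Set.set_eqI iffI)
    fix a assume a: "a \<in> atoms (s \<otimes> u) (s \<otimes> v)"
    hence ac: "a \<in> carrier G" using le_carrier by (auto simp: atoms_def)
    show "a \<in> (\<lambda>a. s \<otimes> a) ` D \<union> (if ble u (s \<otimes> v) then {u} else {})"
    proof (cases "len (s \<otimes> a) < len a")
      case True
      hence "a = u" using atom_up[OF a s _ True] ssu su by simp
      thus ?thesis using a by (simp add: atoms_def)
    next
      case False
      hence up: "len a < len (s \<otimes> a)" using S_asym[OF s ac] by blast
      have au: "a \<noteq> u" using False su by auto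
      have e: "edge u (s \<otimes> a)" using edge_left[OF atoms_edge[OF a] s] ssu au by simp
      have "ble (s \<otimes> a) v" using le_left_up[of a "s \<otimes> v" s] a s ssu sv by (simp add: atoms_def)
      moreover have "len (s \<otimes> a) = len u + 1" using len_S_cases[OF s ac] up a lu by (simp add: atoms_def)
      moreover have "s \<otimes> (s \<otimes> a) = a" using s ac by (simp add: S_cancel)
      ultimately have "s \<otimes> a \<in> D" using edge_le[OF e] up by (simp add: D_def atoms_def)
      thus ?thesis using \<open>s \<otimes> (s \<otimes> a) = a\<close> by (metis UnI1 image_eqI)
    qed
  next
    fix a assume "a \<in> (\<lambda>a. s \<otimes> a) ` D \<union> (if ble u (s \<otimes> v) then {u} else {})"
    then consider (1) "a = u" "ble u (s \<otimes> v)" | (2) b where "b \<in> D" "a = s \<otimes> b" by (auto split: if_splits)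
    thus "a \<in> atoms (s \<otimes> u) (s \<otimes> v)"
    proof cases
      case 1 thus ?thesis using lu suu by (simp add: atoms_def)
    next
      case 2
      hence b: "ble u b" "len b = len u + 1" "ble b v" "len (s \<otimes> b) < len b" by (auto simp: D_def atoms_def)
      hence bc: "b \<in> carrier G" using le_carrier by blast
      show ?thesis using le_left_down[OF b(1) s su] le_left_down[OF b(3) s b(4)] len_S_cases[OF s bc] b lu 2
        by (auto simp: atoms_def)
    qed
  qed
  have DC: "D \<subseteq> carrier G" using le_carrier by (auto simp: D_def atoms_def)
  have fin: "finite D" using atoms_finite[OF c(2)] by (simp add: D_def)
  have inj: "inj_on (\<lambda>a. s \<otimes> a) D" using DC s by (intro inj_onI) (auto simp: S_inj subsetD)
  have "u \<notin> (\<lambda>a. s \<otimes> a) ` D"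
  proof
    assume "u \<in> (\<lambda>a. s \<otimes> a) ` D"
    then obtain b where "b \<in> D" "u = s \<otimes> b" by blast
    thus False using su DC s by (auto simp: D_def S_cancel subsetD)
  qed
  thus "card (atoms (s \<otimes> u) (s \<otimes> v)) = card D + (if ble u (s \<otimes> v) then 1 else 0)"
    unfolding eq using card_image[OF inj] fin by auto
qed

lemma atoms_split:
  assumes s: "s \<in> S" and uv: "ble u v" and sv: "len (s \<otimes> v) < len v"
  shows "card (atoms u v) = card {a \<in> atoms u v. len (s \<otimes> a) < len a} +
           card {a \<in> atoms u (s \<otimes> v). len a < len (s \<otimes> a)}"
proof -
  have c: "u \<in> carrier G" "v \<in> carrier G" "s \<in> carrier G" using uv s le_carrier by auto
  have svv: "ble (s \<otimes> v) v" using S_le[OF s c(2) sv] .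
  have "{a \<in> atoms u (s \<otimes> v). len a < len (s \<otimes> a)} = {a \<in> atoms u v. \<not> len (s \<otimes> a) < len a}"
  proof (intro Set.set_eqI iffI)
    fix a assume "a \<in> {a \<in> atoms u (s \<otimes> v). len a < len (s \<otimes> a)}"
    thus "a \<in> {a \<in> atoms u v. \<not> len (s \<otimes> a) < len a}" using svv le_trans by (auto simp: atoms_def)
  next
    fix a assume a: "a \<in> {a \<in> atoms u v. \<not> len (s \<otimes> a) < len a}"
    hence "a \<in> carrier G" using le_carrier by (auto simp: atoms_def)
    hence "len a < len (s \<otimes> a)" using a S_asym[OF s] by blast
    thus "a \<in> {a \<in> atoms u (s \<otimes> v). len a < len (s \<otimes> a)}" using a lift_below[OF _ s _ sv] by (auto simp: atoms_def)
  qed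
  moreover have "atoms u v = {a \<in> atoms u v. len (s \<otimes> a) < len a} \<union> {a \<in> atoms u v. \<not> len (s \<otimes> a) < len a}" by auto
  moreover have "card ({a \<in> atoms u v. len (s \<otimes> a) < len a} \<union> {a \<in> atoms u v. \<not> len (s \<otimes> a) < len a}) =
     card {a \<in> atoms u v. len (s \<otimes> a) < len a} + card {a \<in> atoms u v. \<not> len (s \<otimes> a) < len a}"
    using atoms_finite[OF c(2), of u] by (intro card_Un_disjoint) auto
  ultimately show ?thesis by simp
qed

lemma card_atoms_2:
  assumes "ble u v" "len v = len u + 2" shows "card (atoms u v) = 2"
  using assms
proof (induction "len v" arbitrary: u v rule: less_induct)
  case less
  have c: "u \<in> carrier G" "v \<in> carrier G" using less.prems le_carrier by auto
  have "v \<noteq> \<one>" using less.prems by auto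
  then obtain s where s: "s \<in> S" "len v = len (s \<otimes> v) + 1" using left_descent c by metis
  have sc: "s \<in> carrier G" using s by auto
  have svv: "ble (s \<otimes> v) v" using S_le[OF s(1) c(2)] s by simp
  show ?case
  proof (cases "len u < len (s \<otimes> u)")
    case True
    have su: "len (s \<otimes> u) = len u + 1" using len_S_cases[OF s(1) c(1)] True by auto
    have u: "ble u (s \<otimes> v)" using lift_below[OF less.prems(1) s(1) True] s by simp
    have "atoms u v = {s \<otimes> u, s \<otimes> v}"
    proof (intro Set.set_eqI iffI)
      fix a assume a: "a \<in> atoms u v"
      hence ac: "a \<in> carrier G" using le_carrier by (auto simp: atoms_def)
      show "a \<in> {s \<otimes> u, s \<otimes> v}"
      proof (cases "len (s \<otimes> a) < len a")
        case True' : True thus ?thesis using atom_up[OF a s(1) True] by simp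
      next
        case False
        hence "ble a (s \<otimes> v)" using a lift_below[of a v s] S_asym[OF s(1) ac] s by (auto simp: atoms_def)
        from le_len_eq[OF this] show ?thesis using a s less.prems by (simp add: atoms_def)
      qed
    next
      fix a assume "a \<in> {s \<otimes> u, s \<otimes> v}"
      thus "a \<in> atoms u v" using u svv lift_above[OF less.prems(1) s(1)] s su le_S[OF s(1) c(1) True] less.prems
        by (auto simp: atoms_def)
    qed
    moreover have "s \<otimes> u \<noteq> s \<otimes> v" using c sc less.prems by auto
    ultimately show ?thesis by simp
  next
    case False
    hence su: "len (s \<otimes> u) < len u" using S_asym[OF s(1) c(1)] by blast
    have l: "ble (s \<otimes> u) (s \<otimes> v)" using le_left_down[OF less.prems(1) s(1) su] .
    have "len u = len (s \<otimes> u) + 1" using len_S_cases[OF s(1) c(1)] su by auto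
    hence IH: "card (atoms (s \<otimes> u) (s \<otimes> v)) = 2" using less.hyps[OF _ l] s less.prems by simp
    have "{a \<in> atoms u (s \<otimes> v). len a < len (s \<otimes> a)} = (if ble u (s \<otimes> v) then {s \<otimes> v} else {})"
    proof -
      have "a = s \<otimes> v" if "a \<in> atoms u (s \<otimes> v)" for a
        using that le_len_eq[of a "s \<otimes> v"] less.prems s by (auto simp: atoms_def)
      moreover have "s \<otimes> v \<in> atoms u (s \<otimes> v)" if "ble u (s \<otimes> v)"
        using that less.prems s c sc by (auto simp: atoms_def)
      moreover have "len (s \<otimes> v) < len (s \<otimes> (s \<otimes> v))" using s c by (simp add: S_cancel)
      moreover have "ble u (s \<otimes> v)" if "a \<in> atoms u (s \<otimes> v)" for a
        using that le_trans by (auto simp: atoms_def)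
      ultimately show ?thesis by auto
    qed
    thus ?thesis using atoms_down(2)[OF s(1) less.prems(1) su] atoms_split[OF s(1) less.prems(1)] s IH
      by (auto split: if_splits)
  qed
qed

lemma other_atom:
  assumes "ble u v" "len v = len u + 2" "a \<in> atoms u v"
  obtains b where "b \<in> atoms u v" "b \<noteq> a"
proof -
  have "card (atoms u v - {a}) = 1" using card_atoms_2[OF assms(1,2)] assms(3) by simp
  then obtain b where "atoms u v - {a} = {b}" by (rule card_1_singletonE)
  thus ?thesis using that by blast
qed

lemma lab_left: "s \<in> S \<Longrightarrow> x \<in> carrier G \<Longrightarrow> y \<in> carrier G \<Longrightarrow> lab (s \<otimes> x) (s \<otimes> y) = lab x y"
  by (simp add: inv_mult_group S_carrier S_inv m_assoc S_cancel)

lemma mult_lab: "x \<in> carrier G \<Longrightarrow> y \<in> carrier G \<Longrightarrow> x \<otimes> lab x y = y"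
  by (simp flip: m_assoc)

text \<open>Induction on \<open>v\<close> with a left descent \<open>s\<close> of \<open>v\<close>. If \<open>s\<close> is an ascent of \<open>u\<close>, the
  atoms are \<open>s u\<close> and the two atoms of the interval from \<open>u\<close> to \<open>s v\<close>, and the edge exists
  exactly when \<open>s u\<close> is one of these two. If \<open>s\<close> is a descent of \<open>u\<close>, the edge is carried to
  the interval from \<open>s u\<close> to \<open>s v\<close>, and the number of atoms is compared by \<open>atoms_down\<close>
  and \<open>atoms_split\<close>. It may change only when \<open>u < s v\<close>, and the two atoms between are both
  ascents or both descents of \<open>s\<close>. A change between 2 and another number would put three
  covers of one element into a plane.\<close>

lemma card_atoms_3:
  assumes "ble u v" "len v = len u + 3" shows "edge u v \<longleftrightarrow> card (atoms u v) = 2"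
  using assms
proof (induction "len v" arbitrary: u v rule: less_induct)
  case less
  have c: "u \<in> carrier G" "v \<in> carrier G" using less.prems le_carrier by auto
  have "v \<noteq> \<one>" using less.prems by auto
  then obtain s where s: "s \<in> S" "len v = len (s \<otimes> v) + 1" using left_descent c by metis
  have sc: "s \<in> carrier G" using s by auto
  have svc: "s \<otimes> v \<in> carrier G" and suc: "s \<otimes> u \<in> carrier G" using sc c by auto
  have svv: "ble (s \<otimes> v) v" using S_le[OF s(1) c(2)] s by simp
  have svl: "len (s \<otimes> v) < len v" using s by simp
  have ss: "s \<otimes> (s \<otimes> u) = u" "s \<otimes> (s \<otimes> v) = v" using s c by (auto simp: S_cancel)
  have "len v \<noteq> len (s \<otimes> u)" "len (s \<otimes> v) \<noteq> len u"
    using less.prems s(2) len_S_cases[OF s(1) c(1)] by linarith+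
  hence ne: "v \<noteq> s \<otimes> u" "s \<otimes> v \<noteq> u" by metis+
  have ed: "edge u v \<longleftrightarrow> edge (s \<otimes> u) (s \<otimes> v)"
    using edge_left[OF _ s(1), of u v] edge_left[OF _ s(1), of "s \<otimes> u" "s \<otimes> v"] ne ss by auto
  show ?case
  proof (cases "len u < len (s \<otimes> u)")
    case True
    have su: "len (s \<otimes> u) = len u + 1" using len_S_cases[OF s(1) c(1)] True by auto
    have u: "ble u (s \<otimes> v)" using lift_below[OF less.prems(1) s(1) True] s by simp
    have e: "edge u v \<longleftrightarrow> ble (s \<otimes> u) (s \<otimes> v)"
      unfolding ed using edge_le cover_edge su s less.prems by auto
    have at: "atoms u v = insert (s \<otimes> u) (atoms u (s \<otimes> v))"
    proof (intro Set.set_eqI iffI)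
      fix a assume a: "a \<in> atoms u v"
      hence ac: "a \<in> carrier G" using le_carrier by (auto simp: atoms_def)
      show "a \<in> insert (s \<otimes> u) (atoms u (s \<otimes> v))"
      proof (cases "len (s \<otimes> a) < len a")
        case True' : True thus ?thesis using atom_up[OF a s(1) True] by simp
      next
        case False
        hence "ble a (s \<otimes> v)" using a lift_below[of a v s] S_asym[OF s(1) ac] s by (auto simp: atoms_def)
        thus ?thesis using a by (simp add: atoms_def)
      qed
    next
      fix a assume "a \<in> insert (s \<otimes> u) (atoms u (s \<otimes> v))"
      thus "a \<in> atoms u v" using svv le_trans lift_above[OF less.prems(1) s(1)] s su le_S[OF s(1) c(1) True]
        by (auto simp: atoms_def)
    qed
    have "card (atoms u (s \<otimes> v)) = 2" using card_atoms_2[OF u] s less.prems by simp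
    moreover have "s \<otimes> u \<in> atoms u (s \<otimes> v) \<longleftrightarrow> ble (s \<otimes> u) (s \<otimes> v)"
      using su le_S[OF s(1) c(1) True] by (simp add: atoms_def)
    ultimately show ?thesis unfolding e at using atoms_finite[OF svc, of u] by (auto simp: insert_absorb card_insert_if)
  next
    case False
    hence su: "len (s \<otimes> u) < len u" using S_asym[OF s(1) c(1)] by blast
    have l: "ble (s \<otimes> u) (s \<otimes> v)" using le_left_down[OF less.prems(1) s(1) su] .
    have lu: "len u = len (s \<otimes> u) + 1" using len_S_cases[OF s(1) c(1)] su by auto
    have IH: "edge u v \<longleftrightarrow> card (atoms (s \<otimes> u) (s \<otimes> v)) = 2"
      unfolding ed using less.hyps[OF _ l] s less.prems lu by simp
    define D where "D = {a \<in> atoms u v. len (s \<otimes> a) < len a}"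
    define A where "A = {a \<in> atoms u (s \<otimes> v). len a < len (s \<otimes> a)}"
    note card1 = atoms_split[OF s(1) less.prems(1) svl, folded A_def D_def]
    note card2 = atoms_down(2)[OF s(1) less.prems(1) su svl, folded D_def]
    have finD: "finite D" using atoms_finite[OF c(2)] by (simp add: D_def)
    let ?x = "s \<otimes> u"
    have xu: "len ?x < len (s \<otimes> ?x)" using su ss by simp
    have exu: "edge ?x u" using edge_S[OF s(1) suc] xu ss by simp
    show ?thesis
    proof (cases "ble u (s \<otimes> v)")
      case False
      hence "atoms u (s \<otimes> v) = {}" using le_trans by (auto simp: atoms_def)
      thus ?thesis using card1 card2 IH False by (simp add: A_def)
    next
      case usv: True
      have lsv: "len (s \<otimes> v) = len u + 2" using s less.prems by simp
      obtain a1 a2 where B: "atoms u (s \<otimes> v) = {a1, a2}" and a12: "a1 \<noteq> a2"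
        using card_atoms_2[OF usv lsv] by (auto simp: card_2_iff)
      have a1: "ble u a1" "len a1 = len u + 1" "ble a1 (s \<otimes> v)" and a2: "ble u a2" "len a2 = len u + 1" "ble a2 (s \<otimes> v)"
        using B unfolding atoms_def by auto
      have ac: "a1 \<in> carrier G" "a2 \<in> carrier G" using a1 a2 le_carrier by auto
      have ea: "edge u a1" "edge u a2" "edge a1 (s \<otimes> v)" "edge a2 (s \<otimes> v)"
        using cover_edge a1 a2 lsv by auto
      have sa: "s \<otimes> (s \<otimes> a1) = a1" "s \<otimes> (s \<otimes> a2) = a2" using s ac by (auto simp: S_cancel)
      have av: "a1 \<in> atoms u v" "a2 \<in> atoms u v" using a1 a2 le_trans[OF a1(3) svv] le_trans[OF a2(3) svv] by (simp_all add: atoms_def)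
      consider (one) "(len a1 < len (s \<otimes> a1)) \<noteq> (len a2 < len (s \<otimes> a2))"
        | (up) "len a1 < len (s \<otimes> a1)" "len a2 < len (s \<otimes> a2)"
        | (down) "len (s \<otimes> a1) < len a1" "len (s \<otimes> a2) < len a2"
        using S_asym[OF s(1)] ac by blast
      thus ?thesis
      proof cases
        case one
        hence "A = {a1} \<or> A = {a2}" unfolding A_def B by auto
        thus ?thesis using card1 card2 IH usv by auto
      next
        case up
        (* Both a1 and a2 have ascent s, so the number of atoms grows by one, and two atoms in D are needed.
   They come from the atoms b1, b2 other than u of the intervals from s u to a1 and a2. If b1 = b2, then u has the covers
   a1, a2 and s b1 with labels in the plane of the labels of u and b1. *)
        have A: "A = {a1, a2}" unfolding A_def B using up by auto
        have other: "\<exists>b. edge ?x b \<and> edge b a \<and> b \<noteq> u \<and> s \<otimes> b \<in> D \<and> b \<in> carrier G \<and> len b < len (s \<otimes> b)"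
          if a: "ble u a" "len a = len u + 1" "ble a (s \<otimes> v)" for a
        proof -
          have xa: "ble ?x a" using le_trans[OF edge_le[OF exu] a(1)] .
          have "u \<in> atoms ?x a" using edge_le[OF exu] lu a by (simp add: atoms_def)
          then obtain b where b: "b \<in> atoms ?x a" "b \<noteq> u" using other_atom[OF xa] a lu by auto
          have bc: "b \<in> carrier G" using b le_carrier by (auto simp: atoms_def)
          have nb: "\<not> len (s \<otimes> b) < len b" using atom_up[OF b(1) s(1) xu] b(2) ss by auto
          have "b \<in> atoms ?x (s \<otimes> v)" using b(1) le_trans[of b a "s \<otimes> v"] a(3) by (simp add: atoms_def)
          hence "b \<in> (\<lambda>a. s \<otimes> a) ` D" using atoms_down(1)[OF s(1) less.prems(1) su svl, folded D_def] b(2)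
            by (auto split: if_splits)
          then obtain d where d: "d \<in> D" "b = s \<otimes> d" by blast
          have "d \<in> carrier G" using d le_carrier by (auto simp: D_def atoms_def)
          hence "s \<otimes> b = d" using d s by (simp add: S_cancel)
          moreover have "edge b a" using b a lu cover_edge by (auto simp: atoms_def)
          ultimately show ?thesis using d b bc atoms_edge[OF b(1)] nb S_asym[OF s(1) bc] by blast
        qed
        obtain b1 where b1: "edge ?x b1" "edge b1 a1" "b1 \<noteq> u" "s \<otimes> b1 \<in> D" "b1 \<in> carrier G" "len b1 < len (s \<otimes> b1)"
          using other[OF a1] by blast
        obtain b2 where b2: "edge ?x b2" "edge b2 a2" "b2 \<noteq> u" "s \<otimes> b2 \<in> D" "b2 \<in> carrier G"
          using other[OF a2] by blast
        have "b1 \<noteq> b2"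
        proof
          assume bb: "b1 = b2"
          let ?r0 = "lab ?x u" and ?t3 = "lab ?x b1"
          have p1: "lab u a1 \<in> plane ?r0 ?t3" using diamond_plane(1)[OF exu ea(1) b1(1,2)] b1 by auto
          have p2: "lab u a2 \<in> plane ?r0 ?t3" using diamond_plane(1)[OF exu ea(2) b2(1,2)] b2 bb by auto
          have p3: "?t3 \<in> plane ?r0 ?t3" using b1(1) edge_iff plane_base(2) by auto
          have ut3: "u \<otimes> ?t3 = s \<otimes> b1"
            using lab_left[OF s(1) suc b1(5)] ss mult_lab[of u "s \<otimes> b1"] c b1(5) sc by simp
          have sb: "s \<otimes> b1 \<noteq> a1" "s \<otimes> b1 \<noteq> a2" using b1 up s by (auto simp: S_cancel)
          have lsb: "len (s \<otimes> b1) = len u + 1" using b1(4) by (simp add: D_def atoms_def)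
          have "lab u a1 \<noteq> lab u a2" "lab u a1 \<noteq> ?t3" "lab u a2 \<noteq> ?t3"
            using a12 sb ut3 mult_lab c ac by metis+
          thus False using three_covers_not_planar[OF c(1) p1 p2 p3] a1 a2 lsb ut3 mult_lab c ac by simp
        qed
        hence "s \<otimes> b1 \<noteq> s \<otimes> b2" using S_inj[OF s(1)] b1 b2 by simp
        hence "card D \<ge> 2" using b1(4) b2(4) finD card_mono[of D "{s \<otimes> b1, s \<otimes> b2}"] by simp
        thus ?thesis using card1 card2 IH usv A a12 by simp
      next
        case down
        (* Both a1 and a2 have descent s, so the number of atoms drops by one, from at least three. It does
   not become two: otherwise a second coatom c lies above a1 and a2, and the diamonds below force the
   covers u, s a1, s a2 of s u into a plane. *)
        have A: "A = {}" unfolding A_def B using down by auto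
        have aD: "{a1, a2} \<subseteq> D" using av down by (simp add: D_def)
        hence D2: "card D \<ge> 2" using card_mono[OF finD aD] a12 by simp
        have "card D \<noteq> 2"
        proof
          assume "card D = 2"
          hence "D = {a1, a2}" using card_subset_eq[OF finD aD] a12 by simp
          moreover have "atoms u v = D"
            using card1 A card_subset_eq[OF atoms_finite[OF c(2)], of D u] by (simp add: D_def)
          ultimately have atv: "atoms u v = {a1, a2}" by simp
          have "s \<otimes> v \<in> atoms a1 v" using a1 svv lsv by (simp add: atoms_def)
          then obtain cc where cc: "cc \<in> atoms a1 v" "cc \<noteq> s \<otimes> v"
            using other_atom[of a1 v "s \<otimes> v"] av a1 less.prems by (auto simp: atoms_def)
          have cv: "ble a1 cc" "len cc = len u + 2" "ble cc v" using cc a1 by (auto simp: atoms_def)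
          have ccc: "cc \<in> carrier G" using cv le_carrier by auto
          have ucc: "ble u cc" using le_trans[OF a1(1) cv(1)] .
          have "atoms u cc \<subseteq> {a1, a2}" using atv le_trans[OF _ cv(3)] unfolding atoms_def by blast
          moreover have "card (atoms u cc) = 2" using card_atoms_2[OF ucc cv(2)] .
          ultimately have "atoms u cc = {a1, a2}" using a12 by (metis card_2_iff card_subset_eq finite.emptyI finite.insertI)
          hence a2c: "ble a2 cc" by (auto simp: atoms_def)
          have scc: "len (s \<otimes> cc) < len cc"
          proof (rule ccontr)
            assume "\<not> ?thesis"
            hence "ble cc (s \<otimes> v)" using lift_below[OF cv(3) s(1) _ svl] S_asym[OF s(1) ccc] by blast
            from le_len_eq[OF this] show False using cc cv lsv by simp
          qed
          let ?z = "s \<otimes> cc" and ?b1 = "s \<otimes> a1" and ?b2 = "s \<otimes> a2"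
          have zc: "?z \<in> carrier G" "?b1 \<in> carrier G" "?b2 \<in> carrier G" using sc ccc ac by auto
          have lz: "len cc = len ?z + 1" using len_S_cases[OF s(1) ccc] scc by auto
          have lb: "len a1 = len ?b1 + 1" "len a2 = len ?b2 + 1" using len_S_cases[OF s(1)] ac down by fastforce+
          have ezv: "edge ?z (s \<otimes> v)" using cover_edge[OF le_left_down[OF cv(3) s(1) scc]] lz cv lsv by simp
          have eb1z: "edge ?b1 ?z" using cover_edge[OF le_left_down[OF cv(1) s(1) down(1)]] lz cv lb a1 by simp
          have eb1a: "edge ?b1 a1" using edge_S[OF s(1) zc(2)] sa down by simp
          have exb1: "edge ?x ?b1" using cover_edge[OF le_left_down[OF a1(1) s(1) su]] lb lu a1 by simp
          have ea1c: "edge a1 cc" "edge a2 cc" using cover_edge cv a1 a2 a2c by auto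
          have a1z: "a1 \<noteq> ?z" using down s ccc scc by (auto simp: S_cancel)
          let ?t1 = "lab u a1" and ?t2 = "lab u a2" and ?p = "lab a1 (s \<otimes> v)" and ?y = "lab a1 cc" and ?r1 = "lab ?b1 a1"
          (* Four diamonds, each sharing two labels with the plane found so far: from u to s v, from u to c,
   from s a1 to s v, and from s u to a1. *)
          have p: "?p \<in> plane ?t1 ?t2" using diamond_plane(1)[OF ea(1,3,2,4) a12] .
          have y: "?y \<in> plane ?t1 ?t2" using diamond_plane(1)[OF ea(1) ea1c(1) ea(2) ea1c(2) a12] .
          have py: "?p \<noteq> ?y" using cc(2) mult_lab ac svc ccc by metis
          have "lab ?b1 ?z = ?y" using lab_left[OF s(1) ac(1) ccc] .
          hence p': "?p \<in> plane ?r1 ?y" using diamond_plane(1)[OF eb1a ea(3) eb1z ezv a1z] by simp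
          have yT: "?y \<in> T" and r1T: "?r1 \<in> T" and t1T: "?t1 \<in> T" "?t2 \<in> T" using ea1c eb1a ea edge_iff by auto
          have "?r1 \<in> plane ?p ?y"
            using plane_change[OF p' plane_base(2)[OF yT] py] plane_base(1)[OF r1T] by blast
          hence r1: "?r1 \<in> plane ?t1 ?t2" using plane_sub[OF p y] by blast
          have xb: "lab ?x ?b1 = ?t1" "lab ?x ?b2 = ?t2" using lab_left[OF s(1) c(1)] ac by auto
          let ?r0 = "lab ?x u"
          have ub1: "u \<noteq> ?b1" using su sa down by auto
          have "?r1 \<in> plane ?r0 ?t1" using diamond_plane(2)[OF exu ea(1) exb1 eb1a ub1] xb by simp
          moreover have r0T: "?r0 \<in> T" using exu edge_iff by auto
          moreover have "?t1 \<noteq> ?r1"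
          proof
            assume "?t1 = ?r1"
            hence "a1 = ?x \<otimes> ?t1 \<otimes> ?t1" using mult_lab[OF suc zc(2)] xb(1) mult_lab[OF zc(2) ac(1)] by simp
            hence "a1 = ?x" using T_cancel_right[OF t1T(1) suc] by simp
            thus False using a1 lu by simp
          qed
          ultimately have "?r0 \<in> plane ?t1 ?r1"
            using plane_change[OF plane_base(2)[OF t1T(1)]] plane_base(1) by blast
          hence r0: "?r0 \<in> plane ?t1 ?t2" using plane_sub[OF plane_base(1)[OF t1T(1)] r1] by blast
          have xx: "?x \<otimes> ?r0 = u" "?x \<otimes> ?t1 = ?b1" "?x \<otimes> ?t2 = ?b2"
            using mult_lab suc c zc xb by metis+
          have ub2: "u \<noteq> ?b2" "?b1 \<noteq> ?b2" using su sa down a12 by auto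
          have "?r0 \<noteq> ?t1" "?r0 \<noteq> ?t2" "?t1 \<noteq> ?t2" using xx ub1 ub2 by metis+
          thus False using three_covers_not_planar[OF suc r0 plane_base(1)[OF t1T(1)] plane_base(2)[OF t1T(2)]]
            xx lb a1 a2 lu by simp
        qed
        thus ?thesis using D2 card1 card2 IH usv A by simp
      qed
    qed
  qed
qed

text \<open>The right-hand side speaks of the poset only, since the length difference is the rank. So short edge
  intervals are recognised by the poset. For the nontrivial direction, take a long edge of
  least length difference: by \<open>long_edge_path3\<close> the difference is three.\<close>

lemma short_edge_iff:
  "short_edge_interval G S u v \<longleftrightarrow>
    (\<forall>x y. ble u x \<and> ble x y \<and> ble y v \<and> len y = len x + 3 \<longrightarrow> card (atoms x y) \<noteq> 2)"
proof
  assume sh: "short_edge_interval G S u v"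
  show "\<forall>x y. ble u x \<and> ble x y \<and> ble y v \<and> len y = len x + 3 \<longrightarrow> card (atoms x y) \<noteq> 2"
  proof (intro allI impI notI)
    fix x y assume a: "ble u x \<and> ble x y \<and> ble y v \<and> len y = len x + 3" "card (atoms x y) = 2"
    hence e: "edge x y" using card_atoms_3 by blast
    have "x \<in> bruhat_interval G S u v" "y \<in> bruhat_interval G S u v"
      using a le_trans le_carrier unfolding bruhat_interval_def by blast+
    thus False using sh e a unfolding short_edge_interval_def by fastforce
  qed
next
  assume n: "\<forall>x y. ble u x \<and> ble x y \<and> ble y v \<and> len y = len x + 3 \<longrightarrow> card (atoms x y) \<noteq> 2"
  have "len y = len x + 1" if "edge x y" "ble u x" "ble y v" for x y
    using that
  proof (induction "len y - len x" arbitrary: x y rule: less_induct)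
    case less
    show ?case
    proof (rule ccontr)
      assume "len y \<noteq> len x + 1"
      have c: "x \<in> carrier G" "y \<in> carrier G" "lab x y \<in> T" "len x < len y" using less.prems edge_iff by auto
      have "even (len y) \<noteq> even (len x)" using odd_len_T[OF c(1,3)] mult_lab[OF c(1,2)] by simp
      hence l3: "len y \<ge> len x + 3"
      proof -
        have "len y \<noteq> len x + 2" using \<open>even (len y) \<noteq> even (len x)\<close> by auto
        thus ?thesis using \<open>len y \<noteq> len x + 1\<close> c(4) by linarith
      qed
      have "(3::nat) = Suc (Suc (Suc 0))" by simp
      hence "(edge ^^ Suc (Suc (Suc 0))) x y" using long_edge_path3[OF less.prems(1) l3] by metis
      then obtain p q where pq: "edge x p" "edge p q" "edge q y" by (auto simp: OO_def)
      have bl: "ble u p" "ble u q" "ble p v" "ble q v"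
        using pq less.prems edge_le le_trans by meson+
      have "len x < len p" "len p < len q" "len q < len y" using pq edge_len by auto
      hence "len p = len x + 1" "len q = len p + 1" "len y = len q + 1"
        using less.hyps[of p x] less.hyps[of q p] less.hyps[of y q] pq bl less.prems by auto
      hence "len y = len x + 3" by simp
      moreover have xy: "ble x y" using edge_le less.prems by auto
      ultimately have "card (atoms x y) = 2" using card_atoms_3 less.prems(1) by blast
      thus False using n less.prems xy \<open>len y = len x + 3\<close> by blast
    qed
  qed
  thus "short_edge_interval G S u v" unfolding short_edge_interval_def bruhat_interval_def by blast
qed




section \<open>Hecke operators\<close>

abbreviation q :: "int poly" where "q \<equiv> q_var"

lemma q_nz [simp]: "q \<noteq> 0" by (simp add: q_var_def)

text \<open>The R-polynomials are built by an operator \<open>Ll s\<close> for every generator, and the point is that the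
  product along a reduced word depends on the element only. For \<open>Nl\<close>, the transpose of left multiplication
  in the Hecke algebra, this follows from the commuting right operators \<open>Nr\<close>. The operator
  \<open>Ml s\<close> inverts \<open>Nl s\<close> up to the factor \<open>q\<close>, and \<open>Ll s\<close> is \<open>Ml s\<close> rescaled by
  powers of \<open>q\<close>. The values outside the carrier are chosen such that these identities hold on the
  whole type.\<close>

definition Nl :: "'a \<Rightarrow> ('a \<Rightarrow> int poly) \<Rightarrow> 'a \<Rightarrow> int poly" where
  "Nl s f w = (if w \<notin> carrier G then f w else if len w < len (s \<otimes> w) then f (s \<otimes> w)
     else q * f (s \<otimes> w) + (1 - q) * f w)"
definition Nr :: "'a \<Rightarrow> ('a \<Rightarrow> int poly) \<Rightarrow> 'a \<Rightarrow> int poly" where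
  "Nr t f w = (if w \<notin> carrier G then f w else if len w < len (w \<otimes> t) then f (w \<otimes> t)
     else q * f (w \<otimes> t) + (1 - q) * f w)"
definition Ml :: "'a \<Rightarrow> ('a \<Rightarrow> int poly) \<Rightarrow> 'a \<Rightarrow> int poly" where
  "Ml s f w = (if w \<notin> carrier G then q * f w else if len w < len (s \<otimes> w) then f (s \<otimes> w) + (q - 1) * f w
     else q * f (s \<otimes> w))"
definition Ll :: "'a \<Rightarrow> ('a \<Rightarrow> int poly) \<Rightarrow> 'a \<Rightarrow> int poly" where
  "Ll s f w = (if w \<notin> carrier G then q * f w else if len w < len (s \<otimes> w) then (q - 1) * f w + q * f (s \<otimes> w)
     else f (s \<otimes> w))"

lemma exchange_up:
  assumes "s \<in> S" "t \<in> S" "w \<in> carrier G" "len w < len (s \<otimes> w)" "len w < len (w \<otimes> t)" "s \<otimes> w \<noteq> w \<otimes> t"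
  shows "len (s \<otimes> w) < len (s \<otimes> w \<otimes> t)"
  using edge_len[OF edge_left[OF edge_right[OF assms(2,3,5)] assms(1)]] assms by (simp add: S_carrier m_assoc)

lemma exchange_mixed:
  assumes "s \<in> S" "t \<in> S" "w \<in> carrier G" "len (w \<otimes> t) < len w" "s \<otimes> w \<noteq> w \<otimes> t"
  shows "len (s \<otimes> w \<otimes> t) < len (s \<otimes> w)"
proof -
  have c: "s \<in> carrier G" "t \<in> carrier G" using assms by auto
  have "edge (w \<otimes> t) w" using edge_right[OF assms(2), of "w \<otimes> t"] assms c by (simp add: S_cancel_right)
  moreover have "w \<noteq> s \<otimes> (w \<otimes> t)"
  proof
    assume "w = s \<otimes> (w \<otimes> t)"
    hence "s \<otimes> w = s \<otimes> (s \<otimes> (w \<otimes> t))" by simp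
    thus False using assms c by (simp add: S_cancel)
  qed
  ultimately have "edge (s \<otimes> (w \<otimes> t)) (s \<otimes> w)" using edge_left assms by blast
  thus ?thesis using edge_len assms c by (simp add: m_assoc)
qed

text \<open>If \<open>s w = w t\<close>, both sides involve the same two values. Otherwise \<open>s\<close> and \<open>t\<close> act
  independently on the lengths, by the exchange lemmas, and both sides use the same four values.\<close>

lemma N_commute:
  assumes s: "s \<in> S" and t: "t \<in> S" shows "Nl s (Nr t f) = Nr t (Nl s f)"
proof
  fix w
  have st: "s \<in> carrier G" "t \<in> carrier G" using s t by auto
  show "Nl s (Nr t f) w = Nr t (Nl s f) w"
  proof (cases "w \<in> carrier G")
    case False thus ?thesis by (simp add: Nl_def Nr_def)
  next
    case w: True
    have c: "s \<otimes> w \<in> carrier G" "w \<otimes> t \<in> carrier G" using w st by auto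
    have asc: "s \<otimes> (w \<otimes> t) = s \<otimes> w \<otimes> t" using w st by (simp add: m_assoc)
    show ?thesis
    proof (cases "s \<otimes> w = w \<otimes> t")
      case True
      have "s \<otimes> w \<otimes> t = w" unfolding True using w t by (simp add: S_cancel_right)
      thus ?thesis unfolding Nl_def Nr_def using w c asc True by (auto simp: algebra_simps)
    next
      case ne: False
      have ls: "len (s \<otimes> w) \<noteq> len w" "len (w \<otimes> t) \<noteq> len w" using len_S_cases[OF s w] len_S_cases_right[OF t w] by auto
      have 1: "len (w \<otimes> t) < len w \<Longrightarrow> len (s \<otimes> w \<otimes> t) < len (s \<otimes> w)" using exchange_mixed[OF s t w _ ne] .
      have 2: "len w < len (s \<otimes> w) \<Longrightarrow> len w < len (w \<otimes> t) \<Longrightarrow> len (s \<otimes> w) < len (s \<otimes> w \<otimes> t)"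
        using exchange_up[OF s t w _ _ ne] .
      have c1: "len (s \<otimes> w \<otimes> t) = len (s \<otimes> w) + 1 \<or> len (s \<otimes> w) = len (s \<otimes> w \<otimes> t) + 1" using len_S_cases_right[OF t c(1)] .
      have c2: "len (s \<otimes> w \<otimes> t) = len (w \<otimes> t) + 1 \<or> len (w \<otimes> t) = len (s \<otimes> w \<otimes> t) + 1" using len_S_cases[OF s c(2)] asc by simp
      have c3: "len (s \<otimes> w) = len w + 1 \<or> len w = len (s \<otimes> w) + 1" using len_S_cases[OF s w] .
      have c4: "len (w \<otimes> t) = len w + 1 \<or> len w = len (w \<otimes> t) + 1" using len_S_cases_right[OF t w] .
      have 3: "len (s \<otimes> w) < len (s \<otimes> w \<otimes> t)" if "len (s \<otimes> w) < len w" "len w < len (w \<otimes> t)"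
      proof -
        have "edge w (w \<otimes> t)" using edge_right[OF t w] that by simp
        from edge_len[OF edge_left[OF this s]] ne show ?thesis using asc by auto
      qed
      consider "len w < len (s \<otimes> w)" "len w < len (w \<otimes> t)" | "len w < len (s \<otimes> w)" "len (w \<otimes> t) < len w"
        | "len (s \<otimes> w) < len w" "len w < len (w \<otimes> t)" | "len (s \<otimes> w) < len w" "len (w \<otimes> t) < len w"
        using ls by linarith
      thus ?thesis
      proof cases
        case C1: 1
        hence "len (s \<otimes> w) < len (s \<otimes> w \<otimes> t)" "len (w \<otimes> t) < len (s \<otimes> w \<otimes> t)" using 2 c1 c2 c3 c4 by linarith+
        thus ?thesis using C1 w c asc by (simp add: Nl_def Nr_def)
      next
        case C2: 2
        hence "\<not> len (s \<otimes> w) < len (s \<otimes> w \<otimes> t)" "len (w \<otimes> t) < len (s \<otimes> w \<otimes> t)" using 1 c1 c2 c3 c4 by linarith+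
        thus ?thesis using C2 w c asc by (simp add: Nl_def Nr_def)
      next
        case C3: 3
        hence "len (s \<otimes> w) < len (s \<otimes> w \<otimes> t)" "\<not> len (w \<otimes> t) < len (s \<otimes> w \<otimes> t)" using 3 c1 c2 c3 c4 by linarith+
        thus ?thesis using C3 w c asc by (simp add: Nl_def Nr_def)
      next
        case C4: 4
        hence "\<not> len (s \<otimes> w) < len (s \<otimes> w \<otimes> t)" "\<not> len (w \<otimes> t) < len (s \<otimes> w \<otimes> t)" using 1 c1 c2 c3 c4 by linarith+
        thus ?thesis using C4 w c asc by (simp add: Nl_def Nr_def algebra_simps)
      qed
    qed
  qed
qed

lemma fold_N_commute:
  assumes "as \<in> lists S" "bs \<in> lists S"
  shows "foldr Nl as (foldr Nr bs f) = foldr Nr bs (foldr Nl as f)"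
proof -
  have 1: "Nl s (foldr Nr bs g) = foldr Nr bs (Nl s g)" if "s \<in> S" for s g
    using assms(2) by (induction bs rule: list.induct) (auto simp: N_commute[OF that])
  show ?thesis using assms(1) by (induction as rule: list.induct) (auto simp: 1)
qed

lemma fold_Nl_eval:
  assumes "as \<in> lists S" "w \<in> carrier G" "len (wp (rev as) \<otimes> w) = length as + len w"
  shows "foldr Nl as f w = f (wp (rev as) \<otimes> w)"
  using assms
proof (induction as arbitrary: w rule: list.induct)
  case (Cons s as)
  have s: "s \<in> S" "as \<in> lists S" "s \<in> carrier G" using Cons.prems by auto
  have r: "rev as \<in> lists S" using s by (auto simp: in_lists_conv_set)
  have sw: "s \<otimes> w \<in> carrier G" using s Cons.prems by auto
  have e: "wp (rev (s # as)) \<otimes> w = wp (rev as) \<otimes> (s \<otimes> w)"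
    using s r Cons.prems(2) wp_snoc[OF r s(1)] by (simp add: m_assoc)
  have "len (wp (rev as) \<otimes> (s \<otimes> w)) \<le> length as + len (s \<otimes> w)"
    using len_mult[OF wp_closed[OF r] sw] len_le[OF r] by simp
  hence l: "len (s \<otimes> w) = len w + 1" using Cons.prems(3) len_S_cases[OF s(1) Cons.prems(2)] unfolding e by simp
  have "foldr Nl as f (s \<otimes> w) = f (wp (rev as) \<otimes> (s \<otimes> w))"
    using Cons.IH[OF s(2) sw] Cons.prems(3) l unfolding e by simp
  thus ?case unfolding e using l Cons.prems(2) by (simp add: Nl_def[of s])
qed simp

lemma fold_Nr_eval:
  assumes "bs \<in> lists S" "w \<in> carrier G" "len (w \<otimes> wp bs) = len w + length bs"
  shows "foldr Nr bs f w = f (w \<otimes> wp bs)"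
  using assms
proof (induction bs arbitrary: w rule: list.induct)
  case (Cons s bs)
  have s: "s \<in> S" "bs \<in> lists S" "s \<in> carrier G" using Cons.prems by auto
  have sw: "w \<otimes> s \<in> carrier G" using s Cons.prems by auto
  have e: "w \<otimes> wp (s # bs) = w \<otimes> s \<otimes> wp bs"
    using s Cons.prems(2) by (simp add: m_assoc)
  have "len (w \<otimes> s \<otimes> wp bs) \<le> length bs + len (w \<otimes> s)"
    using len_mult[OF sw wp_closed[OF s(2)]] len_le[OF s(2)] by simp
  hence l: "len (w \<otimes> s) = len w + 1" using Cons.prems(3) len_S_cases_right[OF s(1) Cons.prems(2)] unfolding e by simp
  have "foldr Nr bs f (w \<otimes> s) = f (w \<otimes> s \<otimes> wp bs)"
    using Cons.IH[OF s(2) sw] Cons.prems(3) l unfolding e by simp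
  thus ?case unfolding e using l Cons.prems(2) by (simp add: Nr_def[of s])
qed simp

text \<open>Evaluation at \<open>\<one>\<close> after a left product picks the value at the inverse of the element, and
  evaluation at any other \<open>w\<close> reduces to \<open>\<one>\<close> by the commuting right operators.\<close>

lemma fold_Nl_cong:
  assumes a: "as \<in> lists S" "len (wp as) = length as" and b: "bs \<in> lists S" "len (wp bs) = length bs"
    and e: "wp as = wp bs"
  shows "foldr Nl as f = foldr Nl bs f"
proof
  fix w show "foldr Nl as f w = foldr Nl bs f w"
  proof (cases "w \<in> carrier G")
    case False
    have "foldr Nl as f w = f w" for as by (induction as) (auto simp: Nl_def False)
    thus ?thesis by simp
  next
    case w: True
    have *: "foldr Nl as f w = foldr Nr (word w) f (inv (wp as))"
      if "as \<in> lists S" "len (wp as) = length as" for as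
    proof -
      have "foldr Nl as f w = foldr Nr (word w) (foldr Nl as f) \<one>"
        using fold_Nr_eval[of "word w" \<one>] word[OF w] w by simp
      also have "\<dots> = foldr Nl as (foldr Nr (word w) f) \<one>" using fold_N_commute[OF that(1) word(1)[OF w]] by simp
      also have "\<dots> = foldr Nr (word w) f (inv (wp as))"
        using fold_Nl_eval[OF that(1), of \<one>] that wp_rev[OF that(1)] len_inv by simp
      finally show ?thesis .
    qed
    show ?thesis using *[OF a] *[OF b] e by simp
  qed
qed

lemma Nl_scale: "Nl s (\<lambda>w. c * f w) = (\<lambda>w. c * Nl s f w)"
  and Ml_scale: "Ml s (\<lambda>w. c * f w) = (\<lambda>w. c * Ml s f w)"
  by (auto simp: Nl_def Ml_def fun_eq_iff algebra_simps)
lemma fold_Nl_scale: "foldr Nl as (\<lambda>w. c * f w) = (\<lambda>w. c * foldr Nl as f w)"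
  by (induction as) (auto simp: Nl_scale)
lemma fold_Ml_scale: "foldr Ml as (\<lambda>w. c * f w) = (\<lambda>w. c * foldr Ml as f w)"
  by (induction as) (auto simp: Ml_scale)

lemma Ml_Nl: assumes "s \<in> S" shows "Ml s (Nl s f) = (\<lambda>w. q * f w)" "Nl s (Ml s f) = (\<lambda>w. q * f w)"
proof -
  have s: "s \<in> carrier G" using assms by auto
  have "Ml s (Nl s f) w = q * f w \<and> Nl s (Ml s f) w = q * f w" for w
  proof (cases "w \<in> carrier G")
    case w: True
    have ss: "s \<otimes> (s \<otimes> w) = w" using S_cancel[OF assms w] .
    have c: "s \<otimes> w \<in> carrier G" using s w by simp
    show ?thesis
    proof (cases "len w < len (s \<otimes> w)")
      case True
      hence "\<not> len (s \<otimes> w) < len w" by simp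
      thus ?thesis using True w c by (simp add: Ml_def Nl_def ss algebra_simps)
    next
      case False
      hence "len (s \<otimes> w) < len w" using S_asym[OF assms w] by blast
      thus ?thesis using False w c by (simp add: Ml_def Nl_def ss algebra_simps)
    qed
  qed (simp add: Ml_def Nl_def)
  thus "Ml s (Nl s f) = (\<lambda>w. q * f w)" "Nl s (Ml s f) = (\<lambda>w. q * f w)" by auto
qed

lemma fold_Ml_Nl:
  assumes "as \<in> lists S"
  shows "foldr Ml as (foldr Nl (rev as) f) = (\<lambda>w. q ^ length as * f w)"
  using assms
proof (induction as arbitrary: f rule: list.induct)
  case (Cons s as)
  have s: "s \<in> S" "as \<in> lists S" using Cons.prems by auto
  show ?case using Cons.IH[OF s(2), of "Nl s f"] s by (simp add: Ml_scale Ml_Nl mult.assoc mult.left_commute)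
qed simp

lemma fold_Nl_Ml:
  assumes "as \<in> lists S"
  shows "foldr Nl (rev as) (foldr Ml as f) = (\<lambda>w. q ^ length as * f w)"
  using assms
proof (induction as arbitrary: f rule: list.induct)
  case (Cons s as)
  have s: "s \<in> S" "as \<in> lists S" using Cons.prems by auto
  show ?case using Cons.IH[OF s(2), of f] s by (simp add: Ml_Nl fold_Nl_scale mult.assoc)
qed simp

text \<open>Both products invert the same product of operators \<open>Nl\<close>, up to the same power of \<open>q\<close>.\<close>

lemma fold_Ml_cong:
  assumes a: "as \<in> lists S" "len (wp as) = length as" and b: "bs \<in> lists S" "len (wp bs) = length bs"
    and e: "wp as = wp bs"
  shows "foldr Ml as f = foldr Ml bs f"
proof
  fix w
  have r: "rev as \<in> lists S" "rev bs \<in> lists S" using a b by (auto simp: in_lists_conv_set)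
  have N: "foldr Nl (rev as) g = foldr Nl (rev bs) g" for g
    using fold_Nl_cong[OF r(1) _ r(2)] a b e by (simp add: wp_rev len_inv)
  have l: "length as = length bs" using a b e by simp
  have "foldr Ml as (foldr Nl (rev as) (foldr Ml bs f)) w = q ^ length as * foldr Ml bs f w"
    using fold_Ml_Nl[OF a(1)] by simp
  moreover have "foldr Ml as (foldr Nl (rev as) (foldr Ml bs f)) w = q ^ length bs * foldr Ml as f w"
    unfolding N fold_Nl_Ml[OF b(1)] fold_Ml_scale ..
  ultimately show "foldr Ml as f w = foldr Ml bs f w" using l by simp
qed

lemma Ml_Ll: assumes "s \<in> S" shows "Ml s (\<lambda>w. q ^ len w * f w) = (\<lambda>w. q ^ len w * Ll s f w)"
proof
  fix w
  show "Ml s (\<lambda>w. q ^ len w * f w) w = q ^ len w * Ll s f w"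
  proof (cases "w \<in> carrier G")
    case w: True
    show ?thesis
    proof (cases "len w < len (s \<otimes> w)")
      case True
      hence "len (s \<otimes> w) = len w + 1" using len_S_cases[OF assms w] by linarith
      thus ?thesis using w by (simp add: Ml_def Ll_def algebra_simps)
    next
      case False
      hence "len w = len (s \<otimes> w) + 1" using len_S_cases[OF assms w] by linarith
      thus ?thesis using w by (simp add: Ml_def Ll_def)
    qed
  qed (simp add: Ml_def Ll_def)
qed

lemma fold_Ll_cong:
  assumes a: "as \<in> lists S" "len (wp as) = length as" and b: "bs \<in> lists S" "len (wp bs) = length bs"
    and e: "wp as = wp bs"
  shows "foldr Ll as f = foldr Ll bs f"
proof -
  have *: "foldr Ml as (\<lambda>w. q ^ len w * f w) = (\<lambda>w. q ^ len w * foldr Ll as f w)" if "as \<in> lists S" for as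
    using that by (induction as rule: list.induct) (auto simp: Ml_Ll)
  have "(\<lambda>w. q ^ len w * foldr Ll as f w) = (\<lambda>w. q ^ len w * foldr Ll bs f w)"
    using fold_Ml_cong[OF assms] *[OF a(1)] *[OF b(1)] by metis
  thus ?thesis by (auto simp: fun_eq_iff)
qed

text \<open>The ordinary R-polynomials.\<close>

definition Rf :: "'a \<Rightarrow> 'a \<Rightarrow> int poly" where
  "Rf u v = foldr Ll (word v) (\<lambda>w. if w = \<one> then 1 else 0) u"

lemma Rf_rec:
  assumes s: "s \<in> S" and v: "v \<in> carrier G" and l: "len (s \<otimes> v) < len v"
  shows "Rf u v = Ll s (\<lambda>w. Rf w (s \<otimes> v)) u"
proof -
  have c: "s \<otimes> v \<in> carrier G" using s v by auto
  have w: "s # word (s \<otimes> v) \<in> lists S" "wp (s # word (s \<otimes> v)) = v" "length (s # word (s \<otimes> v)) = len v"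
    using word[OF c] s v len_S_cases[OF s v] l by (auto simp: S_cancel)
  have "foldr Ll (word v) f = foldr Ll (s # word (s \<otimes> v)) f" for f
    using fold_Ll_cong[OF word(1)[OF v] _ w(1)] word[OF v] w by simp
  thus ?thesis by (simp add: Rf_def)
qed

lemma Rf_one: "Rf u \<one> = (if u = \<one> then 1 else 0)"
proof -
  have "word \<one> = []" using word(3)[of \<one>] by simp
  thus ?thesis by (simp add: Rf_def)
qed


lemma Rf_self: assumes "v \<in> carrier G" shows "Rf v v = 1"
  using assms
proof (induction "len v" arbitrary: v rule: less_induct)
  case less
  show ?case
  proof (cases "v = \<one>")
    case False
    obtain s where s: "s \<in> S" "len v = len (s \<otimes> v) + 1" using left_descent[OF less.prems False] .
    have "Rf (s \<otimes> v) (s \<otimes> v) = 1" using less.hyps[of "s \<otimes> v"] s less.prems by (simp add: S_carrier)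
    thus ?thesis using Rf_rec[OF s(1) less.prems, of v] s less.prems by (simp add: Ll_def)
  qed (simp add: Rf_one)
qed

lemma Rf_le: assumes "v \<in> carrier G" "u \<in> carrier G" "Rf u v \<noteq> 0" shows "ble u v"
  using assms
proof (induction "len v" arbitrary: u v rule: less_induct)
  case less
  show ?case
  proof (cases "v = \<one>")
    case True thus ?thesis using less.prems by (auto simp: Rf_one split: if_splits)
  next
    case False
    obtain s where s: "s \<in> S" "len v = len (s \<otimes> v) + 1" using left_descent[OF less.prems(1) False] .
    have sc: "s \<in> carrier G" using s by auto
    have svv: "ble (s \<otimes> v) v" using S_le[OF s(1) less.prems(1)] s by simp
    have IH: "ble x v" if "x \<in> carrier G" "Rf x (s \<otimes> v) \<noteq> 0" for x
      using less.hyps[of "s \<otimes> v" x] s less.prems(1) sc that svv le_trans by fastforce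
    have "Rf u v = Ll s (\<lambda>w. Rf w (s \<otimes> v)) u" using Rf_rec[OF s(1) less.prems(1)] s by simp
    hence "Rf u (s \<otimes> v) \<noteq> 0 \<or> Rf (s \<otimes> u) (s \<otimes> v) \<noteq> 0"
      using less.prems(2,3) by (auto simp: Ll_def split: if_splits)
    thus ?thesis
    proof
      assume "Rf u (s \<otimes> v) \<noteq> 0" thus ?thesis using IH less.prems by simp
    next
      assume "Rf (s \<otimes> u) (s \<otimes> v) \<noteq> 0"
      hence "ble (s \<otimes> u) v" using IH less.prems sc by simp
      from lift_above[OF this s(1)] s less.prems show ?thesis by (simp add: S_cancel)
    qed
  qed
qed

lemma MR_le:
  assumes J: "J \<subseteq> S" and u: "u \<in> MR J" and z: "z \<in> par J" shows "ble u (u \<otimes> z)"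
proof -
  have uc: "u \<in> carrier G" using u MR_carrier by auto
  obtain ws where ws: "ws \<in> lists J" "wp ws = z" "length ws = len z" using par_reduced[OF J z] .
  have "len (wp ws) = length ws \<Longrightarrow> ble u (u \<otimes> wp ws)" using ws(1)
  proof (induction ws rule: rev_induct)
    case Nil thus ?case using uc by simp
  next
    case (snoc r ws)
    have r: "r \<in> J" "ws \<in> lists J" "r \<in> S" "ws \<in> lists S" using snoc.prems J by auto
    have wc: "wp ws \<in> carrier G" "r \<in> carrier G" using r by auto
    have zr: "wp (ws @ [r]) = wp ws \<otimes> r" using r by (simp add: wp_snoc)
    have l: "len (wp ws) = length ws" "len (wp ws \<otimes> r) = length ws + 1"
      using snoc.prems(1) len_le[OF r(4)] len_S_cases_right[OF r(3) wc(1)] zr by auto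
    have "ble u (u \<otimes> wp ws)" using snoc.IH r l by simp
    moreover have "len (u \<otimes> wp ws) < len (u \<otimes> wp ws \<otimes> r)"
      using MR_len[OF J u wp_par[OF J r(2)]] MR_len[OF J u wp_par[OF J snoc.prems(2)]] l zr uc wc
      by (simp add: m_assoc)
    hence "ble (u \<otimes> wp ws) (u \<otimes> wp ws \<otimes> r)" using edge_le[OF edge_right[OF r(3)]] uc wc by simp
    ultimately show ?case using le_trans zr uc wc by (metis m_assoc)
  qed
  thus ?thesis using ws by simp
qed

lemma lower_S_stable:
  assumes "s \<in> S" "v \<in> carrier G" "len (s \<otimes> v) < len v" "y \<in> carrier G"
  shows "ble (s \<otimes> y) v \<longleftrightarrow> ble y v"
  using lift_above[of y v s] lift_above[of "s \<otimes> y" v s] assms by (auto simp: S_cancel)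

section \<open>Parabolic R-polynomials\<close>

definition coset_below :: "'a set \<Rightarrow> 'a \<Rightarrow> 'a \<Rightarrow> 'a set" where
  "coset_below J u v = {z \<in> par J. ble (u \<otimes> z) v}"

text \<open>Deodhar's formula for the parabolic R-polynomials, taken as their construction. The second
  argument may be any element; the values outside the minimal representatives enter in the proofs.\<close>

definition RJ :: "'a set \<Rightarrow> int poly \<Rightarrow> 'a \<Rightarrow> 'a \<Rightarrow> int poly" where
  "RJ J x u v = (\<Sum>z\<in>coset_below J u v. (- x) ^ len z * Rf (u \<otimes> z) v)"

lemma coset_below_finite:
  assumes "J \<subseteq> S" "u \<in> carrier G" "v \<in> carrier G" shows "finite (coset_below J u v)"
proof (rule finite_imageD)
  show "inj_on (\<lambda>z. u \<otimes> z) (coset_below J u v)"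
    using assms par_closed[OF assms(1)] by (intro inj_onI) (auto simp: coset_below_def subsetD)
  show "finite ((\<lambda>z. u \<otimes> z) ` coset_below J u v)"
    by (rule finite_subset[OF _ finite_lower[OF assms(3)]]) (auto simp: coset_below_def)
qed

lemma RJ_eq:
  assumes J: "J \<subseteq> S" and "u \<in> carrier G" "v \<in> carrier G" "finite X" "coset_below J u v \<subseteq> X" "X \<subseteq> par J"
  shows "RJ J x u v = (\<Sum>z\<in>X. (- x) ^ len z * Rf (u \<otimes> z) v)"
  unfolding RJ_def
proof (rule sum.mono_neutral_left[OF assms(4,5)])
  show "\<forall>z\<in>X - coset_below J u v. (- x) ^ len z * Rf (u \<otimes> z) v = 0"
    using Rf_le[OF assms(3)] assms(2,6) par_closed[OF J] unfolding coset_below_def by (fastforce simp: subsetD)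
qed

text \<open>The common property of the two values of the parameter, namely that \<open>q - 1 - x\<close> is a root of the
  quadratic relation of the Hecke algebra.\<close>

lemma x_quadratic: "x \<in> {- 1, q} \<Longrightarrow> (q - 1 - x) * (- x) = q"
  by (auto simp: algebra_simps)

text \<open>The right-hand side of the recursion for parabolic R-polynomials, as an operator on the column.\<close>

definition LJ :: "'a set \<Rightarrow> int poly \<Rightarrow> 'a \<Rightarrow> ('a \<Rightarrow> int poly) \<Rightarrow> 'a \<Rightarrow> int poly" where
  "LJ J x s f u = (if len (s \<otimes> u) < len u then f (s \<otimes> u)
     else if s \<otimes> u \<in> MR J then (q - 1) * f u + q * f (s \<otimes> u) else (q - 1 - x) * f u)"

text \<open>Summation over cosets intertwines \<open>Ll s\<close> with \<open>LJ s\<close>. In the case \<open>s u = u r\<close>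
  the terms are paired by \<open>z \<mapsto> r z\<close>, and \<open>x_quadratic\<close> makes each pair an eigenvector
  with eigenvalue \<open>q - 1 - x\<close>.\<close>

lemma RJ_rec:
  assumes J: "J \<subseteq> S" and x: "x \<in> {- 1, q}" and u: "u \<in> MR J" and s: "s \<in> S"
    and v: "v \<in> carrier G" and sv: "len (s \<otimes> v) < len v"
  shows "RJ J x u v = LJ J x s (\<lambda>w. RJ J x w (s \<otimes> v)) u"
proof -
  have uc: "u \<in> carrier G" and sc: "s \<in> carrier G" using u MR_carrier s by auto
  have svc: "s \<otimes> v \<in> carrier G" using sc v by auto
  have suc: "s \<otimes> u \<in> carrier G" using sc uc by auto
  have svv: "ble (s \<otimes> v) v" using S_le[OF s v sv] .
  define X where "X = coset_below J u v"
  have Xp: "X \<subseteq> par J" by (auto simp: X_def coset_below_def)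
  have Xc: "z \<in> carrier G" if "z \<in> X" for z using that Xp par_closed[OF J] by auto
  have fin: "finite X" using coset_below_finite[OF J uc v] by (simp add: X_def)
  have Z1: "coset_below J u (s \<otimes> v) \<subseteq> X" using le_trans[OF _ svv] by (auto simp: X_def coset_below_def)
  have Z2: "coset_below J (s \<otimes> u) (s \<otimes> v) \<subseteq> X"
  proof
    fix z assume "z \<in> coset_below J (s \<otimes> u) (s \<otimes> v)"
    hence z: "z \<in> par J" "ble (s \<otimes> u \<otimes> z) (s \<otimes> v)" by (auto simp: coset_below_def)
    have zc: "z \<in> carrier G" using z par_closed[OF J] by auto
    have "ble (s \<otimes> (u \<otimes> z)) v" using le_trans[OF z(2) svv] uc sc zc by (simp add: m_assoc)
    thus "z \<in> X" using lower_S_stable[OF s v sv, of "u \<otimes> z"] uc zc z by (simp add: X_def coset_below_def)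
  qed
  have E0: "RJ J x u v = (\<Sum>z\<in>X. (- x) ^ len z * Ll s (\<lambda>w. Rf w (s \<otimes> v)) (u \<otimes> z))"
    unfolding RJ_def X_def using Rf_rec[OF s v sv] by simp
  have E1: "RJ J x u (s \<otimes> v) = (\<Sum>z\<in>X. (- x) ^ len z * Rf (u \<otimes> z) (s \<otimes> v))"
    using RJ_eq[OF J uc svc fin Z1 Xp] .
  have E2: "RJ J x (s \<otimes> u) (s \<otimes> v) = (\<Sum>z\<in>X. (- x) ^ len z * Rf (s \<otimes> u \<otimes> z) (s \<otimes> v))"
    using RJ_eq[OF J suc svc fin Z2 Xp] .
  have as': "s \<otimes> (u \<otimes> z) = s \<otimes> u \<otimes> z" if "z \<in> X" for z using Xc[OF that] uc sc by (simp add: m_assoc)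
  have uz: "u \<otimes> z \<in> carrier G" if "z \<in> X" for z using Xc[OF that] uc by simp
  have lz: "len (u \<otimes> z) = len u + len z" if "z \<in> X" for z using MR_len[OF J u] that Xp by auto
  show ?thesis
  proof (cases "len (s \<otimes> u) < len u")
    case True
    have "len (s \<otimes> u \<otimes> z) = len (s \<otimes> u) + len z" if "z \<in> X" for z
      using MR_len[OF J MR_left_down[OF J u s True]] that Xp by auto
    hence "RJ J x u v = RJ J x (s \<otimes> u) (s \<otimes> v)" unfolding E0 E2
      using True by (intro sum.cong refl) (simp add: Ll_def as' uz lz)
    thus ?thesis using True by (simp add: LJ_def)
  next
    case nd: False
    hence up: "len u < len (s \<otimes> u)" using S_asym[OF s uc] by blast
    show ?thesis
    proof (cases "s \<otimes> u \<in> MR J")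
      case True
      have "len (s \<otimes> u \<otimes> z) = len (s \<otimes> u) + len z" if "z \<in> X" for z
        using MR_len[OF J True] that Xp by auto
      hence "RJ J x u v = (q - 1) * RJ J x u (s \<otimes> v) + q * RJ J x (s \<otimes> u) (s \<otimes> v)"
        unfolding E0 E1 E2 sum_distrib_left sum.distrib[symmetric]
        by (intro sum.cong refl) (simp add: Ll_def as' uz lz up algebra_simps)
      thus ?thesis using True nd by (simp add: LJ_def)
    next
      case False
      obtain r where r: "r \<in> J" "s \<otimes> u = u \<otimes> r" using MR_left_up[OF J u s up False] .
      have rS: "r \<in> S" "r \<in> carrier G" using r J by auto
      have rp: "r \<in> par J" using r by (simp add: generate.incl)
      define f where "f z = Rf (u \<otimes> z) (s \<otimes> v)" for z
      have rX: "r \<otimes> z \<in> X" if "z \<in> X" for z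
      proof -
        have "s \<otimes> (u \<otimes> z) = u \<otimes> (r \<otimes> z)" using as'[OF that] r(2) uc rS Xc[OF that] by (simp add: m_assoc)
        moreover have "ble (s \<otimes> (u \<otimes> z)) v" using lower_S_stable[OF s v sv uz[OF that]] that by (simp add: X_def coset_below_def)
        moreover have "r \<otimes> z \<in> par J" using rp that Xp subgroup.m_closed[OF par_sub[OF J]] by auto
        ultimately show ?thesis by (simp add: X_def coset_below_def)
      qed
      have rr: "r \<otimes> (r \<otimes> z) = z" if "z \<in> X" for z using S_cancel[OF rS(1) Xc[OF that]] .
      define U D where "U = {z\<in>X. len z < len (r \<otimes> z)}" and "D = {z\<in>X. \<not> len z < len (r \<otimes> z)}"
      have XUD: "X = U \<union> D" "U \<inter> D = {}" "finite U" "finite D" using fin by (auto simp: U_def D_def)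
      have bij: "bij_betw (\<lambda>z. r \<otimes> z) U D"
      proof (rule bij_betw_byWitness[where f' = "\<lambda>z. r \<otimes> z"])
        show "\<forall>z\<in>U. r \<otimes> (r \<otimes> z) = z" "\<forall>z\<in>D. r \<otimes> (r \<otimes> z) = z" using rr by (auto simp: U_def D_def)
        show "(\<lambda>z. r \<otimes> z) ` U \<subseteq> D" using rX rr by (auto simp: U_def D_def)
        show "(\<lambda>z. r \<otimes> z) ` D \<subseteq> U"
        proof
          fix y assume "y \<in> (\<lambda>z. r \<otimes> z) ` D"
          then obtain z where z: "z \<in> X" "\<not> len z < len (r \<otimes> z)" "y = r \<otimes> z" by (auto simp: D_def)
          thus "y \<in> U" using rX[OF z(1)] rr[OF z(1)] len_S_cases[OF rS(1) Xc[OF z(1)]] by (auto simp: U_def)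
        qed
      qed
      have split: "(\<Sum>z\<in>X. g z) = (\<Sum>z\<in>U. g z + g (r \<otimes> z))" for g :: "'a \<Rightarrow> int poly"
        using sum.union_disjoint[OF XUD(3,4,2), of g] sum.reindex_bij_betw[OF bij, of g] XUD(1)
        by (simp add: sum.distrib)
      have L: "Ll s (\<lambda>w. Rf w (s \<otimes> v)) (u \<otimes> z) =
          (if len z < len (r \<otimes> z) then (q - 1) * f z + q * f (r \<otimes> z) else f (r \<otimes> z))" if "z \<in> X" for z
      proof -
        have "s \<otimes> (u \<otimes> z) = u \<otimes> (r \<otimes> z)" using as'[OF that] r(2) uc rS Xc[OF that] by (simp add: m_assoc)
        thus ?thesis unfolding Ll_def f_def using uz[OF that] lz[OF that] lz[OF rX[OF that]] by simp
      qed
      have "RJ J x u v = (\<Sum>z\<in>U. (- x) ^ len z * ((q - 1) * f z + q * f (r \<otimes> z)) + (- x) ^ (len z + 1) * f z)"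
        unfolding E0 split
      proof (intro sum.cong refl)
        fix z assume "z \<in> U"
        hence z: "z \<in> X" "len z < len (r \<otimes> z)" by (auto simp: U_def)
        have "len (r \<otimes> z) = len z + 1" using len_S_cases[OF rS(1) Xc[OF z(1)]] z by auto
        thus "(- x) ^ len z * Ll s (\<lambda>w. Rf w (s \<otimes> v)) (u \<otimes> z) +
            (- x) ^ len (r \<otimes> z) * Ll s (\<lambda>w. Rf w (s \<otimes> v)) (u \<otimes> (r \<otimes> z)) =
            (- x) ^ len z * ((q - 1) * f z + q * f (r \<otimes> z)) + (- x) ^ (len z + 1) * f z"
          using L[OF z(1)] L[OF rX[OF z(1)]] rr[OF z(1)] z by simp
      qed
      also have "\<dots> = (q - 1 - x) * (\<Sum>z\<in>X. (- x) ^ len z * f z)"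
        unfolding split sum_distrib_left
      proof (intro sum.cong refl)
        fix z assume "z \<in> U"
        hence z: "z \<in> X" "len z < len (r \<otimes> z)" by (auto simp: U_def)
        have l: "len (r \<otimes> z) = len z + 1" using len_S_cases[OF rS(1) Xc[OF z(1)]] z by auto
        have "(- x) ^ len z * ((q - 1) * f z + q * f (r \<otimes> z)) + (- x) ^ (len z + 1) * f z =
            (- x) ^ len z * ((q - 1 - x) * f z + ((q - 1 - x) * (- x)) * f (r \<otimes> z))"
          unfolding x_quadratic[OF x] by (simp add: algebra_simps)
        thus "(- x) ^ len z * ((q - 1) * f z + q * f (r \<otimes> z)) + (- x) ^ (len z + 1) * f z =
            (q - 1 - x) * ((- x) ^ len z * f z + (- x) ^ len (r \<otimes> z) * f (r \<otimes> z))"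
          unfolding l by (simp add: algebra_simps)
      qed
      finally have "RJ J x u v = (q - 1 - x) * RJ J x u (s \<otimes> v)" unfolding E1 f_def .
      thus ?thesis using False nd by (simp add: LJ_def)
    qed
  qed
qed

lemma RJ_le:
  assumes "J \<subseteq> S" "u \<in> MR J" "v \<in> carrier G" "RJ J x u v \<noteq> 0" shows "ble u v"
proof -
  have "coset_below J u v \<noteq> {}" using assms(4) by (auto simp: RJ_def)
  thus ?thesis using MR_le[OF assms(1,2)] le_trans by (auto simp: coset_below_def)
qed

lemma RJ_self:
  assumes J: "J \<subseteq> S" and v: "v \<in> MR J" shows "RJ J x v v = 1"
proof -
  have vc: "v \<in> carrier G" using v MR_carrier by auto
  have "z = \<one>" if "z \<in> par J" "ble (v \<otimes> z) v" for z
    using MR_len[OF J v that(1)] le_len[OF that(2)] len_eq_0 that(1) par_closed[OF J] by auto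
  hence "coset_below J v v = {\<one>}" using vc generate.one by (auto simp: coset_below_def)
  thus ?thesis using Rf_self vc by (simp add: RJ_def)
qed

lemma RJ_family:
  assumes J: "J \<subseteq> S" and x: "x \<in> {- 1, q}"
  shows "parabolic_R_family G S J x (\<lambda>u v. if u \<in> MR J \<and> v \<in> MR J then RJ J x u v else 0)"
proof -
  have c: "u \<in> carrier G" if "u \<in> MR J" for u using that MR_carrier by auto
  have d: "s \<otimes> v \<in> MR J" if "v \<in> MR J" "s \<in> S" "len (s \<otimes> v) < len v" for s v using MR_left_down[OF J] that by blast
  have z: "RJ J x u v = 0" if "u \<in> MR J" "v \<in> MR J" "\<not> ble u v" for u v
    using RJ_le[OF J that(1) c[OF that(2)]] that(3) by blast
  show ?thesis unfolding parabolic_R_family_def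
    using z RJ_self[OF J] RJ_rec[OF J x] c d by (auto simp: LJ_def)
qed

lemma R_family_unique:
  assumes J: "J \<subseteq> S" and F: "parabolic_R_family G S J x R" "parabolic_R_family G S J x R'"
  shows "R = R'"
proof -
  have "R u v = R' u v" if "u \<in> MR J" "v \<in> MR J" for u v
    using that
  proof (induction "len v" arbitrary: u v rule: less_induct)
    case less
    have c: "u \<in> carrier G" "v \<in> carrier G" using less.prems MR_carrier by auto
    show ?case
    proof (cases "v = \<one>")
      case True
      show ?thesis
      proof (cases "ble u v")
        case False thus ?thesis using F less.prems unfolding parabolic_R_family_def by metis
      next
        case b: True
        hence "u = \<one>" using le_len[OF b] len_eq_0[OF c(1)] True by simp
        thus ?thesis using F less.prems True unfolding parabolic_R_family_def by metis
      qed
    next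
      case False
      obtain s where s: "s \<in> S" "len v = len (s \<otimes> v) + 1" using left_descent[OF c(2) False] .
      have sv: "s \<otimes> v \<in> MR J" "len (s \<otimes> v) < len v" using MR_left_down[OF J less.prems(2) s(1)] s by auto
      note IH = less.hyps[OF sv(2) _ sv(1)]
      note R1 = F(1)[unfolded parabolic_R_family_def, THEN conjunct2, rule_format, OF less.prems, THEN conjunct2, THEN conjunct2, rule_format, OF s(1) sv(2)]
      note R2 = F(2)[unfolded parabolic_R_family_def, THEN conjunct2, rule_format, OF less.prems, THEN conjunct2, THEN conjunct2, rule_format, OF s(1) sv(2)]
      consider "len (s \<otimes> u) < len u" | "len u < len (s \<otimes> u)" "s \<otimes> u \<in> MR J" | "len u < len (s \<otimes> u)" "s \<otimes> u \<notin> MR J"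
        using S_asym[OF s(1) c(1)] by blast
      thus ?thesis
      proof cases
        case 1 thus ?thesis using R1 R2 IH[of "s \<otimes> u"] MR_left_down[OF J less.prems(1) s(1)] by simp
      next
        case 2 thus ?thesis using R1 R2 IH[of "s \<otimes> u"] IH[OF less.prems(1)] by simp
      next
        case 3 thus ?thesis using R1 R2 IH[OF less.prems(1)] by simp
      qed
    qed
  qed
  moreover have "R u v = R' u v" if "u \<notin> MR J \<or> v \<notin> MR J" for u v
    using F that unfolding parabolic_R_family_def by metis
  ultimately show ?thesis by blast
qed

lemma parabolic_R_eq:
  assumes J: "J \<subseteq> S" and x: "x \<in> {- 1, q}" and uv: "u \<in> MR J" "v \<in> MR J"
  shows "parabolic_R G S J x u v = RJ J x u v"
proof -
  have "parabolic_R G S J x = (\<lambda>u v. if u \<in> MR J \<and> v \<in> MR J then RJ J x u v else 0)"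
    unfolding parabolic_R_def using RJ_family[OF J x] R_family_unique[OF J] by (intro the_equality)
  thus ?thesis using uv by simp
qed

text \<open>By the recursion the claim descends along the left descents of \<open>\<sigma>\<close> to \<open>\<sigma> = \<one>\<close>,
  where the column is supported at \<open>\<one>\<close> and each letter of \<open>z\<close> acts on it by
  \<open>q - 1 - x\<close>.\<close>

lemma RJ_right:
  assumes J: "J \<subseteq> S" and x: "x \<in> {- 1, q}" and u: "u \<in> MR J" and \<sigma>: "\<sigma> \<in> MR J" and z: "z \<in> par J"
  shows "RJ J x u (\<sigma> \<otimes> z) = (q - 1 - x) ^ len z * RJ J x u \<sigma>"
  using u \<sigma> z
proof (induction "len (\<sigma> \<otimes> z)" arbitrary: u \<sigma> z rule: less_induct)
  case less
  have c: "u \<in> carrier G" "\<sigma> \<in> carrier G" "z \<in> carrier G" using less.prems MR_carrier par_closed[OF J] by auto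
  have l: "len (\<sigma> \<otimes> z) = len \<sigma> + len z" using MR_len[OF J less.prems(2,3)] .
  show ?case
  proof (cases "\<sigma> = \<one>")
    case False
    obtain s where s: "s \<in> S" "len \<sigma> = len (s \<otimes> \<sigma>) + 1" using left_descent[OF c(2) False] .
    have sc: "s \<in> carrier G" using s by auto
    have s\<sigma>: "s \<otimes> \<sigma> \<in> MR J" using MR_left_down[OF J less.prems(2) s(1)] s by simp
    have as': "s \<otimes> (\<sigma> \<otimes> z) = s \<otimes> \<sigma> \<otimes> z" using sc c by (simp add: m_assoc)
    have l': "len (s \<otimes> \<sigma> \<otimes> z) < len (\<sigma> \<otimes> z)" using MR_len[OF J s\<sigma> less.prems(3)] l s by simp
    have IH: "RJ J x w (s \<otimes> \<sigma> \<otimes> z) = (q - 1 - x) ^ len z * RJ J x w (s \<otimes> \<sigma>)" if "w \<in> MR J" for w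
      using less.hyps[OF l' that s\<sigma> less.prems(3)] .
    have "RJ J x u (\<sigma> \<otimes> z) = LJ J x s (\<lambda>w. RJ J x w (s \<otimes> \<sigma> \<otimes> z)) u"
      using RJ_rec[OF J x less.prems(1) s(1), of "\<sigma> \<otimes> z"] c l' unfolding as' by simp
    also have "\<dots> = (q - 1 - x) ^ len z * LJ J x s (\<lambda>w. RJ J x w (s \<otimes> \<sigma>)) u"
      unfolding LJ_def using IH[OF less.prems(1)] IH[of "s \<otimes> u"] MR_left_down[OF J less.prems(1) s(1)]
      by (auto simp: algebra_simps)
    also have "LJ J x s (\<lambda>w. RJ J x w (s \<otimes> \<sigma>)) u = RJ J x u \<sigma>"
      using RJ_rec[OF J x less.prems(1) s(1) c(2)] s by simp
    finally show ?thesis .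
  next
    case True
    show ?thesis
    proof (cases "z = \<one>")
      case True thus ?thesis using c by simp
    next
      case z1: False
      obtain ws where ws: "ws \<in> lists J" "wp ws = z" "length ws = len z" using par_reduced[OF J less.prems(3)] .
      obtain r ws' where rw: "ws = r # ws'" using z1 ws by (cases ws) auto
      have r: "r \<in> J" "ws' \<in> lists J" "r \<in> S" "ws' \<in> lists S" using ws rw J by auto
      have rc: "r \<in> carrier G" "wp ws' \<in> carrier G" using r by auto
      have rz: "r \<otimes> z = wp ws'" using ws rw r by (auto simp: S_cancel)
      have rzp: "r \<otimes> z \<in> par J" using rz wp_par[OF J r(2)] by simp
      have lz: "len z = len (r \<otimes> z) + 1"
        using len_le[OF r(4)] ws rw len_S_cases[OF r(3) c(3)] rz by auto
      have IH: "RJ J x u (r \<otimes> z) = (q - 1 - x) ^ len (r \<otimes> z) * RJ J x u \<one>"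
        using less.hyps[of \<one> "r \<otimes> z" u] less.prems(1,2) rzp lz True c rc rz by simp
      have rec: "RJ J x u z = LJ J x r (\<lambda>w. RJ J x w (r \<otimes> z)) u"
        using RJ_rec[OF J x less.prems(1) r(3) c(3)] lz by simp
      show ?thesis
      proof (cases "u = \<one>")
        case u1: True
        have "r \<notin> MR J"
        proof
          assume "r \<in> MR J"
          moreover have "inv r \<in> par J" using r(1) by (simp add: generate.inv)
          ultimately have "len (r \<otimes> inv r) = len r + len (inv r)" using MR_len[OF J] by blast
          thus False using r(3) rc by (simp add: S_inv S_sq len_S)
        qed
        hence "RJ J x u z = (q - 1 - x) * RJ J x u (r \<otimes> z)"
          unfolding rec using u1 rc r(3) by (simp add: LJ_def len_S)
        thus ?thesis using IH lz True c by (simp add: mult.assoc)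
      next
        case u1: False
        have nb: "\<not> ble u \<one>" using u1 le_len[of u \<one>] len_eq_0[OF c(1)] by auto
        have "\<not> ble u z" using le_MR[OF J less.prems(1), of \<one> z] less.prems True nb c by auto
        hence "RJ J x u z = 0" "RJ J x u \<one> = 0" using RJ_le[OF J less.prems(1)] nb c by blast+
        thus ?thesis using True c by simp
      qed
    qed
  qed
qed

end


section \<open>Reversal of polynomials\<close>

lemma coeff_q_reverse:
  assumes "degree p \<le> n"
  shows "coeff (q_reverse n p) j = (if j \<le> n then coeff p (n - j) else 0)"
proof -
  have "coeff (q_reverse n p) j = (\<Sum>i\<le>degree p. if n - i = j then coeff p i else 0)"
    by (simp add: q_reverse_def coeff_sum)
  also have "\<dots> = (\<Sum>i\<in>{..degree p} \<inter> {i. n - i = j}. coeff p i)"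
    by (simp add: sum.inter_restrict flip: if_distrib)
  also have "\<dots> = (if j \<le> n then coeff p (n - j) else 0)"
  proof (cases "j \<le> n \<and> n - j \<le> degree p")
    case True
    hence "{..degree p} \<inter> {i. n - i = j} = {n - j}" using assms by auto
    thus ?thesis using True by simp
  next
    case False
    hence "{..degree p} \<inter> {i. n - i = j} = {}" using assms by auto
    thus ?thesis using False by (auto simp: coeff_eq_0)
  qed
  finally show ?thesis .
qed

lemma q_reverse_0 [simp]: "q_reverse n 0 = 0"
  by (simp add: q_reverse_def)
lemma q_reverse_1 [simp]: "q_reverse 0 1 = 1"
  by (simp add: q_reverse_def)

lemma q_reverse_add:
  assumes "degree p \<le> n" "degree r \<le> n" shows "q_reverse n (p + r) = q_reverse n p + q_reverse n r"
  by (rule poly_eqI) (simp add: coeff_q_reverse assms degree_add_le)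

lemma q_reverse_sum:
  assumes "finite A" "\<And>a. a \<in> A \<Longrightarrow> degree (f a) \<le> n"
  shows "q_reverse n (sum f A) = (\<Sum>a\<in>A. q_reverse n (f a))"
  using assms by (induction A rule: finite_induct) (auto simp: q_reverse_add degree_sum_le)

lemma degree_q_reverse: assumes "degree p \<le> n" shows "degree (q_reverse n p) \<le> n"
  by (rule degree_le) (simp add: coeff_q_reverse assms)

lemma q_reverse_q_reverse: assumes "degree p \<le> n" shows "q_reverse n (q_reverse n p) = p"
  by (rule poly_eqI) (use assms in \<open>auto simp: coeff_q_reverse degree_q_reverse coeff_eq_0\<close>)

lemma q_reverse_mult:
  assumes "degree p \<le> a" "degree r \<le> b"
  shows "q_reverse (a + b) (p * r) = q_reverse a p * q_reverse b r"
proof (cases "p = 0 \<or> r = 0")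
  case True thus ?thesis by auto
next
  case False
  have *: "q_reverse n p = monom 1 (n - degree p) * reflect_poly p" if "degree p \<le> n" for n and p :: "int poly"
    by (rule poly_eqI) (use that in \<open>auto simp: coeff_q_reverse coeff_reflect_poly coeff_monom_mult coeff_eq_0\<close>)
  have d: "degree (p * r) = degree p + degree r" using False degree_mult_eq by auto
  have "q_reverse (a + b) (p * r) = monom 1 (a + b - (degree p + degree r)) * (reflect_poly p * reflect_poly r)"
    using *[of "p * r" "a + b"] assms d by (simp add: reflect_poly_mult)
  also have "monom 1 (a + b - (degree p + degree r)) = monom (1::int) (a - degree p) * monom 1 (b - degree r)"
    using assms by (simp add: mult_monom)
  finally show ?thesis using *[OF assms(1)] *[OF assms(2)] by (simp add: mult_ac)
qed

lemma q_reverse_self_zero: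
  assumes "q_reverse n d = d" "2 * degree d + 1 \<le> n" shows "d = 0"
proof (rule poly_eqI)
  fix j
  have "coeff d j = coeff (q_reverse n d) j" using assms by simp
  also have "\<dots> = (if j \<le> n then coeff d (n - j) else 0)" using assms by (intro coeff_q_reverse) simp
  finally show "coeff d j = coeff 0 j" using assms(2) coeff_eq_0[of d j] coeff_eq_0[of d "n - j"]
    by (cases "j > degree d") (auto split: if_splits)
qed

text \<open>The uniqueness part of the Kazhdan-Lusztig argument: a polynomial of degree less than
  \<open>n / 2\<close> that equals its reversal is zero.\<close>

lemma q_reverse_split_unique:
  assumes "q_reverse n a = a + k" "q_reverse n b = b + k" "2 * degree a + 1 \<le> n" "2 * degree b + 1 \<le> n"
  shows "a = b"
proof -
  have d: "2 * degree (a - b) + 1 \<le> n" using assms(3,4) degree_diff_le_max[of a b] by linarith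
  have "q_reverse n a = q_reverse n ((a - b) + b)" by simp
  also have "\<dots> = q_reverse n (a - b) + q_reverse n b" using d assms(4) by (intro q_reverse_add) auto
  finally have "q_reverse n (a - b) = a - b" using assms(1,2) by simp
  from q_reverse_self_zero[OF this d] show ?thesis by simp
qed

definition low_part :: "nat \<Rightarrow> int poly \<Rightarrow> int poly" where
  "low_part n p = (\<Sum>i\<in>{i. 2 * i < n}. monom (coeff p i) i)"

lemma low_finite: "finite {i. 2 * i < (n::nat)}"
  by (rule finite_subset[of _ "{..n}"]) auto

lemma coeff_low_part: "coeff (low_part n p) j = (if 2 * j < n then coeff p j else 0)"
  unfolding low_part_def using low_finite[of n] by (simp add: coeff_sum sum.delta)

lemma degree_low_part: assumes "n > 0" shows "2 * degree (low_part n p) + 1 \<le> n"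
proof -
  have "degree (low_part n p) \<le> (n - 1) div 2"
    by (rule degree_le) (auto simp: coeff_low_part)
  thus ?thesis using assms by linarith
qed

text \<open>The existence part: an antisymmetric \<open>K\<close> splits into its lower half and the reversal of it.\<close>

lemma q_reverse_low_part:
  assumes K: "q_reverse n K = - K" "degree K \<le> n" and n: "n > 0"
  shows "q_reverse n (low_part n (- K)) = low_part n (- K) + K"
proof (rule poly_eqI)
  fix j
  have d: "degree (low_part n (- K)) \<le> n" using degree_low_part[OF n, of "- K"] by simp
  have K': "(if i \<le> n then coeff K (n - i) else 0) = - coeff K i" for i
    using coeff_q_reverse[OF K(2), of i] K(1) by simp
  show "coeff (q_reverse n (low_part n (- K))) j = coeff (low_part n (- K) + K) j"
  proof (cases "2 * j = n")
    case True
    hence "n - j = j" by simp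
    thus ?thesis using K'[of j] True unfolding coeff_q_reverse[OF d] by (auto simp: coeff_low_part)
  next
    case False
    thus ?thesis using K'[of j] unfolding coeff_q_reverse[OF d] by (auto simp: coeff_low_part split: if_splits)
  qed
qed

context coxeter begin

lemma degree_RJ:
  assumes J: "J \<subseteq> S" and x: "x \<in> {- 1, q}" and u: "u \<in> MR J" and v: "v \<in> carrier G"
  shows "degree (RJ J x u v) \<le> len v - len u"
  using u v
proof (induction "len v" arbitrary: u v rule: less_induct)
  case less
  have uc: "u \<in> carrier G" using less.prems MR_carrier by auto
  have dq: "degree (q - 1) \<le> 1" "degree q \<le> 1" "degree (q - 1 - x) \<le> 1" using x by (auto simp: q_var_def one_pCons)
  have dm: "degree (p * r) \<le> n + 1" if "degree p \<le> 1" "degree r \<le> n" for p r :: "int poly" and n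
    using degree_mult_le[of p r] that by simp
  show ?case
  proof (cases "v = \<one>")
    case True
    show ?thesis
    proof (cases "u = \<one>")
      case True' : True
      have "\<one> \<in> MR J" using less.prems True' by simp
      thus ?thesis using RJ_self[OF J] True True' by simp
    next
      case False
      hence "\<not> ble u v" using le_len[of u v] len_eq_0[OF uc] True by auto
      thus ?thesis using RJ_le[OF J less.prems] by force
    qed
  next
    case False
    obtain s where s: "s \<in> S" "len v = len (s \<otimes> v) + 1" using left_descent[OF less.prems(2) False] .
    have sv: "s \<otimes> v \<in> carrier G" "len (s \<otimes> v) < len v" using s less.prems by (auto simp: S_carrier)
    note IH = less.hyps[OF sv(2) _ sv(1)]
    have rec: "RJ J x u v = LJ J x s (\<lambda>w. RJ J x w (s \<otimes> v)) u"
      using RJ_rec[OF J x less.prems(1) s(1) less.prems(2) sv(2)] .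
    have d1: "degree (p * RJ J x u (s \<otimes> v)) \<le> len v - len u" if "degree p \<le> 1" for p
    proof (cases "RJ J x u (s \<otimes> v) = 0")
      case False
      hence "len u \<le> len (s \<otimes> v)" using RJ_le[OF J less.prems(1) sv(1)] le_len by blast
      thus ?thesis using dm[OF that IH[OF less.prems(1)]] s(2) by simp
    qed simp
    show ?thesis
    proof (cases "len (s \<otimes> u) < len u")
      case True
      hence "len u = len (s \<otimes> u) + 1" using len_S_cases[OF s(1) uc] by auto
      thus ?thesis unfolding rec LJ_def using True IH[OF MR_left_down[OF J less.prems(1) s(1) True]] s by simp
    next
      case nd: False
      hence lu: "len (s \<otimes> u) = len u + 1" using len_S_cases[OF s(1) uc] by auto
      show ?thesis
      proof (cases "s \<otimes> u \<in> MR J")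
        case True
        have d2: "degree (q * RJ J x (s \<otimes> u) (s \<otimes> v)) \<le> len v - len u"
        proof (cases "RJ J x (s \<otimes> u) (s \<otimes> v) = 0")
          case False
          hence "len (s \<otimes> u) \<le> len (s \<otimes> v)" using RJ_le[OF J True sv(1)] le_len by blast
          thus ?thesis using dm[OF dq(2) IH[OF True]] s(2) lu by simp
        qed simp
        have e: "RJ J x u v = (q - 1) * RJ J x u (s \<otimes> v) + q * RJ J x (s \<otimes> u) (s \<otimes> v)"
          unfolding rec LJ_def using nd True by simp
        show ?thesis unfolding e by (rule degree_add_le[OF d1[OF dq(1)] d2])
      next
        case False
        thus ?thesis unfolding rec LJ_def using nd d1[OF dq(3)] by simp
      qed
    qed
  qed
qed

end

section \<open>Inversion of the matrix of R-polynomials\<close>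

locale coxeter_parabolic = coxeter G S for G :: "('a, 'm) monoid_scheme" (structure) and S +
  fixes J :: "'a set" and x :: "int poly"
  assumes J: "J \<subseteq> S" and x: "x \<in> {- 1, q_var}"
begin

abbreviation "WJ \<equiv> MR J"
abbreviation "R \<equiv> RJ J x"
abbreviation "pint \<equiv> parabolic_interval G S J"

definition Rbar :: "'a \<Rightarrow> 'a \<Rightarrow> int poly" where
  "Rbar u v = q_reverse (len v - len u) (R u v)"

lemma WJc: "u \<in> WJ \<Longrightarrow> u \<in> carrier G" using MR_carrier by auto

lemma R_zero: "u \<in> WJ \<Longrightarrow> v \<in> carrier G \<Longrightarrow> \<not> ble u v \<Longrightarrow> R u v = 0"
  using RJ_le[OF J] by blast

lemma R_deg: "u \<in> WJ \<Longrightarrow> v \<in> carrier G \<Longrightarrow> degree (R u v) \<le> len v - len u"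
  using degree_RJ[OF J x] by blast

lemma R_self: "u \<in> WJ \<Longrightarrow> R u u = 1" using RJ_self[OF J] by blast

lemma pint_iff: "\<sigma> \<in> pint u v \<longleftrightarrow> \<sigma> \<in> WJ \<and> ble u \<sigma> \<and> ble \<sigma> v"
  using le_carrier by (auto simp: parabolic_interval_def bruhat_interval_def)

lemma pint_finite: "v \<in> carrier G \<Longrightarrow> finite (pint u v)"
  by (rule finite_subset[OF _ finite_lower[of v]]) (auto simp: pint_iff)

lemma x_rev: "q_reverse (Suc 0) (q - 1 - x) = - x"
  using x by (auto simp: q_reverse_def q_var_def one_pCons monom_Suc monom_0)

lemma q_rev: "q_reverse (Suc 0) (q - 1) = 1 - q" "q_reverse 2 q = q"
  by (auto simp: q_reverse_def q_var_def one_pCons monom_Suc monom_0 numeral_2_eq_2)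

lemma Rbar_rec:
  assumes \<sigma>: "\<sigma> \<in> WJ" and s: "s \<in> S" and v: "v \<in> carrier G" and sv: "len (s \<otimes> v) < len v"
  shows "Rbar \<sigma> v = (if len (s \<otimes> \<sigma>) < len \<sigma> then Rbar (s \<otimes> \<sigma>) (s \<otimes> v)
     else if s \<otimes> \<sigma> \<in> WJ then (1 - q) * Rbar \<sigma> (s \<otimes> v) + q * Rbar (s \<otimes> \<sigma>) (s \<otimes> v) else (- x) * Rbar \<sigma> (s \<otimes> v))"
proof -
  have c: "\<sigma> \<in> carrier G" "s \<otimes> v \<in> carrier G" "s \<otimes> \<sigma> \<in> carrier G" using \<sigma> s v WJc by (auto simp: S_carrier)
  have lv: "len v = len (s \<otimes> v) + 1" using len_S_cases[OF s v] sv by auto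
  have rec: "R \<sigma> v = LJ J x s (\<lambda>w. R w (s \<otimes> v)) \<sigma>" using RJ_rec[OF J x \<sigma> s v sv] .
  have dq: "degree (q - 1) \<le> 1" "degree q \<le> 2" "degree (q - 1 - x) \<le> 1" using x by (auto simp: q_var_def one_pCons)
  have d1: "q_reverse (len v - len \<sigma>) (p * R \<sigma> (s \<otimes> v)) = q_reverse (Suc 0) p * Rbar \<sigma> (s \<otimes> v) \<and>
      degree (p * R \<sigma> (s \<otimes> v)) \<le> len v - len \<sigma>" if "degree p \<le> 1" for p
  proof (cases "R \<sigma> (s \<otimes> v) = 0")
    case True thus ?thesis by (simp add: Rbar_def)
  next
    case False
    hence "len \<sigma> \<le> len (s \<otimes> v)" using R_zero[OF \<sigma> c(2)] le_len by blast
    hence e: "len v - len \<sigma> = 1 + (len (s \<otimes> v) - len \<sigma>)" using lv by simp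
    show ?thesis unfolding e Rbar_def
      using q_reverse_mult[OF that R_deg[OF \<sigma> c(2)]] degree_mult_le[of p "R \<sigma> (s \<otimes> v)"] that R_deg[OF \<sigma> c(2)] by simp
  qed
  show ?thesis
  proof (cases "len (s \<otimes> \<sigma>) < len \<sigma>")
    case True
    hence "len \<sigma> = len (s \<otimes> \<sigma>) + 1" using len_S_cases[OF s c(1)] by auto
    thus ?thesis using True lv by (simp add: Rbar_def rec LJ_def)
  next
    case nd: False
    hence l\<sigma>: "len (s \<otimes> \<sigma>) = len \<sigma> + 1" using len_S_cases[OF s c(1)] by auto
    show ?thesis
    proof (cases "s \<otimes> \<sigma> \<in> WJ")
      case True
      have d2: "q_reverse (len v - len \<sigma>) (q * R (s \<otimes> \<sigma>) (s \<otimes> v)) = q * Rbar (s \<otimes> \<sigma>) (s \<otimes> v) \<and>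
        degree (q * R (s \<otimes> \<sigma>) (s \<otimes> v)) \<le> len v - len \<sigma>"
      proof (cases "R (s \<otimes> \<sigma>) (s \<otimes> v) = 0")
        case True' : True thus ?thesis by (simp add: Rbar_def)
      next
        case False
        hence "len (s \<otimes> \<sigma>) \<le> len (s \<otimes> v)" using R_zero[OF True c(2)] le_len by blast
        hence e: "len v - len \<sigma> = 2 + (len (s \<otimes> v) - len (s \<otimes> \<sigma>))" using lv l\<sigma> by simp
        show ?thesis unfolding e Rbar_def
          using q_reverse_mult[OF dq(2) R_deg[OF True c(2)]] degree_mult_le[of q "R (s \<otimes> \<sigma>) (s \<otimes> v)"] dq(2)
            R_deg[OF True c(2)] q_rev(2) by simp
      qed
      have "R \<sigma> v = (q - 1) * R \<sigma> (s \<otimes> v) + q * R (s \<otimes> \<sigma>) (s \<otimes> v)" using rec nd True by (simp add: LJ_def)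
      hence "Rbar \<sigma> v = q_reverse (len v - len \<sigma>) ((q - 1) * R \<sigma> (s \<otimes> v)) + q_reverse (len v - len \<sigma>) (q * R (s \<otimes> \<sigma>) (s \<otimes> v))"
        unfolding Rbar_def using q_reverse_add d1[OF dq(1)] d2 by metis
      thus ?thesis using nd True d1[OF dq(1)] d2 q_rev(1) by simp
    next
      case False
      have "R \<sigma> v = (q - 1 - x) * R \<sigma> (s \<otimes> v)" using rec nd False by (simp add: LJ_def)
      thus ?thesis using nd False d1[OF dq(3)] x_rev by (simp add: Rbar_def)
    qed
  qed
qed

lemma LJ_quadratic:
  assumes u: "u \<in> WJ" and s: "s \<in> S"
  shows "LJ J x s (LJ J x s f) u = (q - 1) * LJ J x s f u + q * f u"
proof -
  have c: "u \<in> carrier G" "s \<otimes> u \<in> carrier G" using u s WJc by (auto simp: S_carrier)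
  have ss: "s \<otimes> (s \<otimes> u) = u" using s c by (simp add: S_cancel)
  have xq: "(q - 1 - x) * (q - 1 - x) = (q - 1) * (q - 1 - x) + q"
    using x_quadratic[OF x] by (simp add: algebra_simps)
  show ?thesis
  proof (cases "len (s \<otimes> u) < len u")
    case True
    thus ?thesis using u by (simp add: LJ_def ss)
  next
    case False
    hence up: "len u < len (s \<otimes> u)" using S_asym[OF s c(1)] by blast
    show ?thesis
    proof (cases "s \<otimes> u \<in> WJ")
      case True thus ?thesis using False up by (simp add: LJ_def ss)
    next
      case nM: False
      have "LJ J x s (LJ J x s f) u = ((q - 1 - x) * (q - 1 - x)) * f u" using False nM by (simp add: LJ_def mult.assoc)
      thus ?thesis unfolding xq using False nM by (simp add: LJ_def algebra_simps)
    qed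
  qed
qed

text \<open>The recursion in the other index. Going down uses the quadratic relation of the operators, and for
  \<open>s \<sigma> = \<sigma> r\<close> the column is an eigenvector by \<open>RJ_right\<close>.\<close>

lemma R_column:
  assumes \<sigma>: "\<sigma> \<in> WJ" and s: "s \<in> S" and u: "u \<in> WJ"
  shows "LJ J x s (\<lambda>w. R w \<sigma>) u = (if len (s \<otimes> \<sigma>) < len \<sigma> then (q - 1) * R u \<sigma> + q * R u (s \<otimes> \<sigma>)
     else if s \<otimes> \<sigma> \<in> WJ then R u (s \<otimes> \<sigma>) else (q - 1 - x) * R u \<sigma>)"
proof -
  have c: "\<sigma> \<in> carrier G" "s \<otimes> \<sigma> \<in> carrier G" using \<sigma> s WJc by (auto simp: S_carrier)
  have ss: "s \<otimes> (s \<otimes> \<sigma>) = \<sigma>" using s c by (simp add: S_cancel)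
  show ?thesis
  proof (cases "len (s \<otimes> \<sigma>) < len \<sigma>")
    case True
    have rec: "R w \<sigma> = LJ J x s (\<lambda>w. R w (s \<otimes> \<sigma>)) w" if "w \<in> WJ" for w using RJ_rec[OF J x that s c(1) True] .
    have "LJ J x s (\<lambda>w. R w \<sigma>) u = LJ J x s (LJ J x s (\<lambda>w. R w (s \<otimes> \<sigma>))) u"
      using rec[OF u] rec[of "s \<otimes> u"] MR_left_down[OF J u s] by (simp add: LJ_def[of J x s _ u])
    also have "\<dots> = (q - 1) * R u \<sigma> + q * R u (s \<otimes> \<sigma>)" unfolding LJ_quadratic[OF u s] using rec[OF u] by simp
    finally show ?thesis using True by simp
  next
    case False
    hence up: "len \<sigma> < len (s \<otimes> \<sigma>)" using S_asym[OF s c(1)] by blast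
    have e: "R u (s \<otimes> \<sigma>) = LJ J x s (\<lambda>w. R w \<sigma>) u"
      using RJ_rec[OF J x u s c(2)] up unfolding ss by simp
    show ?thesis
    proof (cases "s \<otimes> \<sigma> \<in> WJ")
      case nM: False
      obtain r where r: "r \<in> J" "s \<otimes> \<sigma> = \<sigma> \<otimes> r" using MR_left_up[OF J \<sigma> s up nM] .
      have "R u (\<sigma> \<otimes> r) = (q - 1 - x) * R u \<sigma>"
        using RJ_right[OF J x u \<sigma>, of r] r J len_S[of r] by (auto simp: generate.incl)
      thus ?thesis using False nM e r by simp
    qed (use False e in simp)
  qed
qed

text \<open>Induction on \<open>v\<close>: by \<open>Rbar_rec\<close> and \<open>R_column\<close>, the sum for \<open>v\<close> is the operator
  \<open>LJ s - (q - 1)\<close> applied to the sum for \<open>s v\<close>, which is a unit vector. The recursions are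
  matched by pairing \<open>\<sigma>\<close> with \<open>s \<sigma>\<close>.\<close>

lemma R_Rbar:
  assumes u: "u \<in> WJ" and v: "v \<in> WJ"
  shows "(\<Sum>\<sigma>\<in>{\<sigma>\<in>WJ. ble \<sigma> v}. R u \<sigma> * Rbar \<sigma> v) = (if u = v then 1 else 0)"
  using u v
proof (induction "len v" arbitrary: u v rule: less_induct)
  case less
  have c: "u \<in> carrier G" "v \<in> carrier G" using less.prems WJc by auto
  show ?case
  proof (cases "v = \<one>")
    case True
    have "{\<sigma>\<in>WJ. ble \<sigma> v} = {\<one>}" using True less.prems le_len[of _ v] len_eq_0 WJc by auto
    moreover have "u \<noteq> \<one> \<Longrightarrow> R u \<one> = 0" using R_zero[OF less.prems(1), of \<one>] le_len[of u \<one>] len_eq_0[OF c(1)] by auto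
    ultimately show ?thesis using True R_self[OF less.prems(2)] by (auto simp: Rbar_def)
  next
    case False
    obtain s where s: "s \<in> S" "len v = len (s \<otimes> v) + 1" using left_descent[OF c(2) False] .
    have sv: "len (s \<otimes> v) < len v" "s \<otimes> v \<in> WJ" using s MR_left_down[OF J less.prems(2) s(1)] by auto
    have svc: "s \<otimes> v \<in> carrier G" using sv WJc by auto
    have svv: "ble (s \<otimes> v) v" using S_le[OF s(1) c(2) sv(1)] .
    define Y where "Y = {\<sigma>\<in>WJ. ble \<sigma> v}"
    have Yc: "\<sigma> \<in> carrier G" "\<sigma> \<in> WJ" if "\<sigma> \<in> Y" for \<sigma> using that WJc by (auto simp: Y_def)
    have fin: "finite Y" using finite_subset[OF _ finite_lower[OF c(2)], of Y] by (auto simp: Y_def)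
    have ss: "s \<otimes> (s \<otimes> \<sigma>) = \<sigma>" if "\<sigma> \<in> Y" for \<sigma> using S_cancel[OF s(1) Yc(1)[OF that]] .
    define D U Z where "D = {\<sigma>\<in>Y. len (s \<otimes> \<sigma>) < len \<sigma>}" and "U = {\<sigma>\<in>Y. \<not> len (s \<otimes> \<sigma>) < len \<sigma> \<and> s \<otimes> \<sigma> \<in> WJ}"
      and "Z = {\<sigma>\<in>Y. \<not> len (s \<otimes> \<sigma>) < len \<sigma> \<and> s \<otimes> \<sigma> \<notin> WJ}"
    have part: "Y = Z \<union> (U \<union> D)" "Z \<inter> (U \<union> D) = {}" "U \<inter> D = {}" "finite Z" "finite U" "finite D"
      using fin by (auto simp: D_def U_def Z_def)
    have sY: "s \<otimes> \<sigma> \<in> Y" if "\<sigma> \<in> Y" "s \<otimes> \<sigma> \<in> WJ" for \<sigma>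
      using lower_S_stable[OF s(1) c(2) sv(1) Yc(1)[OF that(1)]] that by (simp add: Y_def)
    have bij: "bij_betw (\<lambda>\<sigma>. s \<otimes> \<sigma>) U D"
    proof (rule bij_betw_byWitness[where f' = "\<lambda>\<sigma>. s \<otimes> \<sigma>"])
      show "\<forall>\<sigma>\<in>U. s \<otimes> (s \<otimes> \<sigma>) = \<sigma>" "\<forall>\<sigma>\<in>D. s \<otimes> (s \<otimes> \<sigma>) = \<sigma>" using ss by (auto simp: U_def D_def)
      show "(\<lambda>\<sigma>. s \<otimes> \<sigma>) ` U \<subseteq> D"
      proof
        fix y assume "y \<in> (\<lambda>\<sigma>. s \<otimes> \<sigma>) ` U"
        then obtain \<sigma> where \<sigma>: "\<sigma> \<in> Y" "\<not> len (s \<otimes> \<sigma>) < len \<sigma>" "s \<otimes> \<sigma> \<in> WJ" "y = s \<otimes> \<sigma>" by (auto simp: U_def)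
        hence "len \<sigma> < len (s \<otimes> \<sigma>)" using S_asym[OF s(1) Yc(1)[OF \<sigma>(1)]] by blast
        thus "y \<in> D" using \<sigma> sY ss by (simp add: D_def)
      qed
      show "(\<lambda>\<sigma>. s \<otimes> \<sigma>) ` D \<subseteq> U"
      proof
        fix y assume "y \<in> (\<lambda>\<sigma>. s \<otimes> \<sigma>) ` D"
        then obtain \<sigma> where \<sigma>: "\<sigma> \<in> Y" "len (s \<otimes> \<sigma>) < len \<sigma>" "y = s \<otimes> \<sigma>" by (auto simp: D_def)
        have "s \<otimes> \<sigma> \<in> WJ" using MR_left_down[OF J Yc(2)[OF \<sigma>(1)] s(1) \<sigma>(2)] .
        thus "y \<in> U" using \<sigma> sY ss Yc by (simp add: U_def)
      qed
    qed
    have split: "(\<Sum>\<sigma>\<in>Y. g \<sigma>) = (\<Sum>\<sigma>\<in>Z. g \<sigma>) + (\<Sum>\<sigma>\<in>U. g \<sigma> + g (s \<otimes> \<sigma>))" for g :: "'a \<Rightarrow> int poly"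
      using sum.union_disjoint[OF part(4) _ part(2), of g] sum.union_disjoint[OF part(5,6,3), of g]
        sum.reindex_bij_betw[OF bij, of g] part by (simp add: sum.distrib)
    define K where "K w = (\<Sum>\<sigma>\<in>Y. R w \<sigma> * Rbar \<sigma> (s \<otimes> v))" for w
    have K: "K w = (if w = s \<otimes> v then 1 else 0)" if "w \<in> WJ" for w
    proof -
      have "K w = (\<Sum>\<sigma>\<in>{\<sigma>\<in>WJ. ble \<sigma> (s \<otimes> v)}. R w \<sigma> * Rbar \<sigma> (s \<otimes> v))"
        unfolding K_def
      proof (rule sum.mono_neutral_right[OF fin])
        show "{\<sigma>\<in>WJ. ble \<sigma> (s \<otimes> v)} \<subseteq> Y" using le_trans[OF _ svv] by (auto simp: Y_def)
        show "\<forall>\<sigma>\<in>Y - {\<sigma>\<in>WJ. ble \<sigma> (s \<otimes> v)}. R w \<sigma> * Rbar \<sigma> (s \<otimes> v) = 0"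
          using R_zero[OF _ svc] by (auto simp: Y_def Rbar_def)
      qed
      thus ?thesis using less.hyps[OF sv(1) that sv(2)] by simp
    qed
    have "(\<Sum>\<sigma>\<in>Y. R u \<sigma> * Rbar \<sigma> v) = (\<Sum>\<sigma>\<in>Y. (LJ J x s (\<lambda>w. R w \<sigma>) u - (q - 1) * R u \<sigma>) * Rbar \<sigma> (s \<otimes> v))"
      unfolding split
    proof (rule arg_cong2[where f = "(+)"]; rule sum.cong[OF refl])
      fix \<sigma> assume "\<sigma> \<in> Z"
      hence \<sigma>: "\<sigma> \<in> Y" "\<not> len (s \<otimes> \<sigma>) < len \<sigma>" "s \<otimes> \<sigma> \<notin> WJ" by (auto simp: Z_def)
      show "R u \<sigma> * Rbar \<sigma> v = (LJ J x s (\<lambda>w. R w \<sigma>) u - (q - 1) * R u \<sigma>) * Rbar \<sigma> (s \<otimes> v)"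
        unfolding R_column[OF Yc(2)[OF \<sigma>(1)] s(1) less.prems(1)] Rbar_rec[OF Yc(2)[OF \<sigma>(1)] s(1) c(2) sv(1)]
        using \<sigma> by (simp add: algebra_simps)
    next
      fix \<sigma> assume "\<sigma> \<in> U"
      hence \<sigma>: "\<sigma> \<in> Y" "\<not> len (s \<otimes> \<sigma>) < len \<sigma>" "s \<otimes> \<sigma> \<in> WJ" by (auto simp: U_def)
      have up: "len \<sigma> < len (s \<otimes> \<sigma>)" using S_asym[OF s(1) Yc(1)[OF \<sigma>(1)]] \<sigma>(2) by blast
      show "R u \<sigma> * Rbar \<sigma> v + R u (s \<otimes> \<sigma>) * Rbar (s \<otimes> \<sigma>) v =
         (LJ J x s (\<lambda>w. R w \<sigma>) u - (q - 1) * R u \<sigma>) * Rbar \<sigma> (s \<otimes> v) +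
         (LJ J x s (\<lambda>w. R w (s \<otimes> \<sigma>)) u - (q - 1) * R u (s \<otimes> \<sigma>)) * Rbar (s \<otimes> \<sigma>) (s \<otimes> v)"
        unfolding R_column[OF Yc(2)[OF \<sigma>(1)] s(1) less.prems(1)] Rbar_rec[OF Yc(2)[OF \<sigma>(1)] s(1) c(2) sv(1)]
          R_column[OF \<sigma>(3) s(1) less.prems(1)] Rbar_rec[OF \<sigma>(3) s(1) c(2) sv(1)] ss[OF \<sigma>(1)]
        using \<sigma> up by (simp add: algebra_simps)
    qed
    also have "\<dots> = LJ J x s K u - (q - 1) * K u"
      unfolding K_def LJ_def
      by (auto simp: sum_distrib_left sum.distrib[symmetric] sum_subtractf[symmetric] algebra_simps intro!: sum.cong)
    also have "\<dots> = (if u = v then 1 else 0)"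
    proof -
      have ssu: "s \<otimes> (s \<otimes> u) = u" "s \<otimes> (s \<otimes> v) = v" using s c by (auto simp: S_cancel)
      have su: "s \<otimes> u = s \<otimes> v \<longleftrightarrow> u = v" using S_inj[OF s(1)] c by simp
      consider "u = v" | "u = s \<otimes> v" | "u \<noteq> v" "u \<noteq> s \<otimes> v" by blast
      thus ?thesis
      proof cases
        case 1
        have "v \<noteq> s \<otimes> v" using sv by auto
        thus ?thesis using 1 K[OF sv(2)] K[OF less.prems(2)] sv by (simp add: LJ_def)
      next
        case 2
        hence "u \<noteq> v" using sv by auto
        thus ?thesis using 2 K[OF sv(2)] K[OF less.prems(2)] sv less.prems(2) ssu by (auto simp: LJ_def)
      next
        case 3
        have "K u = 0" using K[OF less.prems(1)] 3 by simp
        moreover have "s \<otimes> u \<in> WJ \<Longrightarrow> K (s \<otimes> u) = 0" using K[of "s \<otimes> u"] 3 su by simp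
        ultimately show ?thesis using 3 MR_left_down[OF J less.prems(1) s(1)] by (simp add: LJ_def)
      qed
    qed
    finally show ?thesis unfolding Y_def .
  qed
qed

lemma R_Rbar_interval:
  assumes "u \<in> WJ" "v \<in> WJ"
  shows "(\<Sum>\<sigma>\<in>pint u v. R u \<sigma> * Rbar \<sigma> v) = (if u = v then 1 else 0)"
proof -
  have "finite {\<sigma>\<in>WJ. ble \<sigma> v}" using finite_lower[of v] assms WJc by simp
  hence "(\<Sum>\<sigma>\<in>pint u v. R u \<sigma> * Rbar \<sigma> v) = (\<Sum>\<sigma>\<in>{\<sigma>\<in>WJ. ble \<sigma> v}. R u \<sigma> * Rbar \<sigma> v)"
    using R_zero[OF assms(1)] WJc by (intro sum.mono_neutral_left) (auto simp: pint_iff)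
  thus ?thesis using R_Rbar[OF assms] by simp
qed

text \<open>Reversal turns the inverse on the right into an inverse on the left.\<close>

lemma Rbar_R_interval:
  assumes uv: "u \<in> WJ" "v \<in> WJ" "ble u v"
  shows "(\<Sum>\<sigma>\<in>pint u v. Rbar u \<sigma> * R \<sigma> v) = (if u = v then 1 else 0)"
proof -
  have c: "u \<in> carrier G" "v \<in> carrier G" using uv WJc by auto
  have t: "q_reverse (len v - len u) (R u \<sigma> * Rbar \<sigma> v) = Rbar u \<sigma> * R \<sigma> v \<and> degree (R u \<sigma> * Rbar \<sigma> v) \<le> len v - len u"
    if "\<sigma> \<in> pint u v" for \<sigma>
  proof -
    have \<sigma>: "\<sigma> \<in> WJ" "ble u \<sigma>" "ble \<sigma> v" using that by (auto simp: pint_iff)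
    have e: "len v - len u = (len \<sigma> - len u) + (len v - len \<sigma>)" using le_len[OF \<sigma>(2)] le_len[OF \<sigma>(3)] by simp
    have d: "degree (R u \<sigma>) \<le> len \<sigma> - len u" "degree (R \<sigma> v) \<le> len v - len \<sigma>"
      using R_deg uv \<sigma> c WJc by auto
    have d': "degree (Rbar \<sigma> v) \<le> len v - len \<sigma>" unfolding Rbar_def using degree_q_reverse[OF d(2)] .
    show ?thesis unfolding e q_reverse_mult[OF d(1) d']
      using d d' degree_mult_le[of "R u \<sigma>" "Rbar \<sigma> v"] q_reverse_q_reverse[OF d(2)] by (simp add: Rbar_def)
  qed
  have "(\<Sum>\<sigma>\<in>pint u v. Rbar u \<sigma> * R \<sigma> v) = q_reverse (len v - len u) (\<Sum>\<sigma>\<in>pint u v. R u \<sigma> * Rbar \<sigma> v)"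
    using t q_reverse_sum[OF pint_finite[OF c(2)], of u "\<lambda>\<sigma>. R u \<sigma> * Rbar \<sigma> v" "len v - len u"] by simp
  also have "\<dots> = (if u = v then 1 else 0)" unfolding R_Rbar_interval[OF uv(1,2)] by simp
  finally show ?thesis .
qed

section \<open>Parabolic Kazhdan-Lusztig polynomials\<close>

text \<open>The defining conditions of the family, for a fixed second argument \<open>v\<close>; different \<open>v\<close> do not
  interact.\<close>

definition KL_column :: "'a \<Rightarrow> ('a \<Rightarrow> int poly) \<Rightarrow> bool" where
  "KL_column v p \<longleftrightarrow> (\<forall>u\<in>WJ. (\<not> ble u v \<longrightarrow> p u = 0) \<and>
     (ble u v \<and> u \<noteq> v \<longrightarrow> 2 * degree (p u) + 1 \<le> len v - len u) \<and>
     q_reverse (len v - len u) (p u) = (\<Sum>\<sigma>\<in>pint u v. R u \<sigma> * p \<sigma>)) \<and> p v = 1"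

lemma pint_split:
  assumes "u \<in> WJ" "v \<in> WJ" "ble u v"
  shows "(\<Sum>\<sigma>\<in>pint u v. R u \<sigma> * p \<sigma>) = p u + (\<Sum>\<sigma>\<in>pint u v - {u}. R u \<sigma> * p \<sigma>)"
  using sum.remove[OF pint_finite[OF WJc[OF assms(2)]], of u u "\<lambda>\<sigma>. R u \<sigma> * p \<sigma>"] assms R_self WJc
  by (simp add: pint_iff)

lemma KL_column_unique:
  assumes v: "v \<in> WJ" and p: "KL_column v p" "KL_column v p'" and u: "u \<in> WJ"
  shows "p u = p' u"
  using u
proof (induction "len v - len u" arbitrary: u rule: less_induct)
  case less
  show ?case
  proof (cases "ble u v \<and> u \<noteq> v")
    case False thus ?thesis using p less.prems unfolding KL_column_def by metis
  next
    case True
    define n where "n = len v - len u"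
    have IH: "p \<sigma> = p' \<sigma>" if "\<sigma> \<in> pint u v - {u}" for \<sigma>
    proof -
      have "\<sigma> \<in> WJ" "ble u \<sigma>" "ble \<sigma> v" "u \<noteq> \<sigma>" using that by (auto simp: pint_iff)
      moreover have "len u < len \<sigma>" using le_len_strict calculation by blast
      ultimately show ?thesis using le_len[of \<sigma> v] less.hyps[of \<sigma>] by simp
    qed
    have e: "q_reverse n (r u) = r u + (\<Sum>\<sigma>\<in>pint u v - {u}. R u \<sigma> * r \<sigma>)" "2 * degree (r u) + 1 \<le> n"
      if "KL_column v r" for r
      using that less.prems True pint_split[OF less.prems v, of r] unfolding KL_column_def n_def by auto
    have "(\<Sum>\<sigma>\<in>pint u v - {u}. R u \<sigma> * p \<sigma>) = (\<Sum>\<sigma>\<in>pint u v - {u}. R u \<sigma> * p' \<sigma>)"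
      using IH by (intro sum.cong) auto
    thus ?thesis using q_reverse_split_unique[OF e(1)[OF p(1)] _ e(2)[OF p(1)] e(2)[OF p(2)]] e(1)[OF p(2)] by simp
  qed
qed

text \<open>The column is constructed downwards from \<open>v\<close>: the stage \<open>k\<close> is final at all elements of
  length at least \<open>len v - k\<close>.\<close>

primrec KL_build :: "'a \<Rightarrow> nat \<Rightarrow> 'a \<Rightarrow> int poly" where
  "KL_build v 0 u = (if u = v then 1 else 0)"
| "KL_build v (Suc k) u = (if u \<in> WJ \<and> ble u v \<and> len v - len u = Suc k
     then low_part (Suc k) (- (\<Sum>\<sigma>\<in>pint u v - {u}. R u \<sigma> * KL_build v k \<sigma>)) else KL_build v k u)"

lemma KL_build_stable: "len v - len u \<le> k \<Longrightarrow> KL_build v k u = KL_build v (len v - len u) u"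
proof (induction k)
  case (Suc k)
  show ?case
  proof (cases "len v - len u = Suc k")
    case False thus ?thesis using Suc by simp
  qed simp
qed simp

lemma KL_build_not_le: assumes "\<not> ble u v" "v \<in> carrier G" shows "KL_build v k u = 0"
  using assms by (induction k) auto

text \<open>The sum \<open>K\<close> of the terms with \<open>\<sigma> \<noteq> u\<close> must be antisymmetric under reversal, so that its
  lower half gives the polynomial. Reversal expands each Kazhdan-Lusztig polynomial in \<open>K\<close> by the
  induction hypothesis, and \<open>Rbar_R_interval\<close> evaluates the resulting double sum to \<open>- K\<close>.\<close>

lemma KL_column_exists:
  assumes v: "v \<in> WJ" shows "KL_column v (\<lambda>u. KL_build v (len v - len u) u)"
proof -
  define p where "p u = KL_build v (len v - len u) u" for u
  have vc: "v \<in> carrier G" using v WJc by auto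
  have p0: "p u = 0" if "\<not> ble u v" for u using KL_build_not_le[OF that vc] by (simp add: p_def)
  have pv: "p v = 1" by (simp add: p_def)
  define K where "K u = (\<Sum>\<sigma>\<in>pint u v - {u}. R u \<sigma> * p \<sigma>)" for u
  have pu: "p u = low_part (len v - len u) (- K u)" if u: "u \<in> WJ" "ble u v" "u \<noteq> v" for u
  proof -
    have "len u < len v" using le_len_strict[OF u(2)] u(3) by blast
    then obtain k where k: "len v - len u = Suc k" by (metis Suc_diff_Suc)
    have "KL_build v k \<sigma> = p \<sigma>" if "\<sigma> \<in> pint u v - {u}" for \<sigma>
    proof -
      have \<sigma>: "\<sigma> \<in> WJ" "ble u \<sigma>" "ble \<sigma> v" "u \<noteq> \<sigma>" using that by (auto simp: pint_iff)
      have "len u < len \<sigma>" using le_len_strict[OF \<sigma>(2)] \<sigma>(4) by blast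
      thus ?thesis unfolding p_def using k KL_build_stable[of v \<sigma> k] by simp
    qed
    thus ?thesis unfolding p_def[of u] k K_def using u k by simp
  qed
  have rev: "q_reverse (len v - len u) (p u) = (\<Sum>\<sigma>\<in>pint u v. R u \<sigma> * p \<sigma>) \<and> degree (p u) \<le> len v - len u"
    if "u \<in> WJ" "ble u v" for u
    using that
  proof (induction "len v - len u" arbitrary: u rule: less_induct)
    case less
    show ?case
    proof (cases "u = v")
      case True
      have "pint v v = {v}" using v vc le_antisym by (auto simp: pint_iff)
      thus ?thesis using True pv R_self[OF v] by simp
    next
      case False
      define n where "n = len v - len u"
      have uc: "u \<in> carrier G" using less.prems WJc by auto
      have luv: "len u < len v" using le_len_strict[OF less.prems(2)] False by blast
      have IH: "q_reverse (len v - len \<sigma>) (p \<sigma>) = (\<Sum>\<tau>\<in>pint \<sigma> v. R \<sigma> \<tau> * p \<tau>)" "degree (p \<sigma>) \<le> len v - len \<sigma>"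
        "len \<sigma> - len u + (len v - len \<sigma>) = n"
        if "\<sigma> \<in> pint u v - {u}" for \<sigma>
      proof -
        have \<sigma>: "\<sigma> \<in> WJ" "ble u \<sigma>" "ble \<sigma> v" "u \<noteq> \<sigma>" using that by (auto simp: pint_iff)
        have "len u < len \<sigma>" using le_len_strict[OF \<sigma>(2)] \<sigma>(4) by blast
        thus "q_reverse (len v - len \<sigma>) (p \<sigma>) = (\<Sum>\<tau>\<in>pint \<sigma> v. R \<sigma> \<tau> * p \<tau>)" "degree (p \<sigma>) \<le> len v - len \<sigma>"
          "len \<sigma> - len u + (len v - len \<sigma>) = n"
          using less.hyps[of \<sigma>] \<sigma> le_len[OF \<sigma>(3)] by (auto simp: n_def)
      qed
      have trm: "q_reverse n (R u \<sigma> * p \<sigma>) = Rbar u \<sigma> * (\<Sum>\<tau>\<in>pint \<sigma> v. R \<sigma> \<tau> * p \<tau>) \<and> degree (R u \<sigma> * p \<sigma>) \<le> n"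
        if "\<sigma> \<in> pint u v - {u}" for \<sigma>
      proof -
        have \<sigma>c: "\<sigma> \<in> carrier G" using that WJc by (auto simp: pint_iff)
        show ?thesis unfolding IH(3)[OF that, symmetric]
          using q_reverse_mult[OF R_deg[OF less.prems(1) \<sigma>c] IH(2)[OF that]] IH(1)[OF that] IH(2)[OF that]
            R_deg[OF less.prems(1) \<sigma>c] degree_mult_le[of "R u \<sigma>" "p \<sigma>"] by (simp add: Rbar_def)
      qed
      have fin: "finite (pint u v - {u})" "finite (pint u v)" using pint_finite[OF vc] by auto
      have Kdeg: "degree (K u) \<le> n" unfolding K_def using trm fin by (intro degree_sum_le) auto
      have "q_reverse n (K u) = (\<Sum>\<sigma>\<in>pint u v - {u}. Rbar u \<sigma> * (\<Sum>\<tau>\<in>pint \<sigma> v. R \<sigma> \<tau> * p \<tau>))"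
        unfolding K_def using trm q_reverse_sum[OF fin(1), of "\<lambda>\<sigma>. R u \<sigma> * p \<sigma>" n] by simp
      also have "\<dots> = (\<Sum>\<sigma>\<in>pint u v - {u}. \<Sum>\<tau>\<in>{\<tau>\<in>pint u v. ble \<sigma> \<tau>}. Rbar u \<sigma> * R \<sigma> \<tau> * p \<tau>)"
      proof (intro sum.cong refl)
        fix \<sigma> assume \<sigma>: "\<sigma> \<in> pint u v - {u}"
        have "ble u \<sigma>" using \<sigma> by (simp add: pint_iff)
        hence "pint \<sigma> v = {\<tau>\<in>pint u v. ble \<sigma> \<tau>}" using le_trans[OF \<open>ble u \<sigma>\<close>] by (auto simp: pint_iff)
        thus "Rbar u \<sigma> * (\<Sum>\<tau>\<in>pint \<sigma> v. R \<sigma> \<tau> * p \<tau>) = (\<Sum>\<tau>\<in>{\<tau>\<in>pint u v. ble \<sigma> \<tau>}. Rbar u \<sigma> * R \<sigma> \<tau> * p \<tau>)"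
          by (simp add: sum_distrib_left mult.assoc)
      qed
      also have "\<dots> = (\<Sum>\<tau>\<in>pint u v. \<Sum>\<sigma>\<in>{\<sigma>\<in>pint u v - {u}. ble \<sigma> \<tau>}. Rbar u \<sigma> * R \<sigma> \<tau> * p \<tau>)"
        using sum.swap_restrict[OF fin] by simp
      also have "\<dots> = (\<Sum>\<tau>\<in>pint u v. if \<tau> = u then 0 else - (R u \<tau> * p \<tau>))"
      proof (intro sum.cong refl)
        fix \<tau> assume \<tau>: "\<tau> \<in> pint u v"
        hence \<tau>': "\<tau> \<in> WJ" "ble u \<tau>" "ble \<tau> v" by (auto simp: pint_iff)
        have set: "{\<sigma>\<in>pint u v - {u}. ble \<sigma> \<tau>} = pint u \<tau> - {u}" using le_trans[OF _ \<tau>'(3)] by (auto simp: pint_iff)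
        have "u \<in> pint u \<tau>" using less.prems \<tau>' uc by (simp add: pint_iff)
        hence "(\<Sum>\<sigma>\<in>pint u \<tau>. Rbar u \<sigma> * R \<sigma> \<tau>) = Rbar u u * R u \<tau> + (\<Sum>\<sigma>\<in>pint u \<tau> - {u}. Rbar u \<sigma> * R \<sigma> \<tau>)"
          using sum.remove[OF pint_finite[OF WJc[OF \<tau>'(1)]]] by blast
        moreover have "Rbar u u = 1" using R_self[OF less.prems(1)] by (simp add: Rbar_def)
        ultimately have "(\<Sum>\<sigma>\<in>pint u \<tau> - {u}. Rbar u \<sigma> * R \<sigma> \<tau>) = (if u = \<tau> then 1 else 0) - R u \<tau>"
          using Rbar_R_interval[OF less.prems(1) \<tau>'(1,2)] by simp
        thus "(\<Sum>\<sigma>\<in>{\<sigma>\<in>pint u v - {u}. ble \<sigma> \<tau>}. Rbar u \<sigma> * R \<sigma> \<tau> * p \<tau>) = (if \<tau> = u then 0 else - (R u \<tau> * p \<tau>))"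
          unfolding set sum_distrib_right[symmetric] using R_self[OF less.prems(1)] by auto
      qed
      also have "\<dots> = (\<Sum>\<tau>\<in>pint u v - {u}. - (R u \<tau> * p \<tau>))"
        using fin by (intro sum.mono_neutral_cong_right) auto
      also have "\<dots> = - K u" unfolding K_def by (simp add: sum_negf)
      finally have anti: "q_reverse n (K u) = - K u" .
      have n0: "n > 0" using luv by (simp add: n_def)
      have "q_reverse n (p u) = p u + K u"
        using q_reverse_low_part[OF anti Kdeg n0] pu[OF less.prems False] by (simp add: n_def)
      moreover have "degree (p u) \<le> n" using degree_low_part[OF n0, of "- K u"] pu[OF less.prems False] by (simp add: n_def)
      ultimately show ?thesis using pint_split[OF less.prems(1) v less.prems(2), of p] by (simp add: n_def K_def)
    qed
  qed
  have "KL_column v p" unfolding KL_column_def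
  proof (intro conjI ballI impI)
    fix u assume u: "u \<in> WJ"
    { assume "\<not> ble u v" thus "p u = 0" using p0 by simp }
    { assume a: "ble u v \<and> u \<noteq> v"
      hence "len u < len v" using le_len_strict by blast
      thus "2 * degree (p u) + 1 \<le> len v - len u" using pu[OF u] a degree_low_part by simp }
    show "q_reverse (len v - len u) (p u) = (\<Sum>\<sigma>\<in>pint u v. R u \<sigma> * p \<sigma>)"
    proof (cases "ble u v")
      case True thus ?thesis using rev u by blast
    next
      case False
      hence "pint u v = {}" using le_trans pint_iff by blast
      thus ?thesis using p0[OF False] by simp
    qed
  qed (rule pv)
  thus ?thesis unfolding p_def .
qed

lemma P_family_iff:
  "parabolic_P_family G S J x P \<longleftrightarrow>
    (\<forall>u v. u \<notin> WJ \<or> v \<notin> WJ \<longrightarrow> P u v = 0) \<and> (\<forall>v\<in>WJ. KL_column v (\<lambda>u. P u v))"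
proof -
  have "(\<Sum>\<sigma>\<in>pint u v. parabolic_R G S J x u \<sigma> * P \<sigma> v) = (\<Sum>\<sigma>\<in>pint u v. R u \<sigma> * P \<sigma> v)" if "u \<in> WJ" for u v
    using parabolic_R_eq[OF J x that] by (intro sum.cong) (auto simp: pint_iff)
  thus ?thesis unfolding parabolic_P_family_def KL_column_def bruhat_less_def by auto
qed

lemma parabolic_P_family: "parabolic_P_family G S J x (parabolic_P G S J x)"
proof -
  let ?P = "\<lambda>u v. if u \<in> WJ \<and> v \<in> WJ then KL_build v (len v - len u) u else 0"
  have "KL_column v (\<lambda>u. ?P u v)" if "v \<in> WJ" for v
  proof -
    have "(\<Sum>\<sigma>\<in>pint u v. R u \<sigma> * ?P \<sigma> v) = (\<Sum>\<sigma>\<in>pint u v. R u \<sigma> * KL_build v (len v - len \<sigma>) \<sigma>)" for u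
      using that by (intro sum.cong) (auto simp: pint_iff)
    thus ?thesis using KL_column_exists[OF that] that unfolding KL_column_def by simp
  qed
  hence ex: "parabolic_P_family G S J x ?P" unfolding P_family_iff by simp
  have un: "P = ?P" if P: "parabolic_P_family G S J x P" for P
  proof (intro ext)
    fix u v show "P u v = ?P u v"
      using P KL_column_unique[OF _ _ KL_column_exists, of v "\<lambda>u. P u v" u] unfolding P_family_iff by auto
  qed
  show ?thesis unfolding parabolic_P_def by (rule theI[of "parabolic_P_family G S J x", OF ex un])
qed

lemma parabolic_P_column: "v \<in> WJ \<Longrightarrow> KL_column v (\<lambda>u. parabolic_P G S J x u v)"
  using parabolic_P_family unfolding P_family_iff by blast

lemma parabolic_P_unique:
  "v \<in> WJ \<Longrightarrow> KL_column v p \<Longrightarrow> u \<in> WJ \<Longrightarrow> parabolic_P G S J x u v = p u"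
  using KL_column_unique parabolic_P_column by blast

end


context coxeter begin

section \<open>R-polynomials of short edge intervals\<close>

lemma short_edge_path:
  assumes sh: "short_edge_interval G S u v" and p: "(edge ^^ k) x y" and x: "ble u x" and y: "ble y v"
  shows "len y = len x + k"
  using p x
proof (induction k arbitrary: x)
  case (Suc k)
  obtain x' where x': "edge x x'" "(edge ^^ k) x' y" using Suc.prems(1) by (meson relpowp_Suc_D2)
  have c: "x \<in> carrier G" "x' \<in> carrier G" using edge_carrier x' by auto
  have ux': "ble u x'" using le_trans[OF Suc.prems(2) edge_le[OF x'(1)]] .
  have "ble x' y" using x'(2) c le_path by blast
  hence x'v: "ble x' v" using le_trans y by blast
  have xv: "ble x v" using le_trans[OF edge_le[OF x'(1)] x'v] .
  have "len x' = len x + 1"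
    using sh x'(1) c ux' x'v Suc.prems(2) xv unfolding short_edge_interval_def bruhat_interval_def by blast
  thus ?case using Suc.IH[OF x'(2) ux'] by simp
qed simp

lemma nonparabolic_atom_finite:
  assumes "J \<subseteq> S" "u \<in> carrier G" "v \<in> carrier G" shows "finite {r\<in>J. ble (u \<otimes> r) v}"
proof (rule finite_subset)
  show "{r\<in>J. ble (u \<otimes> r) v} \<subseteq> coset_below J u v" by (auto simp: coset_below_def generate.incl)
  show "finite (coset_below J u v)" using coset_below_finite[OF assms] .
qed

lemma card_atoms_split:
  assumes J: "J \<subseteq> S" and u: "u \<in> MR J" and v: "v \<in> carrier G"
  shows "card (atoms u v) = card (parabolic_atoms G S J u v) + card {r\<in>J. ble (u \<otimes> r) v}"
proof -
  have uc: "u \<in> carrier G" using u MR_carrier by auto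
  let ?r = "{r\<in>J. ble (u \<otimes> r) v}"
  have p: "parabolic_atoms G S J u v = atoms u v \<inter> MR J"
    by (auto simp: parabolic_atoms_def atoms_def cover_iff)
  have l: "len (u \<otimes> r) = len u + 1" if "r \<in> J" for r
    using MR_len[OF J u, of r] that J len_S by (auto simp: generate.incl)
  have "atoms u v - MR J = (\<lambda>r. u \<otimes> r) ` ?r"
  proof (intro Set.set_eqI iffI)
    fix a assume a: "a \<in> atoms u v - MR J"
    then obtain r where "r \<in> J" "a = u \<otimes> r" using nonparabolic_atom[OF J u, of a] by (auto simp: atoms_def)
    thus "a \<in> (\<lambda>r. u \<otimes> r) ` ?r" using a by (auto simp: atoms_def)
  next
    fix a assume "a \<in> (\<lambda>r. u \<otimes> r) ` ?r"
    then obtain r where r: "r \<in> J" "ble (u \<otimes> r) v" "a = u \<otimes> r" by blast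
    have rS: "r \<in> S" "r \<in> carrier G" using r J by auto
    have "u \<otimes> r \<notin> MR J"
    proof
      assume "u \<otimes> r \<in> MR J"
      hence "r = \<one>" using MR_unique[OF J u] r(1) generate.incl by metis
      thus False using len_S[OF rS(1)] by simp
    qed
    moreover have "ble u (u \<otimes> r)" using MR_le[OF J u, of r] r by (simp add: generate.incl)
    ultimately show "a \<in> atoms u v - MR J" using r l by (simp add: atoms_def)
  qed
  moreover have "inj_on (\<lambda>r. u \<otimes> r) ?r" using uc J by (intro inj_onI) (auto simp: S_carrier subsetD)
  ultimately have "card (atoms u v - MR J) = card ?r" using card_image by metis
  moreover have "card (atoms u v) = card (atoms u v \<inter> MR J) + card (atoms u v - MR J)"
    using card_Int_Diff[OF atoms_finite[OF v]] .
  ultimately show ?thesis unfolding p by simp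
qed

text \<open>The part of the interval in the coset of \<open>u\<close>, in terms of the poset and its parabolic atoms: an
  element outside the coset has a projection \<open>\<sigma> > u\<close> below it, and gradedness of the minimal
  representatives gives a parabolic atom below \<open>\<sigma>\<close>.\<close>

lemma nonparabolic_interval:
  assumes J: "J \<subseteq> S" and u: "u \<in> MR J" and v: "v \<in> carrier G"
  shows "(\<lambda>z. u \<otimes> z) ` coset_below J u v =
     {y. ble u y \<and> ble y v \<and> (\<forall>a\<in>parabolic_atoms G S J u v. \<not> ble a y)}"
proof (intro Set.set_eqI iffI)
  fix y assume "y \<in> (\<lambda>z. u \<otimes> z) ` coset_below J u v"
  then obtain z where z: "z \<in> par J" "ble (u \<otimes> z) v" "y = u \<otimes> z" by (auto simp: coset_below_def)
  have "\<not> ble a y" if "a \<in> parabolic_atoms G S J u v" for a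
  proof
    assume "ble a y"
    hence "ble a u" using le_MR[OF J _ u z(1)] that z by (auto simp: parabolic_atoms_def)
    thus False using le_len that by (fastforce simp: parabolic_atoms_def cover_iff)
  qed
  thus "y \<in> {y. ble u y \<and> ble y v \<and> (\<forall>a\<in>parabolic_atoms G S J u v. \<not> ble a y)}"
    using z MR_le[OF J u] by auto
next
  fix y assume y: "y \<in> {y. ble u y \<and> ble y v \<and> (\<forall>a\<in>parabolic_atoms G S J u v. \<not> ble a y)}"
  have yc: "y \<in> carrier G" using y le_carrier by blast
  obtain \<sigma> z where \<sigma>: "\<sigma> \<in> MR J" "z \<in> par J" "y = \<sigma> \<otimes> z" using MR_decomp[OF J yc] .
  have us: "ble u \<sigma>" using le_MR[OF J u \<sigma>(1,2)] y \<sigma> by simp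
  have sy: "ble \<sigma> y" using MR_le[OF J \<sigma>(1,2)] \<sigma> by simp
  have "u = \<sigma>"
  proof (rule ccontr)
    assume "u \<noteq> \<sigma>"
    then obtain a where a: "a \<in> MR J" "edge u a" "len a = len u + 1" "ble a \<sigma>"
      using MR_graded[OF J u \<sigma>(1) us] by blast
    have ay: "ble a y" using le_trans[OF a(4) sy] .
    hence "ble a v" using le_trans y by blast
    hence "a \<in> parabolic_atoms G S J u v" using a edge_le by (simp add: parabolic_atoms_def cover_iff)
    thus False using ay y by blast
  qed
  thus "y \<in> (\<lambda>z. u \<otimes> z) ` coset_below J u v" using \<sigma> y by (auto simp: coset_below_def)
qed

lemma RJ_empty: assumes "u \<in> carrier G" "v \<in> carrier G" shows "RJ {} (- 1) u v = Rf u v"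
proof -
  have p: "par {} = {\<one>}" using generate_empty by simp
  show ?thesis
  proof (cases "ble u v")
    case True
    hence "coset_below {} u v = {\<one>}" using assms by (auto simp: coset_below_def p)
    thus ?thesis using assms by (simp add: RJ_def)
  next
    case False
    hence "coset_below {} u v = {}" using assms by (auto simp: coset_below_def p)
    thus ?thesis using Rf_le[OF assms(2,1)] False by (auto simp: RJ_def)
  qed
qed

end

context coxeter_parabolic begin

text \<open>When all paths from \<open>u\<close> to \<open>v\<close> have the same number of edges, the recursion has a single term:
  for \<open>u < s u\<close> and \<open>s v < v\<close>, a relation \<open>s u \<le> s v\<close> would give a saturated path there, and
  by \<open>path_left_up\<close> a path from \<open>u\<close> to \<open>v\<close> that is too short. A hypothesis on
  paths, rather than on the edges inside the interval, passes to the smaller pairs directly. The exponent \<open>m\<close> drops exactly in the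
  step with \<open>s u = u r\<close>.\<close>

lemma R_short:
  assumes "u \<in> WJ" "v \<in> WJ" "ble u v" "\<And>k. (edge ^^ k) u v \<Longrightarrow> len v = len u + k"
  defines "n \<equiv> len v - len u" and "m \<equiv> card {r\<in>J. ble (u \<otimes> r) v}"
  shows "m \<le> n \<and> R u v = (q - 1) ^ (n - m) * (q - 1 - x) ^ m"
  using assms(1-4) unfolding n_def m_def
proof (induction "len v" arbitrary: u v rule: less_induct)
  case less
  have c: "u \<in> carrier G" "v \<in> carrier G" using less.prems WJc by auto
  have Jp: "r \<in> par J" "r \<in> S" "r \<in> carrier G" "len r = 1" if "r \<in> J" for r
    using that J len_S by (auto simp: generate.incl)
  have lr: "len (w \<otimes> r) = len w + 1" if "r \<in> J" "w \<in> WJ" for r w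
    using MR_len[OF J that(2) Jp(1)[OF that(1)]] Jp(4)[OF that(1)] by simp
  show ?case
  proof (cases "v = \<one>")
    case True
    hence u1: "u = \<one>" using le_len[OF less.prems(3)] len_eq_0[OF c(1)] by simp
    have e: "{r\<in>J. ble (u \<otimes> r) v} = {}" using le_len[of _ v] True u1 Jp by fastforce
    show ?thesis unfolding e using True u1 R_self less.prems by simp
  next
    case False
    obtain s where s: "s \<in> S" "len v = len (s \<otimes> v) + 1" using left_descent[OF c(2) False] .
    have sc: "s \<in> carrier G" using s by auto
    have sv: "s \<otimes> v \<in> WJ" "len (s \<otimes> v) < len v" using MR_left_down[OF J less.prems(2) s(1)] s by auto
    have cc: "s \<otimes> u \<in> carrier G" "s \<otimes> v \<in> carrier G" using sc c by auto
    have ss: "s \<otimes> (s \<otimes> u) = u" "s \<otimes> (s \<otimes> v) = v" using s c by (auto simp: S_cancel)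
    have rec: "R u v = LJ J x s (\<lambda>w. R w (s \<otimes> v)) u" using RJ_rec[OF J x less.prems(1) s(1) c(2) sv(2)] .
    have svv: "ble (s \<otimes> v) v" using S_le[OF s(1) c(2) sv(2)] .
    have as': "s \<otimes> (u \<otimes> r) = s \<otimes> u \<otimes> r" if "r \<in> J" for r using Jp[OF that] sc c by (simp add: m_assoc)
    have lift_path: "(edge ^^ k) u v" if "(edge ^^ k) (s \<otimes> u) (s \<otimes> v)" for k
      using path_left_up[OF that s(1) cc(1)] s ss by simp
    show ?thesis
    proof (cases "len (s \<otimes> u) < len u")
      case True
      have lu: "len u = len (s \<otimes> u) + 1" using len_S_cases[OF s(1) c(1)] True by auto
      have su: "s \<otimes> u \<in> WJ" using MR_left_down[OF J less.prems(1) s(1) True] .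
      have l: "ble (s \<otimes> u) (s \<otimes> v)" using le_left_down[OF less.prems(3) s(1) True] .
      have pth: "len (s \<otimes> v) = len (s \<otimes> u) + k" if "(edge ^^ k) (s \<otimes> u) (s \<otimes> v)" for k
        using less.prems(4)[OF lift_path[OF that]] s lu by simp
      have "ble (u \<otimes> r) v \<longleftrightarrow> ble (s \<otimes> u \<otimes> r) (s \<otimes> v)" if r: "r \<in> J" for r
      proof
        assume "ble (u \<otimes> r) v"
        from le_left_down[OF this s(1)] show "ble (s \<otimes> u \<otimes> r) (s \<otimes> v)"
          unfolding as'[OF r] using lr[OF r less.prems(1)] lr[OF r su] lu by simp
      next
        assume "ble (s \<otimes> u \<otimes> r) (s \<otimes> v)"
        from le_left_up[OF this s(1)] have "ble (s \<otimes> (s \<otimes> u \<otimes> r)) v" using ss s by simp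
        thus "ble (u \<otimes> r) v" using ss Jp[OF r] sc c S_cancel[OF s(1), of "u \<otimes> r"] by (simp add: m_assoc)
      qed
      hence "{r\<in>J. ble (u \<otimes> r) v} = {r\<in>J. ble (s \<otimes> u \<otimes> r) (s \<otimes> v)}" by blast
      moreover have "len v - len u = len (s \<otimes> v) - len (s \<otimes> u)" using s lu by simp
      moreover have "R u v = R (s \<otimes> u) (s \<otimes> v)" using rec True by (simp add: LJ_def)
      ultimately show ?thesis using less.hyps[OF sv(2) su sv(1) l pth] by simp
    next
      case nd: False
      hence up: "len u < len (s \<otimes> u)" using S_asym[OF s(1) c(1)] by blast
      have lu: "len (s \<otimes> u) = len u + 1" using len_S_cases[OF s(1) c(1)] up by auto
      have u: "ble u (s \<otimes> v)" using lift_below[OF less.prems(3) s(1) up sv(2)] .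
      have nsu: "\<not> ble (s \<otimes> u) (s \<otimes> v)"
      proof
        assume b: "ble (s \<otimes> u) (s \<otimes> v)"
        from less.prems(4)[OF lift_path[OF saturated_path[OF b]]] show False using le_len[OF b] lu s by simp
      qed
      have e: "edge (s \<otimes> v) v" using edge_S[OF s(1) cc(2)] s ss by simp
      have pth: "len (s \<otimes> v) = len u + k" if "(edge ^^ k) u (s \<otimes> v)" for k
        using less.prems(4)[of "Suc k"] that e s by (metis Suc_eq_plus1 add_Suc_right add_right_cancel relpowp_Suc_I)
      note IH = less.hyps[OF sv(2) less.prems(1) sv(1) u pth]
      have n: "len v - len u = Suc (len (s \<otimes> v) - len u)" using s le_len[OF u] by simp
      have desc: "ble (u \<otimes> r) v \<longleftrightarrow> ble (u \<otimes> r) (s \<otimes> v)" if r: "r \<in> J" "len (u \<otimes> r) < len (s \<otimes> (u \<otimes> r))" for r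
        using lift_below[OF _ s(1) r(2) sv(2)] le_trans[OF _ svv] by blast
      show ?thesis
      proof (cases "s \<otimes> u \<in> WJ")
        case True
        have "len (u \<otimes> r) < len (s \<otimes> (u \<otimes> r))" if "r \<in> J" for r
          unfolding as'[OF that] using lr[OF that True] lr[OF that less.prems(1)] lu by simp
        hence "{r\<in>J. ble (u \<otimes> r) v} = {r\<in>J. ble (u \<otimes> r) (s \<otimes> v)}" using desc by blast
        moreover have "R u v = (q - 1) * R u (s \<otimes> v)"
          using rec nd True R_zero[OF True cc(2) nsu] by (simp add: LJ_def)
        ultimately show ?thesis using IH n by (simp add: Suc_diff_le)
      next
        case False
        obtain r0 where r0: "r0 \<in> J" "s \<otimes> u = u \<otimes> r0" using MR_left_up[OF J less.prems(1) s(1) up False] .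
        have "len (u \<otimes> r) < len (s \<otimes> (u \<otimes> r))" if r: "r \<in> J" "r \<noteq> r0" for r
        proof -
          have e: "s \<otimes> (u \<otimes> r) = u \<otimes> (r0 \<otimes> r)" using as'[OF r(1)] r0 Jp[OF r(1)] Jp[OF r0(1)] c by (simp add: m_assoc)
          have "r0 \<otimes> r \<noteq> \<one>" using r Jp[OF r(1)] Jp[OF r0(1)] by (metis S_cancel r_one)
          hence "len (r0 \<otimes> r) \<noteq> 0" using len_eq_0 Jp[OF r(1)] Jp[OF r0(1)] by simp
          hence "len (r0 \<otimes> r) = 2" using len_S_cases_right[OF Jp(2)[OF r(1)] Jp(3)[OF r0(1)]] Jp(4)[OF r0(1)] by auto
          moreover have "r0 \<otimes> r \<in> par J" using Jp r r0 subgroup.m_closed[OF par_sub[OF J]] by blast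
          ultimately show ?thesis unfolding e using MR_len[OF J less.prems(1)] lr[OF r(1) less.prems(1)] by simp
        qed
        hence "{r\<in>J. ble (u \<otimes> r) v} - {r0} = {r\<in>J. ble (u \<otimes> r) (s \<otimes> v)} - {r0}" using desc by blast
        moreover have "ble (u \<otimes> r0) v" using lift_above[OF less.prems(3) s(1) sv(2)] r0 by simp
        moreover have "\<not> ble (u \<otimes> r0) (s \<otimes> v)" using nsu r0 by simp
        ultimately have ins: "{r\<in>J. ble (u \<otimes> r) v} = insert r0 {r\<in>J. ble (u \<otimes> r) (s \<otimes> v)}"
            "r0 \<notin> {r\<in>J. ble (u \<otimes> r) (s \<otimes> v)}" using r0(1) by auto
        have "card {r\<in>J. ble (u \<otimes> r) v} = Suc (card {r\<in>J. ble (u \<otimes> r) (s \<otimes> v)})"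
          unfolding ins(1) using ins(2) nonparabolic_atom_finite[OF J c(1) cc(2)] by simp
        moreover have "R u v = (q - 1 - x) * R u (s \<otimes> v)" using rec nd False by (simp add: LJ_def)
        ultimately show ?thesis using IH n by simp
      qed
    qed
  qed
qed

end

context coxeter begin

section \<open>Deodhar's formula for parabolic Kazhdan-Lusztig polynomials\<close>

text \<open>The right-hand side satisfies the defining conditions. In the last one, reversal turns
  \<open>(- 1)\<^sup>l\<close> into \<open>(- q)\<^sup>l\<close>, so that the ordinary R-polynomials are summed to parabolic
  ones; then the second argument is split as \<open>\<sigma> z\<close>, and \<open>RJ_right\<close> restores the signs, as
  \<open>q - 1 - x = - 1\<close> for \<open>x = q\<close>.\<close>

lemma parabolic_P_q:
  assumes J: "J \<subseteq> S" and uv: "u \<in> MR J" "v \<in> MR J"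
  shows "parabolic_P G S J q u v = (\<Sum>z\<in>coset_below J u v. (- 1) ^ len z * ordinary_P G S (u \<otimes> z) v)"
proof -
  interpret Q: coxeter_parabolic G S J q by unfold_locales (use J in auto)
  interpret E: coxeter_parabolic G S "{}" "- 1" by unfold_locales auto
  define p where "p u = (\<Sum>z\<in>coset_below J u v. (- 1) ^ len z * ordinary_P G S (u \<otimes> z) v)" for u
  let ?P = "\<lambda>y. ordinary_P G S y v"
  have vc: "v \<in> carrier G" using uv MR_carrier by auto
  have ord: "E.KL_column v ?P" using E.parabolic_P_column[of v] vc by (simp add: ordinary_P_def)
  have P0: "?P y = 0" if "y \<in> carrier G" "\<not> ble y v" for y using ord that unfolding E.KL_column_def by simp
  have Pd: "2 * degree (?P y) + 1 \<le> len v - len y" if "ble y v" "y \<noteq> v" for y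
    using ord that le_carrier[OF that(1)] unfolding E.KL_column_def by simp
  have Pv: "?P v = 1" using ord unfolding E.KL_column_def by simp
  have Pr: "q_reverse (len v - len y) (?P y) = (\<Sum>\<sigma>\<in>{y. ble y v}. Rf y \<sigma> * ?P \<sigma>)" if "y \<in> carrier G" for y
  proof -
    have "q_reverse (len v - len y) (?P y) = (\<Sum>\<sigma>\<in>E.pint y v. RJ {} (- 1) y \<sigma> * ?P \<sigma>)"
      using ord that unfolding E.KL_column_def by simp
    also have "\<dots> = (\<Sum>\<sigma>\<in>E.pint y v. Rf y \<sigma> * ?P \<sigma>)"
      using RJ_empty[OF that] by (intro sum.cong) (auto simp: E.pint_iff)
    also have "\<dots> = (\<Sum>\<sigma>\<in>{y. ble y v}. Rf y \<sigma> * ?P \<sigma>)"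
    proof (rule sum.mono_neutral_left)
      show "finite {y. ble y v}" using finite_lower[OF vc] .
      show "E.pint y v \<subseteq> {y. ble y v}" by (auto simp: E.pint_iff)
      show "\<forall>\<sigma>\<in>{y. ble y v} - E.pint y v. Rf y \<sigma> * ?P \<sigma> = 0"
      proof
        fix \<sigma> assume s: "\<sigma> \<in> {y. ble y v} - E.pint y v"
        hence "\<sigma> \<in> carrier G" "\<not> ble y \<sigma>" using le_carrier[of \<sigma> v] by (auto simp: E.pint_iff)
        hence "Rf y \<sigma> = 0" using Rf_le[OF _ that] by blast
        thus "Rf y \<sigma> * ?P \<sigma> = 0" by simp
      qed
    qed
    finally show ?thesis .
  qed
  have Zc: "z \<in> carrier G" if "z \<in> par J" for z using that par_closed[OF J] by auto
  have "Q.KL_column v p" unfolding Q.KL_column_def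
  proof (intro conjI ballI impI)
    have "z = \<one>" if "z \<in> par J" "ble (v \<otimes> z) v" for z
      using MR_len[OF J uv(2) that(1)] le_len[OF that(2)] len_eq_0[OF Zc[OF that(1)]] by auto
    hence "coset_below J v v = {\<one>}" using vc generate.one by (auto simp: coset_below_def)
    thus "p v = 1" using Pv vc by (simp add: p_def)
  next
    fix u assume u: "u \<in> MR J" and "\<not> ble u v"
    hence "coset_below J u v = {}" using MR_le[OF J u] le_trans unfolding coset_below_def by blast
    thus "p u = 0" by (simp add: p_def)
  next
    fix u assume u: "u \<in> MR J" and a: "ble u v \<and> u \<noteq> v"
    have "degree ((- 1) ^ len z * ?P (u \<otimes> z)) \<le> (len v - len u - 1) div 2" if "z \<in> coset_below J u v" for z
    proof -
      have z: "z \<in> par J" "ble (u \<otimes> z) v" using that by (auto simp: coset_below_def)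
      have "u \<otimes> z \<noteq> v"
      proof
        assume e: "u \<otimes> z = v"
        hence "z = \<one>" using MR_unique[OF J u uv(2) z(1)] by simp
        thus False using e a u MR_carrier by auto
      qed
      hence "2 * degree (?P (u \<otimes> z)) + 1 \<le> len v - len (u \<otimes> z)" using Pd z by blast
      moreover have "degree ((- 1) ^ len z * ?P (u \<otimes> z)) = degree (?P (u \<otimes> z))"
        by (cases "even (len z)") auto
      ultimately show ?thesis using MR_len[OF J u z(1)] by simp
    qed
    hence "degree (p u) \<le> (len v - len u - 1) div 2" unfolding p_def
      using coset_below_finite[OF J _ vc] u MR_carrier by (intro degree_sum_le) auto
    moreover have "len u < len v" using le_len_strict a by blast
    ultimately show "2 * degree (p u) + 1 \<le> len v - len u" by linarith
  next
    fix u assume u: "u \<in> MR J"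
    have uc: "u \<in> carrier G" using u MR_carrier by auto
    have fin: "finite (coset_below J u v)" using coset_below_finite[OF J uc vc] .
    have t: "q_reverse (len v - len u) ((- 1) ^ len z * ?P (u \<otimes> z)) =
        (\<Sum>\<sigma>\<in>{y. ble y v}. (- q) ^ len z * Rf (u \<otimes> z) \<sigma> * ?P \<sigma>) \<and> degree ((- 1) ^ len z * ?P (u \<otimes> z)) \<le> len v - len u"
      if "z \<in> coset_below J u v" for z
    proof -
      have z: "z \<in> par J" "ble (u \<otimes> z) v" using that by (auto simp: coset_below_def)
      have l: "len (u \<otimes> z) = len u + len z" using MR_len[OF J u z(1)] .
      have e: "len v - len u = len z + (len v - len (u \<otimes> z))" using l le_len[OF z(2)] by simp
      have d: "degree (?P (u \<otimes> z)) \<le> len v - len (u \<otimes> z)" using Pd[OF z(2)] Pv by (cases "u \<otimes> z = v") auto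
      have d1: "degree ((- 1 :: int poly) ^ len z) \<le> len z" by (cases "even (len z)") auto
      have qr: "q_reverse k ((- 1) ^ k) = (- q) ^ k" for k
      proof -
        have "q_reverse k ((- 1) ^ k) = monom ((- 1) ^ k) k"
          by (cases "even k") (auto simp: q_reverse_def)
        also have "\<dots> = (- q) ^ k"
        proof -
          have "- q = monom (- 1) 1" by (simp add: q_var_def monom_Suc monom_0)
          thus ?thesis by (simp add: monom_power)
        qed
        finally show ?thesis .
      qed
      have "q_reverse (len v - len u) ((- 1) ^ len z * ?P (u \<otimes> z)) =
          (- q) ^ len z * q_reverse (len v - len (u \<otimes> z)) (?P (u \<otimes> z))"
        unfolding e q_reverse_mult[OF d1 d] qr ..
      also have "\<dots> = (\<Sum>\<sigma>\<in>{y. ble y v}. (- q) ^ len z * Rf (u \<otimes> z) \<sigma> * ?P \<sigma>)"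
        using Pr[of "u \<otimes> z"] uc Zc[OF z(1)] by (simp add: sum_distrib_left mult.assoc)
      finally show ?thesis using degree_mult_le[of "(- 1) ^ len z" "?P (u \<otimes> z)"] d d1 e by simp
    qed
    have "q_reverse (len v - len u) (p u) = (\<Sum>z\<in>coset_below J u v. \<Sum>\<sigma>\<in>{y. ble y v}. (- q) ^ len z * Rf (u \<otimes> z) \<sigma> * ?P \<sigma>)"
      unfolding p_def using t q_reverse_sum[OF fin, of "\<lambda>z. (- 1) ^ len z * ?P (u \<otimes> z)" "len v - len u"] by simp
    also have "\<dots> = (\<Sum>\<sigma>\<in>{y. ble y v}. (\<Sum>z\<in>coset_below J u v. (- q) ^ len z * Rf (u \<otimes> z) \<sigma>) * ?P \<sigma>)"
      by (subst sum.swap) (simp add: sum_distrib_right)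
    also have "\<dots> = (\<Sum>\<sigma>\<in>{y. ble y v}. RJ J q u \<sigma> * ?P \<sigma>)"
    proof (intro sum.cong refl)
      fix \<sigma> assume s: "\<sigma> \<in> {y. ble y v}"
      hence "coset_below J u \<sigma> \<subseteq> coset_below J u v" using le_trans unfolding coset_below_def by blast
      hence "RJ J q u \<sigma> = (\<Sum>z\<in>coset_below J u v. (- q) ^ len z * Rf (u \<otimes> z) \<sigma>)"
        using s le_carrier fin by (intro RJ_eq[OF J uc]) (auto simp: coset_below_def)
      thus "(\<Sum>z\<in>coset_below J u v. (- q) ^ len z * Rf (u \<otimes> z) \<sigma>) * ?P \<sigma> = RJ J q u \<sigma> * ?P \<sigma>" by simp
    qed
    also have "\<dots> = (\<Sum>(\<sigma>, z)\<in>(SIGMA \<sigma>:{\<sigma>\<in>MR J. ble \<sigma> v}. coset_below J \<sigma> v). RJ J q u (\<sigma> \<otimes> z) * ?P (\<sigma> \<otimes> z))"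
    proof -
      have bij: "bij_betw (\<lambda>(\<sigma>, z). \<sigma> \<otimes> z) (SIGMA \<sigma>:{\<sigma>\<in>MR J. ble \<sigma> v}. coset_below J \<sigma> v) {y. ble y v}"
        unfolding bij_betw_def
      proof (intro conjI inj_onI Set.set_eqI iffI)
        fix a b assume "a \<in> (SIGMA \<sigma>:{\<sigma>\<in>MR J. ble \<sigma> v}. coset_below J \<sigma> v)" "b \<in> (SIGMA \<sigma>:{\<sigma>\<in>MR J. ble \<sigma> v}. coset_below J \<sigma> v)"
          "(case a of (\<sigma>, z) \<Rightarrow> \<sigma> \<otimes> z) = (case b of (\<sigma>, z) \<Rightarrow> \<sigma> \<otimes> z)"
        thus "a = b" using MR_decomp_unique[OF J] by (auto simp: coset_below_def)
      next
        fix y assume "y \<in> {y. ble y v}"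
        hence y: "ble y v" "y \<in> carrier G" using le_carrier by auto
        obtain \<sigma> z where \<sigma>: "\<sigma> \<in> MR J" "z \<in> par J" "y = \<sigma> \<otimes> z" using MR_decomp[OF J y(2)] .
        have "ble \<sigma> v" using MR_le[OF J \<sigma>(1,2)] y \<sigma> le_trans by blast
        thus "y \<in> (\<lambda>(\<sigma>, z). \<sigma> \<otimes> z) ` (SIGMA \<sigma>:{\<sigma>\<in>MR J. ble \<sigma> v}. coset_below J \<sigma> v)"
          using \<sigma> y by (intro image_eqI[of _ _ "(\<sigma>, z)"]) (auto simp: coset_below_def)
      qed (auto simp: coset_below_def)
      show ?thesis
        using sum.reindex_bij_betw[OF bij, of "\<lambda>y. RJ J q u y * ?P y"] by (simp add: case_prod_unfold)
    qed
    also have "\<dots> = (\<Sum>\<sigma>\<in>{\<sigma>\<in>MR J. ble \<sigma> v}. \<Sum>z\<in>coset_below J \<sigma> v. RJ J q u (\<sigma> \<otimes> z) * ?P (\<sigma> \<otimes> z))"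
      using finite_lower[OF vc] coset_below_finite[OF J _ vc] MR_carrier by (intro sum.Sigma[symmetric]) auto
    also have "\<dots> = (\<Sum>\<sigma>\<in>{\<sigma>\<in>MR J. ble \<sigma> v}. RJ J q u \<sigma> * p \<sigma>)"
    proof (intro sum.cong refl)
      fix \<sigma> assume \<sigma>: "\<sigma> \<in> {\<sigma>\<in>MR J. ble \<sigma> v}"
      have "RJ J q u (\<sigma> \<otimes> z) = (- 1) ^ len z * RJ J q u \<sigma>" if "z \<in> coset_below J \<sigma> v" for z
        using RJ_right[OF J _ u, of q \<sigma> z] that \<sigma> by (auto simp: coset_below_def)
      thus "(\<Sum>z\<in>coset_below J \<sigma> v. RJ J q u (\<sigma> \<otimes> z) * ?P (\<sigma> \<otimes> z)) = RJ J q u \<sigma> * p \<sigma>"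
        unfolding p_def sum_distrib_left by (intro sum.cong refl) (simp add: mult_ac)
    qed
    also have "\<dots> = (\<Sum>\<sigma>\<in>Q.pint u v. RJ J q u \<sigma> * p \<sigma>)"
      using finite_lower[OF vc] Q.R_zero[OF u] MR_carrier by (intro sum.mono_neutral_right) (auto simp: Q.pint_iff)
    finally show "q_reverse (len v - len u) (p u) = (\<Sum>\<sigma>\<in>Q.pint u v. RJ J q u \<sigma> * p \<sigma>)" .
  qed
  from Q.parabolic_P_unique[OF uv(2) this uv(1)] show ?thesis by (simp add: p_def)
qed

lemma parabolic_P_q_interval:
  assumes J: "J \<subseteq> S" and uv: "u \<in> MR J" "v \<in> MR J"
  shows "parabolic_P G S J q u v =
    (\<Sum>y\<in>{y. ble u y \<and> ble y v \<and> (\<forall>a\<in>parabolic_atoms G S J u v. \<not> ble a y)}. (- 1) ^ (len y - len u) * ordinary_P G S y v)"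
proof -
  have c: "u \<in> carrier G" "v \<in> carrier G" using uv MR_carrier by auto
  have "inj_on (\<lambda>z. u \<otimes> z) (coset_below J u v)"
    using c par_closed[OF J] by (intro inj_onI) (auto simp: coset_below_def subsetD)
  moreover have "len (u \<otimes> z) - len u = len z" if "z \<in> coset_below J u v" for z
    using MR_len[OF J uv(1)] that by (auto simp: coset_below_def)
  ultimately show ?thesis
    unfolding parabolic_P_q[OF assms] nonparabolic_interval[OF J uv(1) c(2), symmetric]
    by (simp add: sum.reindex)
qed

end


section \<open>Transport along an isomorphism of intervals\<close>

locale interval_iso = A: coxeter G1 S1 + B: coxeter G2 S2
  for G1 :: "('a, 'm) monoid_scheme" and S1 and G2 :: "('b, 'n) monoid_scheme" and S2 +
  fixes u1 v1 u2 v2 \<phi>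
  assumes iso: "poset_iso (bruhat_interval G1 S1 u1 v1) (bruhat_le G1 S1)
      (bruhat_interval G2 S2 u2 v2) (bruhat_le G2 S2) \<phi>"
    and le1: "bruhat_le G1 S1 u1 v1"
begin

definition I1 :: "'a set" where "I1 = {y. A.ble u1 y \<and> A.ble y v1}"
definition I2 :: "'b set" where "I2 = {y. B.ble u2 y \<and> B.ble y v2}"

lemma I_eq: "bruhat_interval G1 S1 u1 v1 = I1" "bruhat_interval G2 S2 u2 v2 = I2"
  using A.le_carrier B.le_carrier by (auto simp: I1_def I2_def bruhat_interval_def)

lemma bij: "bij_betw \<phi> I1 I2" and phi_le: "x \<in> I1 \<Longrightarrow> y \<in> I1 \<Longrightarrow> A.ble x y \<longleftrightarrow> B.ble (\<phi> x) (\<phi> y)"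
  using iso unfolding poset_iso_def I_eq by auto

lemma inj: "inj_on \<phi> I1" and phi_in: "x \<in> I1 \<Longrightarrow> \<phi> x \<in> I2" and phi_img: "\<phi> ` I1 = I2"
  using bij by (auto simp: bij_betw_def)

lemma surj: assumes "z \<in> I2" obtains y where "y \<in> I1" "\<phi> y = z"
  using assms unfolding phi_img[symmetric] by blast

lemma ends1: "u1 \<in> I1" "v1 \<in> I1"
  using le1 A.le_carrier[OF le1] by (auto simp: I1_def)

lemma le2: "B.ble u2 v2"
  using phi_in[OF ends1(1)] B.le_trans unfolding I2_def by blast

lemma ends2: "u2 \<in> I2" "v2 \<in> I2"
  using le2 B.le_carrier[OF le2] by (auto simp: I2_def)

lemma phi_ends: "\<phi> u1 = u2" "\<phi> v1 = v2"
proof -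
  obtain a where a: "a \<in> I1" "\<phi> a = u2" using surj ends2(1) by blast
  have "A.ble u1 a" using a by (simp add: I1_def)
  hence "B.ble (\<phi> u1) u2" using phi_le[OF ends1(1) a(1)] a by simp
  moreover have "B.ble u2 (\<phi> u1)" using phi_in[OF ends1(1)] by (simp add: I2_def)
  ultimately show "\<phi> u1 = u2" using B.le_antisym by blast
  obtain b where b: "b \<in> I1" "\<phi> b = v2" using surj ends2(2) by blast
  have "A.ble b v1" using b by (simp add: I1_def)
  hence "B.ble v2 (\<phi> v1)" using phi_le[OF b(1) ends1(2)] b by simp
  moreover have "B.ble (\<phi> v1) v2" using phi_in[OF ends1(2)] by (simp add: I2_def)
  ultimately show "\<phi> v1 = v2" using B.le_antisym by blast
qed

lemma between1: "x \<in> I1 \<Longrightarrow> y \<in> I1 \<Longrightarrow> A.ble x z \<Longrightarrow> A.ble z y \<Longrightarrow> z \<in> I1"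
  unfolding I1_def using A.le_trans by blast
lemma between2: "x \<in> I2 \<Longrightarrow> y \<in> I2 \<Longrightarrow> B.ble x z \<Longrightarrow> B.ble z y \<Longrightarrow> z \<in> I2"
  unfolding I2_def using B.le_trans by blast

lemma phi_cover:
  assumes xy: "x \<in> I1" "y \<in> I1" "A.ble x y" and l: "A.len y = A.len x + 1"
  shows "B.len (\<phi> y) = B.len (\<phi> x) + 1"
proof -
  have ne: "\<phi> x \<noteq> \<phi> y" using inj xy l by (metis inj_onD add_cancel_right_right one_neq_zero)
  have le: "B.ble (\<phi> x) (\<phi> y)" using phi_le xy by blast
  obtain b where b: "B.edge (\<phi> x) b" "B.len b = B.len (\<phi> x) + 1" "B.ble b (\<phi> y)"
    using B.graded[OF le ne] .
  have "b \<in> I2" using between2[OF phi_in[OF xy(1)] phi_in[OF xy(2)] B.edge_le[OF b(1)] b(3)] .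
  then obtain c where c: "c \<in> I1" "\<phi> c = b" using surj by blast
  have xc: "A.ble x c" and cy: "A.ble c y"
    using phi_le[OF xy(1) c(1)] phi_le[OF c(1) xy(2)] c(2) b(3) B.edge_le[OF b(1)] by simp_all
  have "x \<noteq> c" using c b(2) by auto
  hence "A.len x < A.len c" using A.le_len_strict[OF xc] by blast
  hence "c = y" using A.le_len_eq[OF cy] l by simp
  thus ?thesis using b c by simp
qed

text \<open>An isomorphism preserves covers, hence length differences.\<close>

lemma phi_len:
  assumes "x \<in> I1" "y \<in> I1" "A.ble x y"
  shows "B.len (\<phi> y) = B.len (\<phi> x) + (A.len y - A.len x)"
  using assms
proof (induction "A.len y - A.len x" arbitrary: x rule: less_induct)
  case less
  show ?case
  proof (cases "x = y")
    case False
    obtain a where a: "A.edge x a" "A.len a = A.len x + 1" "A.ble a y" using A.graded[OF less.prems(3) False] .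
    have aI: "a \<in> I1" using between1[OF less.prems(1,2) A.edge_le[OF a(1)] a(3)] .
    have xl: "A.len a \<le> A.len y" using A.le_len[OF a(3)] .
    have "B.len (\<phi> y) = B.len (\<phi> a) + (A.len y - A.len a)" using less.hyps[OF _ aI less.prems(2) a(3)] a(2) xl by simp
    thus ?thesis using phi_cover[OF less.prems(1) aI A.edge_le[OF a(1)] a(2)] a(2) xl by simp
  qed simp
qed

lemma phi_atoms:
  assumes xy: "x \<in> I1" "y \<in> I1" "A.ble x y"
  shows "\<phi> ` A.atoms x y = B.atoms (\<phi> x) (\<phi> y)"
proof (intro Set.set_eqI iffI)
  fix b assume "b \<in> \<phi> ` A.atoms x y"
  then obtain a where a: "A.ble x a" "A.len a = A.len x + 1" "A.ble a y" "b = \<phi> a" by (auto simp: A.atoms_def)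
  have "a \<in> I1" using between1[OF xy(1,2) a(1,3)] .
  thus "b \<in> B.atoms (\<phi> x) (\<phi> y)"
    using phi_le[OF xy(1) \<open>a \<in> I1\<close>] phi_le[OF \<open>a \<in> I1\<close> xy(2)] phi_cover[OF xy(1) \<open>a \<in> I1\<close> a(1,2)] a
    by (simp add: B.atoms_def)
next
  fix b assume b: "b \<in> B.atoms (\<phi> x) (\<phi> y)"
  hence b': "B.ble (\<phi> x) b" "B.ble b (\<phi> y)" "B.len b = B.len (\<phi> x) + 1" by (auto simp: B.atoms_def)
  have "b \<in> I2" using between2[OF phi_in[OF xy(1)] phi_in[OF xy(2)] b'(1,2)] .
  then obtain a where a: "a \<in> I1" "\<phi> a = b" using surj by blast
  have le: "A.ble x a" "A.ble a y" using phi_le[OF xy(1) a(1)] phi_le[OF a(1) xy(2)] a(2) b' by simp_all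
  have "A.len a = A.len x + 1" using phi_len[OF xy(1) a(1) le(1)] a b'(3) A.le_len[OF le(1)] by simp
  thus "b \<in> \<phi> ` A.atoms x y" using a le by (auto simp: A.atoms_def)
qed

lemma phi_card_atoms:
  assumes xy: "x \<in> I1" "y \<in> I1" "A.ble x y"
  shows "card (B.atoms (\<phi> x) (\<phi> y)) = card (A.atoms x y)"
proof -
  have "A.atoms x y \<subseteq> I1" using between1[OF xy(1,2)] by (auto simp: A.atoms_def)
  hence "inj_on \<phi> (A.atoms x y)" using inj inj_on_subset by blast
  thus ?thesis using card_image phi_atoms[OF xy] by metis
qed

lemma phi_short:
  assumes "short_edge_interval G1 S1 u1 v1" shows "short_edge_interval G2 S2 u2 v2"
  unfolding B.short_edge_iff
proof (intro allI impI)
  fix x y assume a: "B.ble u2 x \<and> B.ble x y \<and> B.ble y v2 \<and> B.len y = B.len x + 3"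
  have "x \<in> I2" "y \<in> I2" using a B.le_trans unfolding I2_def by blast+
  then obtain x' y' where x': "x' \<in> I1" "\<phi> x' = x" and y': "y' \<in> I1" "\<phi> y' = y" using surj by metis
  have le: "A.ble x' y'" using phi_le[OF x'(1) y'(1)] x'(2) y'(2) a by simp
  have "A.len y' = A.len x' + 3" using phi_len[OF x'(1) y'(1) le] x' y' a A.le_len[OF le] by simp
  moreover have "A.ble u1 x'" "A.ble y' v1" using x' y' by (auto simp: I1_def)
  ultimately have "card (A.atoms x' y') \<noteq> 2" using assms le unfolding A.short_edge_iff by blast
  thus "card (B.atoms x y) \<noteq> 2" using phi_card_atoms[OF x'(1) y'(1) le] x' y' by simp
qed

lemma sub_iso:
  assumes xy: "x \<in> I1" "y \<in> I1" "A.ble x y"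
  shows "interval_iso G1 S1 G2 S2 x y (\<phi> x) (\<phi> y) \<phi>"
proof (unfold_locales)
  let ?K1 = "bruhat_interval G1 S1 x y" and ?K2 = "bruhat_interval G2 S2 (\<phi> x) (\<phi> y)"
  have sub: "?K1 \<subseteq> I1" using between1[OF xy(1,2)] by (auto simp: bruhat_interval_def)
  have "\<phi> ` ?K1 = ?K2"
  proof (intro Set.set_eqI iffI)
    fix b assume "b \<in> \<phi> ` ?K1"
    then obtain a where a: "A.ble x a" "A.ble a y" "b = \<phi> a" by (auto simp: bruhat_interval_def)
    have "a \<in> I1" using between1[OF xy(1,2) a(1,2)] .
    hence "B.ble (\<phi> x) b" "B.ble b (\<phi> y)" using phi_le[OF xy(1), of a] phi_le[OF _ xy(2), of a] a by simp_all
    thus "b \<in> ?K2" using B.le_carrier by (auto simp: bruhat_interval_def)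
  next
    fix b assume "b \<in> ?K2"
    hence b: "B.ble (\<phi> x) b" "B.ble b (\<phi> y)" by (auto simp: bruhat_interval_def)
    have "b \<in> I2" using between2[OF phi_in[OF xy(1)] phi_in[OF xy(2)] b] .
    then obtain a where a: "a \<in> I1" "\<phi> a = b" using surj by blast
    have "A.ble x a" "A.ble a y" using phi_le[OF xy(1) a(1)] phi_le[OF a(1) xy(2)] a(2) b by simp_all
    thus "b \<in> \<phi> ` ?K1" using a A.le_carrier by (auto simp: bruhat_interval_def)
  qed
  moreover have "inj_on \<phi> ?K1" using inj sub inj_on_subset by blast
  ultimately show "poset_iso ?K1 (bruhat_le G1 S1) ?K2 (bruhat_le G2 S2) \<phi>"
    unfolding poset_iso_def bij_betw_def using phi_le sub by blast
  show "A.ble x y" using xy by simp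
qed

lemma short_sub:
  assumes "short_edge_interval G1 S1 u1 v1" "x \<in> I1" "y \<in> I1"
  shows "short_edge_interval G1 S1 x y"
  using assms(1) between1[OF assms(2,3)]
  unfolding short_edge_interval_def bruhat_interval_def I1_def by blast

text \<open>Only two numbers enter \<open>R_short\<close>: the length difference, and the number of atoms outside the
  minimal representatives.\<close>

lemma R_invariant:
  assumes sh: "short_edge_interval G1 S1 u1 v1" and J: "J1 \<subseteq> S1" "J2 \<subseteq> S2" and x: "x \<in> {- 1, q_var}"
    and uv: "u1 \<in> A.MR J1" "v1 \<in> A.MR J1" "u2 \<in> B.MR J2" "v2 \<in> B.MR J2"
    and c: "card (parabolic_atoms G1 S1 J1 u1 v1) = card (parabolic_atoms G2 S2 J2 u2 v2)"
  shows "A.RJ J1 x u1 v1 = B.RJ J2 x u2 v2"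
proof -
  interpret A': coxeter_parabolic G1 S1 J1 x by unfold_locales (use J x in auto)
  interpret B': coxeter_parabolic G2 S2 J2 x by unfold_locales (use J x in auto)
  have vc: "v1 \<in> carrier G1" "v2 \<in> carrier G2" using uv A.MR_carrier B.MR_carrier by auto
  have uc: "u1 \<in> carrier G1" "u2 \<in> carrier G2" using uv A.MR_carrier B.MR_carrier by auto
  have l: "B.len v2 - B.len u2 = A.len v1 - A.len u1"
    using phi_len[OF ends1 le1] phi_ends by simp
  have "card (B.atoms u2 v2) = card (A.atoms u1 v1)" using phi_card_atoms[OF ends1 le1] phi_ends by simp
  hence m: "card {r\<in>J1. A.ble (u1 \<otimes>\<^bsub>G1\<^esub> r) v1} = card {r\<in>J2. B.ble (u2 \<otimes>\<^bsub>G2\<^esub> r) v2}"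
    using A.card_atoms_split[OF J(1) uv(1) vc(1)] B.card_atoms_split[OF J(2) uv(3) vc(2)] c by simp
  show ?thesis
    using A'.R_short[OF uv(1,2) le1] A.short_edge_path[OF sh _ A.le_refl[OF uc(1)] A.le_refl[OF vc(1)]]
      B'.R_short[OF uv(3,4) le2] B.short_edge_path[OF phi_short[OF sh] _ B.le_refl[OF uc(2)] B.le_refl[OF vc(2)]] l m
    by simp
qed

text \<open>Both polynomials solve the equation of \<open>q_reverse_split_unique\<close>, and the sums in it are
  matched term by term by \<open>R_invariant\<close> on smaller intervals and the induction hypothesis.\<close>

lemma P_invariant:
  assumes sh: "short_edge_interval G1 S1 u1 v1" and J: "J1 \<subseteq> S1" "J2 \<subseteq> S2" and x: "x \<in> {- 1, q_var}"
    and uv: "u1 \<in> A.MR J1" "v1 \<in> A.MR J1" "u2 \<in> B.MR J2" "v2 \<in> B.MR J2"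
    and img: "\<And>y. y \<in> I1 \<Longrightarrow> y \<in> A.MR J1 \<longleftrightarrow> \<phi> y \<in> B.MR J2"
    and y: "y \<in> I1" "y \<in> A.MR J1"
  shows "parabolic_P G1 S1 J1 x y v1 = parabolic_P G2 S2 J2 x (\<phi> y) v2"
  using y
proof (induction "A.len v1 - A.len y" arbitrary: y rule: less_induct)
  case less
  interpret A': coxeter_parabolic G1 S1 J1 x by unfold_locales (use J x in auto)
  interpret B': coxeter_parabolic G2 S2 J2 x by unfold_locales (use J x in auto)
  let ?P1 = "\<lambda>y. parabolic_P G1 S1 J1 x y v1" and ?P2 = "\<lambda>y. parabolic_P G2 S2 J2 x y v2"
  note P1 = A'.parabolic_P_column[OF uv(2)] and P2 = B'.parabolic_P_column[OF uv(4)]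
  have fy: "\<phi> y \<in> I2" "\<phi> y \<in> B.MR J2" using less.prems img phi_in by auto
  have yv: "A.ble y v1" "B.ble (\<phi> y) v2" using less.prems fy by (auto simp: I1_def I2_def)
  show ?case
  proof (cases "y = v1")
    case True
    thus ?thesis using P1 P2 phi_ends unfolding A'.KL_column_def B'.KL_column_def by simp
  next
    case False
    have nv: "\<phi> y \<noteq> v2" using False inj less.prems ends1 phi_ends by (metis inj_onD)
    define n where "n = A.len v1 - A.len y"
    have n2: "B.len v2 - B.len (\<phi> y) = n"
      using phi_len[OF less.prems(1) ends1(2) yv(1)] phi_ends by (simp add: n_def)
    let ?k1 = "\<Sum>\<sigma>\<in>A'.pint y v1 - {y}. A.RJ J1 x y \<sigma> * ?P1 \<sigma>"
    let ?k2 = "\<Sum>\<sigma>\<in>B'.pint (\<phi> y) v2 - {\<phi> y}. B.RJ J2 x (\<phi> y) \<sigma> * ?P2 \<sigma>"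
    have e1: "q_reverse n (?P1 y) = ?P1 y + ?k1" "2 * degree (?P1 y) + 1 \<le> n"
      using P1 less.prems(2) yv False A'.pint_split[OF less.prems(2) uv(2) yv(1), of ?P1]
      unfolding A'.KL_column_def n_def by auto
    have e2: "q_reverse n (?P2 (\<phi> y)) = ?P2 (\<phi> y) + ?k2" "2 * degree (?P2 (\<phi> y)) + 1 \<le> n"
      using P2 fy(2) yv nv B'.pint_split[OF fy(2) uv(4) yv(2), of ?P2]
      unfolding B'.KL_column_def n2[symmetric] by auto
    have I: "\<sigma> \<in> I1" if "\<sigma> \<in> A'.pint y v1" for \<sigma>
      using that between1[OF less.prems(1) ends1(2)] by (simp add: A'.pint_iff)
    have bij: "bij_betw \<phi> (A'.pint y v1 - {y}) (B'.pint (\<phi> y) v2 - {\<phi> y})"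
      unfolding bij_betw_def
    proof (intro conjI Set.set_eqI iffI)
      show "inj_on \<phi> (A'.pint y v1 - {y})" using I inj by (meson DiffD1 inj_on_subset subsetI)
    next
      fix b assume "b \<in> \<phi> ` (A'.pint y v1 - {y})"
      then obtain a where a: "a \<in> A'.pint y v1" "a \<noteq> y" "b = \<phi> a" by blast
      have "b \<noteq> \<phi> y" using a I inj less.prems by (metis inj_onD)
      moreover have "b \<in> B'.pint (\<phi> y) v2"
        using a I[OF a(1)] img phi_le[OF less.prems(1) I[OF a(1)]] phi_in[OF I[OF a(1)]]
        by (auto simp: A'.pint_iff B'.pint_iff I2_def)
      ultimately show "b \<in> B'.pint (\<phi> y) v2 - {\<phi> y}" by simp
    next
      fix b assume "b \<in> B'.pint (\<phi> y) v2 - {\<phi> y}"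
      hence b: "b \<in> B.MR J2" "B.ble (\<phi> y) b" "B.ble b v2" "b \<noteq> \<phi> y" by (auto simp: B'.pint_iff)
      have "b \<in> I2" using between2[OF fy(1) ends2(2) b(2,3)] .
      then obtain a where a: "a \<in> I1" "\<phi> a = b" using surj by blast
      hence "a \<in> A'.pint y v1 - {y}" using b img phi_le[OF less.prems(1) a(1)] by (auto simp: A'.pint_iff I1_def)
      thus "b \<in> \<phi> ` (A'.pint y v1 - {y})" using a by blast
    qed
    have "?k1 = (\<Sum>\<sigma>\<in>A'.pint y v1 - {y}. B.RJ J2 x (\<phi> y) (\<phi> \<sigma>) * ?P2 (\<phi> \<sigma>))"
    proof (intro sum.cong refl arg_cong2[where f = "(*)"])
      fix \<sigma> assume s: "\<sigma> \<in> A'.pint y v1 - {y}"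
      hence sI: "\<sigma> \<in> I1" "\<sigma> \<in> A.MR J1" "A.ble y \<sigma>" "A.ble \<sigma> v1" "\<sigma> \<noteq> y" using I by (auto simp: A'.pint_iff)
      have "A.len y < A.len \<sigma>" using A.le_len_strict[OF sI(3)] sI(5) by blast
      thus "?P1 \<sigma> = ?P2 (\<phi> \<sigma>)" using less.hyps[OF _ sI(1,2)] A.le_len[OF sI(4)] by simp
      interpret sub: interval_iso G1 S1 G2 S2 y \<sigma> "\<phi> y" "\<phi> \<sigma>" \<phi> using sub_iso[OF less.prems(1) sI(1,3)] .
      have at: "\<phi> ` A.atoms y \<sigma> = B.atoms (\<phi> y) (\<phi> \<sigma>)" using phi_atoms[OF less.prems(1) sI(1,3)] .
      have aI: "A.atoms y \<sigma> \<subseteq> I1" using between1[OF less.prems(1) sI(1)] by (auto simp: A.atoms_def)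
      have pa: "parabolic_atoms G1 S1 J1 y \<sigma> = A.atoms y \<sigma> \<inter> A.MR J1"
        "parabolic_atoms G2 S2 J2 (\<phi> y) (\<phi> \<sigma>) = B.atoms (\<phi> y) (\<phi> \<sigma>) \<inter> B.MR J2"
        by (auto simp: parabolic_atoms_def A.atoms_def B.atoms_def A.cover_iff B.cover_iff)
      have "\<phi> ` parabolic_atoms G1 S1 J1 y \<sigma> = parabolic_atoms G2 S2 J2 (\<phi> y) (\<phi> \<sigma>)"
        unfolding pa at[symmetric] using aI img by auto
      moreover have "inj_on \<phi> (parabolic_atoms G1 S1 J1 y \<sigma>)" unfolding pa using inj aI by (meson inj_on_subset le_infI1)
      ultimately have "card (parabolic_atoms G1 S1 J1 y \<sigma>) = card (parabolic_atoms G2 S2 J2 (\<phi> y) (\<phi> \<sigma>))"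
        using card_image by metis
      moreover have "\<phi> \<sigma> \<in> B.MR J2" using img sI by simp
      ultimately show "A.RJ J1 x y \<sigma> = B.RJ J2 x (\<phi> y) (\<phi> \<sigma>)"
        using sub.R_invariant[OF short_sub[OF sh less.prems(1) sI(1)] J x less.prems(2) sI(2) fy(2)] by simp
    qed
    also have "\<dots> = ?k2" using sum.reindex_bij_betw[OF bij, of "\<lambda>\<sigma>. B.RJ J2 x (\<phi> y) \<sigma> * ?P2 \<sigma>"] .
    finally show ?thesis using q_reverse_split_unique[OF e1(1) _ e1(2) e2(2)] e2(1) by simp
  qed
qed

lemma ordinary_P_invariant:
  assumes "short_edge_interval G1 S1 u1 v1"
  shows "ordinary_P G1 S1 u1 v1 = ordinary_P G2 S2 u2 v2"
proof -
  have c: "u1 \<in> carrier G1" "v1 \<in> carrier G1" "u2 \<in> carrier G2" "v2 \<in> carrier G2"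
    using A.le_carrier[OF le1] B.le_carrier[OF le2] by auto
  have "y \<in> A.MR {} \<longleftrightarrow> \<phi> y \<in> B.MR {}" if "y \<in> I1" for y
    using that phi_in[OF that] A.le_carrier B.le_carrier by (auto simp: I1_def I2_def)
  from P_invariant[OF assms _ _ _ _ _ _ _ this ends1(1), of "- 1"] show ?thesis
    using c phi_ends by (simp add: ordinary_P_def)
qed

text \<open>The isomorphism respects the parabolic atoms, but perhaps not the other minimal representatives.
  The formula \<open>parabolic_P_q_interval\<close> speaks of ordinary polynomials and parabolic atoms only.\<close>

lemma parabolic_P_q_invariant:
  assumes sh: "short_edge_interval G1 S1 u1 v1" and J: "J1 \<subseteq> S1" "J2 \<subseteq> S2"
    and uv: "u1 \<in> A.MR J1" "v1 \<in> A.MR J1" "u2 \<in> B.MR J2" "v2 \<in> B.MR J2"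
    and at: "bij_betw \<phi> (parabolic_atoms G1 S1 J1 u1 v1) (parabolic_atoms G2 S2 J2 u2 v2)"
  shows "parabolic_P G1 S1 J1 q_var u1 v1 = parabolic_P G2 S2 J2 q_var u2 v2"
proof -
  let ?X1 = "{y. A.ble u1 y \<and> A.ble y v1 \<and> (\<forall>a\<in>parabolic_atoms G1 S1 J1 u1 v1. \<not> A.ble a y)}"
  let ?X2 = "{y. B.ble u2 y \<and> B.ble y v2 \<and> (\<forall>a\<in>parabolic_atoms G2 S2 J2 u2 v2. \<not> B.ble a y)}"
  have aI: "parabolic_atoms G1 S1 J1 u1 v1 \<subseteq> I1" by (auto simp: parabolic_atoms_def I1_def A.cover_iff)
  have img: "\<phi> ` parabolic_atoms G1 S1 J1 u1 v1 = parabolic_atoms G2 S2 J2 u2 v2" using at by (simp add: bij_betw_def)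
  have na: "(\<forall>a\<in>parabolic_atoms G1 S1 J1 u1 v1. \<not> A.ble a y) \<longleftrightarrow> (\<forall>a\<in>parabolic_atoms G2 S2 J2 u2 v2. \<not> B.ble a (\<phi> y))"
    if "y \<in> I1" for y
    unfolding img[symmetric] using phi_le[OF _ that] aI by blast
  have "bij_betw \<phi> ?X1 ?X2" unfolding bij_betw_def
  proof (intro conjI Set.set_eqI iffI)
    show "inj_on \<phi> ?X1" by (rule inj_on_subset[OF inj]) (auto simp: I1_def)
  next
    fix b assume "b \<in> \<phi> ` ?X1"
    then obtain a where a: "a \<in> ?X1" "b = \<phi> a" by blast
    have "a \<in> I1" using a by (simp add: I1_def)
    thus "b \<in> ?X2" using a na phi_in[of a] by (simp add: I2_def)
  next
    fix b assume b: "b \<in> ?X2"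
    then obtain a where a: "a \<in> I1" "\<phi> a = b" using surj[of b] by (auto simp: I2_def)
    hence "a \<in> ?X1" using na[OF a(1)] b by (simp add: I1_def)
    thus "b \<in> \<phi> ` ?X1" using a by blast
  qed
  note bij = this
  have "(- 1) ^ (A.len y - A.len u1) * ordinary_P G1 S1 y v1 =
      (- 1) ^ (B.len (\<phi> y) - B.len u2) * ordinary_P G2 S2 (\<phi> y) v2" if "y \<in> ?X1" for y
  proof -
    have y: "y \<in> I1" "A.ble y v1" "A.ble u1 y" using that by (auto simp: I1_def)
    interpret sub: interval_iso G1 S1 G2 S2 y v1 "\<phi> y" v2 \<phi> using sub_iso[OF y(1) ends1(2) y(2)] phi_ends by simp
    have "ordinary_P G1 S1 y v1 = ordinary_P G2 S2 (\<phi> y) v2"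
      using sub.ordinary_P_invariant[OF short_sub[OF sh y(1) ends1(2)]] .
    moreover have "B.len (\<phi> y) - B.len u2 = A.len y - A.len u1"
      using phi_len[OF ends1(1) y(1,3)] phi_ends by simp
    ultimately show ?thesis by simp
  qed
  hence "(\<Sum>y\<in>?X1. (- 1) ^ (A.len y - A.len u1) * ordinary_P G1 S1 y v1) =
      (\<Sum>y\<in>?X1. (- 1) ^ (B.len (\<phi> y) - B.len u2) * ordinary_P G2 S2 (\<phi> y) v2)" by (intro sum.cong refl)
  also have "\<dots> = (\<Sum>y\<in>?X2. (- 1) ^ (B.len y - B.len u2) * ordinary_P G2 S2 y v2)"
    using sum.reindex_bij_betw[OF bij, of "\<lambda>y. (- 1) ^ (B.len y - B.len u2) * ordinary_P G2 S2 y v2"] .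
  finally show ?thesis
    unfolding A.parabolic_P_q_interval[OF J(1) uv(1,2)] B.parabolic_P_q_interval[OF J(2) uv(3,4)] .
qed

end

context coxeter begin

lemma parabolic_zero:
  assumes "J \<subseteq> S" "x \<in> {- 1, q_var}" "u \<in> MR J" "v \<in> MR J" "\<not> ble u v"
  shows "parabolic_R G S J x u v = 0" "parabolic_P G S J x u v = 0"
proof -
  interpret coxeter_parabolic G S J x by unfold_locales (use assms in auto)
  show "parabolic_R G S J x u v = 0" using parabolic_R_eq[OF assms(1-4)] R_zero assms WJc by simp
  show "parabolic_P G S J x u v = 0" using parabolic_P_column[OF assms(4)] assms unfolding KL_column_def by blast
qed

lemma bruhat_interval_empty_iff: "bruhat_interval G S u v = {} \<longleftrightarrow> \<not> ble u v"
proof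
  assume "bruhat_interval G S u v = {}"
  thus "\<not> ble u v" using le_carrier[of u v] unfolding bruhat_interval_def by force
next
  assume "\<not> ble u v"
  thus "bruhat_interval G S u v = {}" using le_trans unfolding bruhat_interval_def by blast
qed

end

section \<open>Combinatorial invariance\<close>

lemma coxeter_system_coxeter: "coxeter_system G S \<Longrightarrow> coxeter G S"
  by (simp add: coxeter_def coxeter_axioms_def coxeter_system_def)

lemma invariance:
  fixes W1 :: "('a, 'm) monoid_scheme" and S1 :: "'a set"
    and W2 :: "('b, 'n) monoid_scheme" and S2 :: "'b set"
  assumes W: "coxeter_system W1 S1" "coxeter_system W2 S2"
    and J: "J1 \<subseteq> S1" "J2 \<subseteq> S2"
    and uv: "u1 \<in> min_coset_reps W1 S1 J1" "v1 \<in> min_coset_reps W1 S1 J1"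
      "u2 \<in> min_coset_reps W2 S2 J2" "v2 \<in> min_coset_reps W2 S2 J2"
    and sh: "short_edge_interval W1 S1 u1 v1"
    and iso: "poset_iso (bruhat_interval W1 S1 u1 v1) (bruhat_le W1 S1)
               (bruhat_interval W2 S2 u2 v2) (bruhat_le W2 S2) \<phi>"
    and x: "x \<in> {- 1, q_var}"
  shows "bij_betw \<phi> (parabolic_atoms W1 S1 J1 u1 v1) (parabolic_atoms W2 S2 J2 u2 v2) \<Longrightarrow>
           parabolic_R W1 S1 J1 x u1 v1 = parabolic_R W2 S2 J2 x u2 v2"
    and "bij_betw \<phi> (parabolic_atoms W1 S1 J1 u1 v1) (parabolic_atoms W2 S2 J2 u2 v2) \<Longrightarrow>
           parabolic_P W1 S1 J1 q_var u1 v1 = parabolic_P W2 S2 J2 q_var u2 v2"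
    and "bij_betw \<phi> (parabolic_interval W1 S1 J1 u1 v1) (parabolic_interval W2 S2 J2 u2 v2) \<Longrightarrow>
           parabolic_R W1 S1 J1 x u1 v1 = parabolic_R W2 S2 J2 x u2 v2 \<and>
           parabolic_P W1 S1 J1 x u1 v1 = parabolic_P W2 S2 J2 x u2 v2"
proof -
  interpret A: coxeter W1 S1 using coxeter_system_coxeter[OF W(1)] .
  interpret B: coxeter W2 S2 using coxeter_system_coxeter[OF W(2)] .
  let ?a = "bij_betw \<phi> (parabolic_atoms W1 S1 J1 u1 v1) (parabolic_atoms W2 S2 J2 u2 v2)"
  let ?i = "bij_betw \<phi> (parabolic_interval W1 S1 J1 u1 v1) (parabolic_interval W2 S2 J2 u2 v2)"
  have goal: "(?a \<longrightarrow> parabolic_R W1 S1 J1 x u1 v1 = parabolic_R W2 S2 J2 x u2 v2 \<and>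
      parabolic_P W1 S1 J1 q_var u1 v1 = parabolic_P W2 S2 J2 q_var u2 v2) \<and>
    (?i \<longrightarrow> parabolic_R W1 S1 J1 x u1 v1 = parabolic_R W2 S2 J2 x u2 v2 \<and>
      parabolic_P W1 S1 J1 x u1 v1 = parabolic_P W2 S2 J2 x u2 v2)"
  proof (cases "A.ble u1 v1")
    case False
    have "bruhat_interval W2 S2 u2 v2 = \<phi> ` bruhat_interval W1 S1 u1 v1"
      using iso by (simp add: poset_iso_def bij_betw_def)
    moreover have "bruhat_interval W1 S1 u1 v1 = {}" using False A.bruhat_interval_empty_iff by blast
    ultimately have "bruhat_interval W2 S2 u2 v2 = {}" by (metis image_empty)
    hence "\<not> B.ble u2 v2" using B.bruhat_interval_empty_iff by blast
    thus ?thesis using A.parabolic_zero[OF J(1) _ uv(1,2) False] B.parabolic_zero[OF J(2) _ uv(3,4)] x by auto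
  next
    case True
    interpret I: interval_iso W1 S1 W2 S2 u1 v1 u2 v2 \<phi> by unfold_locales (use iso True in auto)
    have R: "parabolic_R W1 S1 J1 x u1 v1 = parabolic_R W2 S2 J2 x u2 v2" if ?a
      using I.R_invariant[OF sh J x uv bij_betw_same_card[OF that]]
        A.parabolic_R_eq[OF J(1) x uv(1,2)] B.parabolic_R_eq[OF J(2) x uv(3,4)] by simp
    have img: "y \<in> A.MR J1 \<longleftrightarrow> \<phi> y \<in> B.MR J2" if ?i "y \<in> I.I1" for y
    proof
      assume "y \<in> A.MR J1"
      hence "y \<in> parabolic_interval W1 S1 J1 u1 v1" using that I.I_eq by (simp add: parabolic_interval_def)
      thus "\<phi> y \<in> B.MR J2" using bij_betwE[OF that(1)] by (simp add: parabolic_interval_def)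
    next
      assume "\<phi> y \<in> B.MR J2"
      hence "\<phi> y \<in> parabolic_interval W2 S2 J2 u2 v2" using I.phi_in[OF that(2)] I.I_eq by (simp add: parabolic_interval_def)
      moreover have "parabolic_interval W2 S2 J2 u2 v2 = \<phi> ` parabolic_interval W1 S1 J1 u1 v1"
        using that(1) by (simp add: bij_betw_def)
      ultimately have "\<phi> y \<in> \<phi> ` parabolic_interval W1 S1 J1 u1 v1" by metis
      then obtain y' where y': "\<phi> y = \<phi> y'" "y' \<in> parabolic_interval W1 S1 J1 u1 v1" by (rule imageE)
      have "y' \<in> I.I1" using y'(2) I.I_eq by (simp add: parabolic_interval_def)
      hence "y = y'" using inj_onD[OF I.inj y'(1) that(2)] by blast
      thus "y \<in> A.MR J1" using y' by (simp add: parabolic_interval_def)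
    qed
    have atoms: ?a if ?i
    proof -
      have pa: "parabolic_atoms W1 S1 J1 u1 v1 = A.atoms u1 v1 \<inter> A.MR J1"
        "parabolic_atoms W2 S2 J2 u2 v2 = B.atoms u2 v2 \<inter> B.MR J2"
        by (auto simp: parabolic_atoms_def A.atoms_def B.atoms_def A.cover_iff B.cover_iff)
      have aI: "A.atoms u1 v1 \<subseteq> I.I1" by (auto simp: A.atoms_def I.I1_def)
      have at: "\<phi> ` A.atoms u1 v1 = B.atoms u2 v2" using I.phi_atoms[OF I.ends1 True] I.phi_ends by simp
      have "\<phi> ` (A.atoms u1 v1 \<inter> A.MR J1) = B.atoms u2 v2 \<inter> B.MR J2"
        unfolding at[symmetric] using aI img[OF that] by auto
      moreover have "inj_on \<phi> (A.atoms u1 v1 \<inter> A.MR J1)" using I.inj aI by (meson inj_on_subset le_infI1)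
      ultimately show ?thesis unfolding pa bij_betw_def by simp
    qed
    have P: "parabolic_P W1 S1 J1 x u1 v1 = parabolic_P W2 S2 J2 x u2 v2" if ?i
      using I.P_invariant[OF sh J x uv img[OF that] I.ends1(1) uv(1)] I.phi_ends by simp
    show ?thesis using R P atoms I.parabolic_P_q_invariant[OF sh J uv] by blast
  qed
  show "?a \<Longrightarrow> parabolic_R W1 S1 J1 x u1 v1 = parabolic_R W2 S2 J2 x u2 v2"
    and "?a \<Longrightarrow> parabolic_P W1 S1 J1 q_var u1 v1 = parabolic_P W2 S2 J2 q_var u2 v2"
    and "?i \<Longrightarrow> parabolic_R W1 S1 J1 x u1 v1 = parabolic_R W2 S2 J2 x u2 v2 \<and>
           parabolic_P W1 S1 J1 x u1 v1 = parabolic_P W2 S2 J2 x u2 v2"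
    using goal by blast+
qed

theorem theorem1p8:
  fixes W1 :: "('a, 'm) monoid_scheme" and S1 :: "'a set"
    and W2 :: "('b, 'n) monoid_scheme" and S2 :: "'b set"
  assumes "coxeter_system W1 S1" and "coxeter_system W2 S2"
  shows
    "(\<forall>u1\<in>carrier W1. \<forall>v1\<in>carrier W1. \<forall>u2\<in>carrier W2. \<forall>v2\<in>carrier W2.
        short_edge_interval W1 S1 u1 v1 \<and>
        (\<exists>\<phi>. poset_iso (bruhat_interval W1 S1 u1 v1) (bruhat_le W1 S1)
               (bruhat_interval W2 S2 u2 v2) (bruhat_le W2 S2) \<phi>) \<longrightarrow>
        ordinary_R W1 S1 u1 v1 = ordinary_R W2 S2 u2 v2 \<and>
        ordinary_P W1 S1 u1 v1 = ordinary_P W2 S2 u2 v2) \<and>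
     (\<forall>J1 J2. J1 \<subseteq> S1 \<longrightarrow> J2 \<subseteq> S2 \<longrightarrow>
      (\<forall>u1\<in>min_coset_reps W1 S1 J1. \<forall>v1\<in>min_coset_reps W1 S1 J1.
       \<forall>u2\<in>min_coset_reps W2 S2 J2. \<forall>v2\<in>min_coset_reps W2 S2 J2.
        short_edge_interval W1 S1 u1 v1 \<and>
        (\<exists>\<phi>. poset_iso (bruhat_interval W1 S1 u1 v1) (bruhat_le W1 S1)
               (bruhat_interval W2 S2 u2 v2) (bruhat_le W2 S2) \<phi> \<and>
             poset_iso (parabolic_interval W1 S1 J1 u1 v1) (bruhat_le W1 S1)
               (parabolic_interval W2 S2 J2 u2 v2) (bruhat_le W2 S2) \<phi>) \<longrightarrow>
        (\<forall>x\<in>{- 1, q_var}. parabolic_R W1 S1 J1 x u1 v1 = parabolic_R W2 S2 J2 x u2 v2) \<and>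
        (\<forall>x\<in>{- 1, q_var}. parabolic_P W1 S1 J1 x u1 v1 = parabolic_P W2 S2 J2 x u2 v2))) \<and>
     (\<forall>J1 J2. J1 \<subseteq> S1 \<longrightarrow> J2 \<subseteq> S2 \<longrightarrow>
      (\<forall>u1\<in>min_coset_reps W1 S1 J1. \<forall>v1\<in>min_coset_reps W1 S1 J1.
       \<forall>u2\<in>min_coset_reps W2 S2 J2. \<forall>v2\<in>min_coset_reps W2 S2 J2.
        short_edge_interval W1 S1 u1 v1 \<and>
        (\<exists>\<phi>. poset_iso (bruhat_interval W1 S1 u1 v1) (bruhat_le W1 S1)
               (bruhat_interval W2 S2 u2 v2) (bruhat_le W2 S2) \<phi> \<and>
             bij_betw \<phi> (parabolic_atoms W1 S1 J1 u1 v1) (parabolic_atoms W2 S2 J2 u2 v2)) \<longrightarrow>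
        (\<forall>x\<in>{- 1, q_var}. parabolic_R W1 S1 J1 x u1 v1 = parabolic_R W2 S2 J2 x u2 v2) \<and>
        parabolic_P W1 S1 J1 q_var u1 v1 = parabolic_P W2 S2 J2 q_var u2 v2))"
proof -
  interpret A: coxeter W1 S1 using coxeter_system_coxeter[OF assms(1)] .
  interpret B: coxeter W2 S2 using coxeter_system_coxeter[OF assms(2)] .
  note inv = invariance[OF assms]
  have 1: "ordinary_R W1 S1 u1 v1 = ordinary_R W2 S2 u2 v2 \<and> ordinary_P W1 S1 u1 v1 = ordinary_P W2 S2 u2 v2"
    if uv: "u1 \<in> carrier W1" "v1 \<in> carrier W1" "u2 \<in> carrier W2" "v2 \<in> carrier W2"
      and sh: "short_edge_interval W1 S1 u1 v1"
      and iso: "poset_iso (bruhat_interval W1 S1 u1 v1) (bruhat_le W1 S1)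
               (bruhat_interval W2 S2 u2 v2) (bruhat_le W2 S2) \<phi>" for u1 v1 u2 v2 \<phi>
  proof -
    have e: "parabolic_interval W1 S1 {} u1 v1 = bruhat_interval W1 S1 u1 v1"
      "parabolic_interval W2 S2 {} u2 v2 = bruhat_interval W2 S2 u2 v2"
      by (auto simp: parabolic_interval_def bruhat_interval_def)
    have "bij_betw \<phi> (parabolic_interval W1 S1 {} u1 v1) (parabolic_interval W2 S2 {} u2 v2)"
      unfolding e using iso by (simp add: poset_iso_def)
    thus ?thesis unfolding ordinary_R_def ordinary_P_def
      using inv(3)[OF empty_subsetI empty_subsetI _ _ _ _ sh iso, of "- 1"] uv by simp
  qed
  have 2: "(\<forall>x\<in>{- 1, q_var}. parabolic_R W1 S1 J1 x u1 v1 = parabolic_R W2 S2 J2 x u2 v2) \<and>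
      (\<forall>x\<in>{- 1, q_var}. parabolic_P W1 S1 J1 x u1 v1 = parabolic_P W2 S2 J2 x u2 v2)"
    if "J1 \<subseteq> S1" "J2 \<subseteq> S2" "u1 \<in> min_coset_reps W1 S1 J1" "v1 \<in> min_coset_reps W1 S1 J1"
      "u2 \<in> min_coset_reps W2 S2 J2" "v2 \<in> min_coset_reps W2 S2 J2" "short_edge_interval W1 S1 u1 v1"
      "poset_iso (bruhat_interval W1 S1 u1 v1) (bruhat_le W1 S1)
               (bruhat_interval W2 S2 u2 v2) (bruhat_le W2 S2) \<phi>"
      "poset_iso (parabolic_interval W1 S1 J1 u1 v1) (bruhat_le W1 S1)
               (parabolic_interval W2 S2 J2 u2 v2) (bruhat_le W2 S2) \<phi>" for J1 J2 u1 v1 u2 v2 \<phi>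
  proof -
    have "bij_betw \<phi> (parabolic_interval W1 S1 J1 u1 v1) (parabolic_interval W2 S2 J2 u2 v2)"
      using that(9) by (simp add: poset_iso_def)
    thus ?thesis using inv(3)[OF that(1-8)] by blast
  qed
  have 3: "(\<forall>x\<in>{- 1, q_var}. parabolic_R W1 S1 J1 x u1 v1 = parabolic_R W2 S2 J2 x u2 v2) \<and>
      parabolic_P W1 S1 J1 q_var u1 v1 = parabolic_P W2 S2 J2 q_var u2 v2"
    if "J1 \<subseteq> S1" "J2 \<subseteq> S2" "u1 \<in> min_coset_reps W1 S1 J1" "v1 \<in> min_coset_reps W1 S1 J1"
      "u2 \<in> min_coset_reps W2 S2 J2" "v2 \<in> min_coset_reps W2 S2 J2" "short_edge_interval W1 S1 u1 v1"
      "poset_iso (bruhat_interval W1 S1 u1 v1) (bruhat_le W1 S1)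
               (bruhat_interval W2 S2 u2 v2) (bruhat_le W2 S2) \<phi>"
      "bij_betw \<phi> (parabolic_atoms W1 S1 J1 u1 v1) (parabolic_atoms W2 S2 J2 u2 v2)" for J1 J2 u1 v1 u2 v2 \<phi>
    using inv(1)[OF that(1-8) _ that(9)] inv(2)[OF that(1-8) _ that(9), of q_var] by blast
  show ?thesis
    apply (rule conjI[OF _ conjI]; intro allI impI ballI; elim conjE exE)
      apply (rule 1; assumption)
     apply (rule 2; assumption)
    apply (rule 3; assumption)
    done
qed

end
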